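(* Let $X=\{X_t;\ t\in\mathbf{R}_+^N\}$ be a multiparameter Gaussian random field in $\mathbf{R}^d$, with i.i.d. coordinate processes $X^{(1)},\dots,X^{(d)}$, and let $t_0\in\mathbf{R}_+^N$. Let $\widetilde{\alpha}=\widetilde{\alpha}_{X^{(i)}}(t_0)$ be the deterministic local Hölder exponent and $\underline{\alpha}=\underline{\alpha}_{X^{(i)}}(t_0)$ the deterministic local sub-exponent of $X^{(i)}$ at $t_0$ (both independent of $1\le i\le d$). Assume that $\widetilde{\alpha}>0$. Then, almost surely, $$\lim_{\rho\to 0}\dim_{\mathcal H}(\mathrm{Gr}_X(B(t_0,\rho)))\ \ge\ \begin{cases} N/\underline{\alpha} & \text{if } N\le d\,\underline{\alpha},\\ N+d(1-\underline{\alpha}) & \text{if } N> d\,\underline{\alpha},\end{cases}$$ $$\lim_{\rho\to 0}\dim_{\mathcal H}(\mathrm{Gr}_X(B(t_0,\rho)))\ \le\ \min\left\{\frac{N}{\widetilde{\alpha}}\,;\ N+d(1-\widetilde{\alpha})\right\},$$ and $$\lim_{\rho\to 0}\dim_{\mathcal H}(\mathrm{Rg}_X(B(t_0,\rho)))\ \ge\ \begin{cases} N/\underline{\alpha} & \text{if } N\le d\,\underline{\alpha},\\ d & \text{if } N> d\,\underline{\alpha},\end{cases}$$ $$\lim_{\rho\to 0}\dim_{\mathcal H}(\mathrm{Rg}_X(B(t_0,\rho)))\ \le\ \min\left\{\frac{N}{\widetilde{\alpha}}\,;\ d\right\}.$$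
   Context: $\mathbf{R}_+=[0,\infty)$ and $\|\cdot\|$ is the Euclidean norm. A multiparameter Gaussian random field in $\mathbf{R}^d$ is a stochastic process $X=\{X_t;\ t\in\mathbf{R}_+^N\}$ with $X_t=(X^{(1)}_t,\dots,X^{(d)}_t)\in\mathbf{R}^d$, whose coordinate processes $X^{(i)}=\{X^{(i)}_t;\ t\in\mathbf{R}_+^N\}$ are independent real-valued Gaussian processes with the same law. $B(t_0,\rho)$ is the ball of $\mathbf{R}_+^N$ with center $t_0$ and radius $\rho$. For a real-valued Gaussian process $Y=\{Y_t;\ t\in\mathbf{R}_+^N\}$ and $t_0\in\mathbf{R}_+^N$, the deterministic local Hölder exponent is $$\widetilde{\alpha}_Y(t_0)=\sup\Big\{\alpha>0:\ \lim_{\rho\to0}\sup_{s,t\in B(t_0,\rho)}\frac{\mathbf{E}[|Y_t-Y_s|^2]}{\|t-s\|^{2\alpha}}<+\infty\Big\}$$ and the deterministic local sub-exponent is $$\underline{\alpha}_Y(t_0)=\inf\Big\{\alpha>0:\ \lim_{\rho\to0}\inf_{s,t\in B(t_0,\rho)}\frac{\mathbf{E}[|Y_t-Y_s|^2]}{\|t-s\|^{2\alpha}}=+\infty\Big\}$$ (sup and inf over $s\ne t$; $\inf\emptyset=+\infty$, $N/(+\infty)=0$). $\mathrm{Rg}_X(A)=\{X_t;\ t\in A\}$ and $\mathrm{Gr}_X(A)=\{(t,X_t);\ t\in A\}$ are the range and the graph of $X$ over $A\subset\mathbf{R}_+^N$, and $\dim_{\mathcal H}$ is Hausdorff dimension.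
   Formalization: X is taken as any version with continuous paths near t_0 (shown to exist), since the bounds fail for arbitrary versions altered on random null sets; the graph upper bound is claimed only for finite local Hölder exponent, as it fails for X constant in t. *)

theory Defs
  imports "HOL-Probability.Probability"
begin

section \<open>Hausdorff dimension\<close>

text \<open>
  Covering sets are required to be bounded because the diameter of an unbounded set is an
  unspecified real number. Only exponents \<open>s > 0\<close> are used, so that no convention for \<open>0\<^sup>0\<close> is
  needed; this does not affect the infimum defining the dimension.
\<close>

definition hausdorff_premeasure :: "real \<Rightarrow> real \<Rightarrow> 'a::metric_space set \<Rightarrow> ennreal" where
  "hausdorff_premeasure s \<delta> E =
     (INF U \<in> {U :: nat \<Rightarrow> 'a set.
                E \<subseteq> (\<Union>k. U k) \<and> (\<forall>k. bounded (U k) \<and> diameter (U k) \<le> \<delta>)}.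
        (\<Sum>k. ennreal (diameter (U k) powr s)))"

definition hausdorff_outer_measure :: "real \<Rightarrow> 'a::metric_space set \<Rightarrow> ennreal" where
  "hausdorff_outer_measure s E = (SUP \<delta> \<in> {0<..}. hausdorff_premeasure s \<delta> E)"

definition hausdorff_dim :: "'a::metric_space set \<Rightarrow> ereal" where
  "hausdorff_dim E = Inf {ereal s | s. s > 0 \<and> hausdorff_outer_measure s E = 0}"

section \<open>Gaussian processes and fields\<close>

definition orthant :: "(real ^ 'n) set" where
  "orthant = {t. \<forall>i. 0 \<le> t $ i}"

definition orthant_ball :: "real ^ 'n \<Rightarrow> real \<Rightarrow> (real ^ 'n) set" where
  "orthant_ball t0 \<rho> = ball t0 \<rho> \<inter> orthant"

text \<open>Degenerate (almost surely constant) variables count as Gaussian.\<close>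

definition gaussian_rv :: "'w measure \<Rightarrow> ('w \<Rightarrow> real) \<Rightarrow> bool" where
  "gaussian_rv M Z \<longleftrightarrow> Z \<in> borel_measurable M \<and>
     ((\<exists>\<mu> \<sigma>. \<sigma> > 0 \<and> distributed M lborel Z (normal_density \<mu> \<sigma>)) \<or>
      (\<exists>\<mu>. AE \<omega> in M. Z \<omega> = \<mu>))"

definition gaussian_process :: "'w measure \<Rightarrow> 't set \<Rightarrow> ('t \<Rightarrow> 'w \<Rightarrow> real) \<Rightarrow> bool" where
  "gaussian_process M T Y \<longleftrightarrow>
     (\<forall>F c. finite F \<and> F \<subseteq> T \<longrightarrow> gaussian_rv M (\<lambda>\<omega>. \<Sum>t\<in>F. c t * Y t \<omega>))"

definition coord_process ::
    "(real ^ 'n \<Rightarrow> 'w \<Rightarrow> real ^ 'd) \<Rightarrow> 'd \<Rightarrow> real ^ 'n \<Rightarrow> 'w \<Rightarrow> real" where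
  "coord_process X i = (\<lambda>t \<omega>. X t \<omega> $ i)"

text \<open>
  Independence and equality in law of the coordinate processes are understood for the processes
  as random elements of \<open>\<real>\<^sup>T\<close>, \<open>T = orthant\<close>, with the product sigma-algebra.
\<close>

definition gaussian_field :: "'w measure \<Rightarrow> (real ^ 'n \<Rightarrow> 'w \<Rightarrow> real ^ 'd) \<Rightarrow> bool" where
  "gaussian_field M X \<longleftrightarrow>
     (\<forall>i. gaussian_process M orthant (coord_process X i)) \<and>
     prob_space.indep_vars M (\<lambda>i::'d. PiM orthant (\<lambda>t. borel))
       (\<lambda>i \<omega>. \<lambda>t\<in>orthant. coord_process X i t \<omega>) UNIV \<and>
     (\<forall>i j. distr M (PiM orthant (\<lambda>t. borel)) (\<lambda>\<omega>. \<lambda>t\<in>orthant. coord_process X i t \<omega>)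
          = distr M (PiM orthant (\<lambda>t. borel)) (\<lambda>\<omega>. \<lambda>t\<in>orthant. coord_process X j t \<omega>))"

definition modification ::
    "'w measure \<Rightarrow> 't set \<Rightarrow> ('t \<Rightarrow> 'w \<Rightarrow> 'b::topological_space) \<Rightarrow> ('t \<Rightarrow> 'w \<Rightarrow> 'b) \<Rightarrow> bool" where
  "modification M T Y X \<longleftrightarrow>
     (\<forall>t\<in>T. Y t \<in> borel_measurable M \<and> (AE \<omega> in M. Y t \<omega> = X t \<omega>))"

definition continuous_paths_near ::
    "'w measure \<Rightarrow> real ^ 'n \<Rightarrow> (real ^ 'n \<Rightarrow> 'w \<Rightarrow> 'b::topological_space) \<Rightarrow> bool" where
  "continuous_paths_near M t0 Y \<longleftrightarrow>
     (\<exists>\<rho>>0. AE \<omega> in M. continuous_on (orthant_ball t0 \<rho>) (\<lambda>t. Y t \<omega>))"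

section \<open>Deterministic local exponents\<close>

definition increment_ratio ::
    "'w measure \<Rightarrow> (real ^ 'n \<Rightarrow> 'w \<Rightarrow> real) \<Rightarrow> real \<Rightarrow> real ^ 'n \<Rightarrow> real ^ 'n \<Rightarrow> real" where
  "increment_ratio M Y \<alpha> s t =
     (\<integral>\<omega>. \<bar>Y t \<omega> - Y s \<omega>\<bar>\<^sup>2 \<partial>M) / norm (t - s) powr (2 * \<alpha>)"

text \<open>
  The supremum (infimum) below is monotone in \<open>\<rho>\<close>, so its limit as \<open>\<rho>\<close> decreases to \<open>0\<close>
  exists in the extended reals.
\<close>

definition local_holder_exponent ::
    "'w measure \<Rightarrow> (real ^ 'n \<Rightarrow> 'w \<Rightarrow> real) \<Rightarrow> real ^ 'n \<Rightarrow> ereal" where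
  "local_holder_exponent M Y t0 =
     Sup {ereal \<alpha> | \<alpha>. \<alpha> > 0 \<and>
       (\<exists>L. ((\<lambda>\<rho>. SUP (s, t) \<in> {(s, t). s \<in> orthant_ball t0 \<rho> \<and> t \<in> orthant_ball t0 \<rho> \<and> s \<noteq> t}.
                ereal (increment_ratio M Y \<alpha> s t)) \<longlongrightarrow> L) (at_right 0) \<and> L < \<infinity>)}"

definition local_sub_exponent ::
    "'w measure \<Rightarrow> (real ^ 'n \<Rightarrow> 'w \<Rightarrow> real) \<Rightarrow> real ^ 'n \<Rightarrow> ereal" where
  "local_sub_exponent M Y t0 =
     Inf {ereal \<alpha> | \<alpha>. \<alpha> > 0 \<and>
       ((\<lambda>\<rho>. INF (s, t) \<in> {(s, t). s \<in> orthant_ball t0 \<rho> \<and> t \<in> orthant_ball t0 \<rho> \<and> s \<noteq> t}.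
                ereal (increment_ratio M Y \<alpha> s t)) \<longlongrightarrow> \<infinity>) (at_right 0)}"

section \<open>Range and graph\<close>

definition range_over :: "('t \<Rightarrow> 'w \<Rightarrow> 'b) \<Rightarrow> 'w \<Rightarrow> 't set \<Rightarrow> 'b set" where
  "range_over X \<omega> A = {X t \<omega> | t. t \<in> A}"

definition graph_over :: "('t \<Rightarrow> 'w \<Rightarrow> 'b) \<Rightarrow> 'w \<Rightarrow> 't set \<Rightarrow> ('t \<times> 'b) set" where
  "graph_over X \<omega> A = {(t, X t \<omega>) | t. t \<in> A}"

end

theory Submission
  imports Defs
begin

text \<open>
  The upper bounds come from Hoelder continuity: Gaussian moments of all orders and a Borel-Cantelli
  chaining over dyadic grids show that a continuous version is Hoelder near \<open>t\<^sub>0\<close> of every order below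
  \<open>\<alpha>\<close>, and the images of grid cells are then efficient covers. The lower bounds come from the energy
  method: pushing Lebesgue measure on a cube forward along the path, a finite \<open>\<gamma>\<close>-energy
  bounds the dimension below by \<open>\<gamma>\<close>. The expected energy is controlled through the small ball estimate
  \<open>P (\<bar>D\<bar> \<le> r) \<le> 4 r / sqrt (E D\<^sup>2)\<close>, valid for every Gaussian \<open>D\<close>, centred or not, which by
  independence of the coordinates yields the power \<open>d\<close>. For the graph, the kernel
  \<open>\<bar>X\<^sub>t - X\<^sub>s\<bar> powr -\<gamma> * \<bar>t - s\<bar> powr -\<eta>\<close> with \<open>\<gamma> < d\<close> dominates the kernel of order \<open>\<gamma> + \<eta>\<close>, so the same
  moment estimate also covers orders above \<open>d\<close>.
\<close>

section \<open>Bounds for the Hausdorff dimension\<close>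

text \<open>Pathwise dimensions depend on the version of the field, so they are studied for an
  arbitrary modification \<open>Y\<close> with continuous paths near \<open>t0\<close>; positivity
  of the Hoelder exponent makes one exist. Distributional estimates for \<open>X\<close> pass to
  \<open>Y\<close> at pairs of times or on countable grids, and continuity does the rest. The
  exponents measure the full second moment of increments, mean included, and may be degenerate.
  Halving shows that the Hoelder exponent is at most 1 or infinite. In the infinite case paths are
  almost surely constant near \<open>t0\<close> and the graph has dimension N although N / \<alpha>
  = 0; hence the graph upper bound is asserted for finite \<alpha>. Exponents are approached by
  strict inequalities: each rational below a lower bound or above an upper bound gives an almost
  sure statement, and monotonicity in the radius turns countably many of these into the limit. The
  value N + d (1 - \<beta>) arises from the constraint b \<gamma> + \<eta> < N: with b near \<beta>
  and \<gamma> near d, \<eta> can be taken near N - d \<beta>, and the order reached is \<gamma> +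
  \<eta>.\<close>

lemma inverse_ennreal_antimono:
  fixes x y :: ennreal assumes "x \<le> y" shows "inverse y \<le> inverse x"
proof (cases "x = 0 \<or> y = top")
  case False
  then obtain a b where ab: "x = ennreal a" "y = ennreal b" "0 < a" "0 \<le> b"
    using assms by (cases x; cases y) (auto simp: ennreal_eq_0_iff less_le top_unique)
  then have "a \<le> b" using assms by simp
  then show ?thesis using ab by (simp add: inverse_ennreal le_imp_inverse_le)
qed auto

lemma hausdorff_premeasure_le:
  assumes "E \<subseteq> (\<Union>k. U k)" "\<And>k::nat. bounded (U k) \<and> diameter (U k) \<le> \<delta>"
  shows "hausdorff_premeasure s \<delta> E \<le> (\<Sum>k. ennreal (diameter (U k) powr s))"
  unfolding hausdorff_premeasure_def using assms by (intro INF_lower) auto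

lemma hausdorff_premeasure_mono:
  assumes "E \<subseteq> F" shows "hausdorff_premeasure s \<delta> E \<le> hausdorff_premeasure s \<delta> F"
  unfolding hausdorff_premeasure_def using assms by (intro INF_superset_mono) auto

lemma hausdorff_outer_measure_mono:
  assumes "E \<subseteq> F" shows "hausdorff_outer_measure s E \<le> hausdorff_outer_measure s F"
  unfolding hausdorff_outer_measure_def
  using assms by (intro SUP_mono) (blast intro: hausdorff_premeasure_mono)

lemma hausdorff_dim_mono:
  assumes "E \<subseteq> F" shows "hausdorff_dim E \<le> hausdorff_dim F"
proof -
  have "hausdorff_outer_measure s E = 0" if "hausdorff_outer_measure s F = 0" for s
    using hausdorff_outer_measure_mono[OF assms, of s] that by simp
  then show ?thesis
    unfolding hausdorff_dim_def by (intro Inf_superset_mono) auto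
qed

lemma hausdorff_dim_nonneg: "0 \<le> hausdorff_dim E"
  unfolding hausdorff_dim_def by (rule Inf_greatest) auto

section \<open>Upper bounds from covers, lower bounds from energy\<close>

lemma finite_cover_premeasure_le:
  assumes fin: "finite I" and cov: "E \<subseteq> (\<Union>i\<in>I. U i)"
    and U: "\<And>i. i \<in> I \<Longrightarrow> bounded (U i) \<and> diameter (U i) \<le> D" and D: "0 \<le> D" "D \<le> \<delta>" and s: "0 < s"
  shows "hausdorff_premeasure s \<delta> E \<le> ennreal (real (card I) * D powr s)"
proof -
  obtain h where h: "bij_betw h {..<card I} I"
    using ex_bij_betw_nat_finite[OF fin] by (auto simp: atLeast0LessThan)
  \<comment> \<open>Padding with the empty set turns the finite cover into a sequence at no cost:
    its diameter is 0 and \<open>0 powr s = 0\<close>.\<close>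
  define V where "V k = (if k < card I then U (h k) else {})" for k
  have hI: "h k \<in> I" if "k < card I" for k
    using h that by (auto simp: bij_betw_def)
  have "E \<subseteq> (\<Union>k. V k)"
  proof
    fix x assume "x \<in> E"
    then obtain i where i: "i \<in> I" "x \<in> U i" using cov by auto
    then have "i \<in> h ` {..<card I}" using h by (simp add: bij_betw_def)
    then obtain k where "k < card I" "h k = i" by auto
    then show "x \<in> (\<Union>k. V k)" using i by (auto simp: V_def)
  qed
  moreover have V: "bounded (V k) \<and> diameter (V k) \<le> D" for k
    using U[OF hI] D by (auto simp: V_def)
  ultimately have "hausdorff_premeasure s \<delta> E \<le> (\<Sum>k. ennreal (diameter (V k) powr s))"
    using D order_trans by (intro hausdorff_premeasure_le) blast+
  also have "\<dots> = (\<Sum>k<card I. ennreal (diameter (V k) powr s))"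
    by (rule suminf_finite) (auto simp: V_def)
  also have "\<dots> \<le> (\<Sum>k<card I. ennreal (D powr s))"
    using V s by (intro sum_mono ennreal_leI powr_mono2) (auto intro: diameter_ge_0)
  also have "\<dots> = ennreal (real (card I) * D powr s)"
    by (simp add: ennreal_mult flip: ennreal_of_nat_eq_real_of_nat)
  finally show ?thesis .
qed

text \<open>At order s such a cover has sum at most A B^s 2^((p - q s) n), which tends to 0 for
  every s > p / q. Counting sets along powers of 2 is the form in which every upper bound is later
  supplied.\<close>

lemma hausdorff_dim_le_covers:
  fixes E :: "'a::metric_space set" and p q A B :: real and n0 :: nat
  assumes q: "0 < q" and p: "0 \<le> p" and B: "0 \<le> B"
    and cov: "\<And>n::nat. n0 \<le> n \<Longrightarrow> \<exists>\<U>. finite \<U> \<and> E \<subseteq> \<Union>\<U> \<and> real (card \<U>) \<le> A * 2 powr (p * n)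
      \<and> (\<forall>U\<in>\<U>. bounded U \<and> diameter U \<le> B * 2 powr (- (q * n)))"
  shows "hausdorff_dim E \<le> ereal (p / q)"
proof (rule ereal_le_epsilon2)
  fix e :: real assume e: "0 < e"
  define s where "s = p / q + e"
  have s: "0 < s" using p q e by (simp add: s_def add_nonneg_pos)
  have sq: "p - q * s < 0" using q e by (simp add: s_def field_simps)
  have zero: "hausdorff_premeasure s \<delta> E = 0" if \<delta>: "0 < \<delta>" for \<delta>
  proof -
    have lim1: "(\<lambda>n::nat. B * 2 powr (- (q * n))) \<longlonglongrightarrow> 0"
      using q by real_asymp
    have "(\<lambda>n::nat. 2 powr ((p - q * s) * n)) \<longlonglongrightarrow> 0"
    proof -
      define r where "r = q * s - p"
      have "0 < r" using sq by (simp add: r_def)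
      then have "(\<lambda>n::nat. 2 powr (- (r * n))) \<longlonglongrightarrow> 0" by real_asymp
      then show ?thesis by (simp add: r_def algebra_simps)
    qed
    then have lim2: "(\<lambda>n::nat. A * B powr s * 2 powr ((p - q * s) * n)) \<longlonglongrightarrow> 0"
      by (rule tendsto_mult_right_zero)
    have bd: "hausdorff_premeasure s \<delta> E \<le> ennreal (A * B powr s * 2 powr ((p - q * s) * n))"
      if n: "n0 \<le> n" "B * 2 powr (- (q * n)) < \<delta>" for n :: nat
    proof -
      obtain \<U> where \<U>: "finite \<U>" "E \<subseteq> \<Union>\<U>" "real (card \<U>) \<le> A * 2 powr (p * n)"
        "\<And>U. U \<in> \<U> \<Longrightarrow> bounded U \<and> diameter U \<le> B * 2 powr (- (q * n))"
        using cov[OF n(1)] by blast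
      have "hausdorff_premeasure s \<delta> E \<le> ennreal (real (card \<U>) * (B * 2 powr (- (q * n))) powr s)"
        using \<U> n(2) B s by (intro finite_cover_premeasure_le[where U = "\<lambda>u. u"]) auto
      also have "\<dots> \<le> ennreal (A * 2 powr (p * n) * (B * 2 powr (- (q * n))) powr s)"
        using \<U>(3) by (intro ennreal_leI mult_right_mono) auto
      also have "A * 2 powr (p * n) * (B * 2 powr (- (q * n))) powr s
          = A * B powr s * 2 powr ((p - q * s) * n)"
        using B by (simp add: powr_mult powr_powr algebra_simps flip: powr_add)
      finally show ?thesis .
    qed
    have "\<forall>\<^sub>F n::nat in sequentially.
        hausdorff_premeasure s \<delta> E \<le> ennreal (A * B powr s * 2 powr ((p - q * s) * n))"
      using order_tendstoD(2)[OF lim1 \<delta>] eventually_ge_at_top[of n0]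
      by eventually_elim (rule bd)
    moreover have "(\<lambda>n::nat. ennreal (A * B powr s * 2 powr ((p - q * s) * n))) \<longlonglongrightarrow> ennreal 0"
      by (intro tendsto_ennrealI lim2)
    ultimately have "hausdorff_premeasure s \<delta> E \<le> ennreal 0"
      by (intro tendsto_lowerbound[of _ _ sequentially]) auto
    then show ?thesis by simp
  qed
  have "hausdorff_outer_measure s E = 0"
    unfolding hausdorff_outer_measure_def by (auto simp: zero intro!: SUP_eq_const)
  then have "hausdorff_dim E \<le> ereal s"
    unfolding hausdorff_dim_def using s by (intro Inf_lower) auto
  then show "hausdorff_dim E \<le> ereal (p / q) + ereal e" by (simp add: s_def)
qed

text \<open>
  If \<open>B k\<close> are the disjoint traces of a cover and \<open>m k\<close>, \<open>e k\<close> their mass and energy, then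
  \<open>m k\<^sup>2 \<le> diam\<^sup>\<gamma> e k\<close>, and \<open>m \<le> c x + y / c\<close> whenever \<open>m\<^sup>2 \<le> x y\<close> replaces Cauchy-Schwarz.
\<close>

lemma hausdorff_dim_ge_energy:
  fixes F :: "'t \<Rightarrow> 'b::{metric_space,second_countable_topology}"
  assumes "finite_measure \<mu>" and F [measurable]: "F \<in> borel_measurable \<mu>"
    and pos: "emeasure \<mu> (space \<mu>) \<noteq> 0" and \<gamma>: "0 < \<gamma>"
    and energy: "(\<integral>\<^sup>+s. \<integral>\<^sup>+t. inverse (ennreal (dist (F s) (F t) powr \<gamma>)) \<partial>\<mu> \<partial>\<mu>) < \<infinity>"
  shows "ereal \<gamma> \<le> hausdorff_dim (F ` space \<mu>)"
proof -
  interpret finite_measure \<mu> by fact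
  \<comment> \<open>The potential of order \<gamma> of the pushed-forward measure, read along
    \<open>F\<close>. The energy becomes the total mass of the measure \<open>\<nu>\<close> with
    density \<open>P\<close>, so countable additivity distributes it over the pieces of a
    cover.\<close>
  define P where "P s = (\<integral>\<^sup>+t. inverse (ennreal (dist (F s) (F t) powr \<gamma>)) \<partial>\<mu>)" for s
  have [measurable]: "P \<in> borel_measurable \<mu>" unfolding P_def by measurable
  define \<nu> where "\<nu> = density \<mu> P"
  have \<nu>: "emeasure \<nu> B = (\<integral>\<^sup>+s. P s * indicator B s \<partial>\<mu>)" if "B \<in> sets \<mu>" for B
    using that unfolding \<nu>_def by (simp add: emeasure_density)
  define I where "I = emeasure \<nu> (space \<mu>)"
  have "I = (\<integral>\<^sup>+s. P s \<partial>\<mu>)"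
    unfolding I_def by (subst \<nu>) (auto intro!: nn_integral_cong)
  then have Ifin: "I < \<infinity>" using energy by (simp add: P_def)
  define m where "m = measure \<mu> (space \<mu>)"
  have m: "emeasure \<mu> (space \<mu>) = ennreal m" "0 < m"
    using pos by (auto simp: m_def emeasure_eq_measure measure_le_0_iff zero_less_measure_iff)
  \<comment> \<open>With this \<open>c\<close> the energy terms sum to I / c \<le> m / 2, so the
    diameters must account for at least half of the mass \<open>m\<close>. The summand 1 keeps
    \<open>c\<close> positive when the energy vanishes.\<close>
  define c where "c = 2 * (enn2real I + 1) / m"
  have c: "0 < c" using m by (auto simp: c_def add_nonneg_pos)
  have Ic: "enn2real I / c \<le> m / 2"
  proof -
    have "enn2real I / c = (m / 2) * (enn2real I / (enn2real I + 1))" by (simp add: c_def)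
    also have "\<dots> \<le> (m / 2) * 1" using m by (intro mult_left_mono) (auto simp: divide_le_eq_1 add_nonneg_pos)
    finally show ?thesis by simp
  qed
  have *: "ennreal (m / (2 * c)) \<le> (\<Sum>k. ennreal (diameter (U k) powr s))"
    if s: "0 < s" "s \<le> \<gamma>" and cov: "F ` space \<mu> \<subseteq> (\<Union>k. U k)"
      and U: "\<And>k. bounded (U k) \<and> diameter (U k) \<le> 1" for s and U :: "nat \<Rightarrow> 'b set"
  proof -
    \<comment> \<open>Closures make the preimages measurable and leave the diameters
      unchanged.\<close>
    define V where "V k = F -` closure (U k) \<inter> space \<mu>" for k
    have V [measurable]: "V k \<in> sets \<mu>" for k
      unfolding V_def by (rule measurable_sets[OF F]) auto
    define B where "B = disjointed V"
    have B [measurable]: "B k \<in> sets \<mu>" for k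
    proof -
      have "range V \<subseteq> sets \<mu>" by (auto simp: V)
      from sets.range_disjointed_sets[OF this] show ?thesis by (auto simp: B_def)
    qed
    have BV: "B k \<subseteq> V k" for k by (auto simp: B_def disjointed_subset)
    have disj: "disjoint_family B" by (simp add: B_def disjoint_family_disjointed)
    have "(\<Union>k. V k) = space \<mu>"
    proof (intro equalityI subsetI)
      fix x assume x: "x \<in> space \<mu>"
      then obtain k where "F x \<in> U k" using cov by blast
      then show "x \<in> (\<Union>k. V k)" using x closure_subset[of "U k"] by (auto simp: V_def)
    qed (auto simp: V_def)
    then have UB: "(\<Union>k. B k) = space \<mu>" by (simp add: B_def UN_disjointed_eq)
    define e where "e k = emeasure \<nu> (B k)" for k
    have sets\<nu>: "sets \<nu> = sets \<mu>" by (simp add: \<nu>_def)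
    have sume: "(\<Sum>k. e k) = I"
      using suminf_emeasure[of B \<nu>] disj B by (simp add: sets\<nu> e_def I_def UB image_subset_iff)
    have summ: "(\<Sum>k. emeasure \<mu> (B k)) = ennreal m"
      using suminf_emeasure[of B \<mu>] disj B m(1) by (simp add: UB image_subset_iff)
    have efin: "e k < \<infinity>" for k
      using ennreal_suminf_lessD[of e "\<infinity>" k] Ifin by (simp add: sume)
    have key: "emeasure \<mu> (B k) \<le> ennreal c * ennreal (diameter (U k) powr s) + e k / ennreal c" for k
    proof -
      define D where "D = diameter (U k)"
      have D: "0 \<le> D" "D \<le> 1" using U[of k] by (auto simp: D_def diameter_ge_0)
      have dist: "dist (F x) (F y) \<le> D" if "x \<in> B k" "y \<in> B k" for x y
      proof -
        have "F x \<in> closure (U k)" "F y \<in> closure (U k)"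
          using that BV by (auto simp: V_def)
        then show ?thesis
          using diameter_bounded_bound[of "closure (U k)"] U[of k]
          by (simp add: D_def diameter_closure bounded_closure)
      qed
      define K where "K = inverse (ennreal (D powr \<gamma>))"
      have "(\<integral>\<^sup>+s. K * emeasure \<mu> (B k) * indicator (B k) s \<partial>\<mu>) \<le> (\<integral>\<^sup>+s. P s * indicator (B k) s \<partial>\<mu>)"
      proof (intro nn_integral_mono)
        fix x assume "x \<in> space \<mu>"
        have "K * emeasure \<mu> (B k) \<le> P x" if x: "x \<in> B k"
        proof -
          have "K * emeasure \<mu> (B k) = (\<integral>\<^sup>+t. K * indicator (B k) t \<partial>\<mu>)"
            by (simp add: nn_integral_cmult_indicator)
          also have "\<dots> \<le> P x"
            unfolding P_def K_def using dist[OF x] \<gamma>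
            by (intro nn_integral_mono)
              (auto simp: indicator_def intro!: inverse_ennreal_antimono ennreal_leI powr_mono2)
          finally show ?thesis .
        qed
        then show "K * emeasure \<mu> (B k) * indicator (B k) x \<le> P x * indicator (B k) x"
          by (auto simp: indicator_def)
      qed
      also have "\<dots> = e k" by (simp add: e_def \<nu>)
      finally have le: "K * emeasure \<mu> (B k) * emeasure \<mu> (B k) \<le> e k"
        by (simp add: nn_integral_cmult_indicator)
      define b where "b = measure \<mu> (B k)"
      have b: "emeasure \<mu> (B k) = ennreal b" "0 \<le> b" by (auto simp: b_def emeasure_eq_measure)
      obtain f where f: "e k = ennreal f" "0 \<le> f" using efin[of k] by (cases "e k") auto
      show ?thesis
      proof (cases "D = 0")
        \<comment> \<open>On a set of diameter 0 the kernel is infinite, so finite energy forces the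
          piece to have mass 0.\<close>
        case True
        then have "\<infinity> * ennreal b * ennreal b \<le> ennreal f"
          using le by (simp add: K_def b f)
        then have "b = 0" using b(2) f
          by (auto simp: ennreal_top_mult ennreal_mult_top top_unique split: if_splits)
        then show ?thesis by (simp add: b)
      next
        case False
        then have D0: "0 < D" using D by simp
        have "ennreal (inverse (D powr \<gamma>) * b * b) \<le> ennreal f"
          using le D0 b by (simp add: K_def b(1) f(1) inverse_ennreal ennreal_mult)
        then have "b * b \<le> f * D powr \<gamma>"
          using f D0 by (simp add: field_simps)
        \<comment> \<open>Uses D \<le> 1 and s \<le> \<gamma>: one finite energy excludes every
          order s up to \<gamma>.\<close>
        also have "\<dots> \<le> f * D powr s"
          using D0 D s f by (intro mult_left_mono powr_mono') auto
        finally have bb: "b * b \<le> f * D powr s" .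
        have "b \<le> c * D powr s + f / c"
        proof (rule power2_le_imp_le)
          have "b\<^sup>2 \<le> (c * D powr s) * (f / c)"
            using bb c by (simp add: power2_eq_square mult.commute)
          also have "\<dots> \<le> (c * D powr s + f / c)\<^sup>2"
            using c f by (simp add: power2_sum)
          finally show "b\<^sup>2 \<le> (c * D powr s + f / c)\<^sup>2" .
        qed (use c f in auto)
        then show ?thesis
          using c f by (simp add: b f D_def[symmetric] divide_ennreal flip: ennreal_mult ennreal_plus)
      qed
    qed
    define S where "S = (\<Sum>k. ennreal (diameter (U k) powr s))"
    have "ennreal m \<le> (\<Sum>k. ennreal c * ennreal (diameter (U k) powr s) + e k / ennreal c)"
      unfolding summ[symmetric] by (intro suminf_le key) auto
    also have "\<dots> = ennreal c * S + (\<Sum>k. e k * inverse (ennreal c))"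
      by (simp add: S_def divide_ennreal_def suminf_add[symmetric] ennreal_suminf_cmult)
    also have "(\<Sum>k. e k * inverse (ennreal c)) = I / ennreal c"
      by (simp add: ennreal_suminf_multc sume divide_ennreal_def)
    finally have main: "ennreal m \<le> ennreal c * S + I / ennreal c" .
    show ?thesis
    proof (cases "S = \<infinity>")
      case False
      then obtain S' where S': "S = ennreal S'" "0 \<le> S'" by (cases S) auto
      obtain I' where I': "I = ennreal I'" "0 \<le> I'" using Ifin by (cases I) auto
      have "m \<le> c * S' + I' / c"
        using main c S' I' by (simp add: divide_ennreal flip: ennreal_mult ennreal_plus)
      moreover have "I' / c \<le> m / 2" using Ic I' by simp
      ultimately have "m / 2 \<le> c * S'" by linarith
      then show ?thesis using S' c by (simp add: S_def[symmetric] field_simps)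
    qed (simp add: S_def)
  qed
  have "ereal \<gamma> \<le> ereal s" if "0 < s" "hausdorff_outer_measure s (F ` space \<mu>) = 0" for s
  proof (rule ccontr)
    assume "\<not> ?thesis"
    then have "s \<le> \<gamma>" by simp
    then have "ennreal (m / (2 * c)) \<le> hausdorff_premeasure s 1 (F ` space \<mu>)"
      unfolding hausdorff_premeasure_def using * that by (intro INF_greatest) auto
    also have "\<dots> \<le> hausdorff_outer_measure s (F ` space \<mu>)"
      unfolding hausdorff_outer_measure_def by (intro SUP_upper) auto
    finally show False using that m c by simp
  qed
  then show ?thesis unfolding hausdorff_dim_def by (intro Inf_greatest) auto
qed

section \<open>Dyadic grids and images of Hoelder maps\<close>

definition cube :: "real ^ 'n \<Rightarrow> real \<Rightarrow> (real ^ 'n) set" where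
  "cube a L = {t. \<forall>i. a $ i \<le> t $ i \<and> t $ i \<le> a $ i + L}"

definition grid_proj :: "real ^ 'n \<Rightarrow> real \<Rightarrow> nat \<Rightarrow> real ^ 'n \<Rightarrow> real ^ 'n" where
  "grid_proj a L n t = (\<chi> i. a $ i + L * of_int \<lfloor>2 ^ n * (t $ i - a $ i) / L\<rfloor> / 2 ^ n)"

text \<open>The index 2^n is included because a point on an upper face of the closed cube is its own
  projection in that coordinate. Hence 2^n + 1 points per axis, later bounded by 2 * 2^n.\<close>

definition grid :: "real ^ 'n \<Rightarrow> real \<Rightarrow> nat \<Rightarrow> (real ^ 'n) set" where
  "grid a L n = (\<lambda>k. \<chi> i. a $ i + L * real (k i) / 2 ^ n) ` (UNIV \<rightarrow>\<^sub>E {..2 ^ n})"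

lemma finite_grid: "finite (grid a L n)"
  unfolding grid_def by (intro finite_imageI finite_PiE) auto

lemma card_grid_le:
  fixes a :: "real ^ 'n"
  shows "real (card (grid a L n)) \<le> (2 * 2 ^ n) ^ CARD('n)"
proof -
  have "card (grid a L n) \<le> card ((UNIV :: 'n set) \<rightarrow>\<^sub>E {..(2::nat) ^ n})"
    unfolding grid_def by (intro card_image_le finite_PiE) auto
  also have "\<dots> = (2 ^ n + 1) ^ CARD('n)" by (simp add: card_PiE)
  also have "\<dots> \<le> (2 * 2 ^ n) ^ CARD('n)" by (intro power_mono) auto
  finally have "real (card (grid a L n)) \<le> real ((2 * 2 ^ n) ^ CARD('n))" by (rule of_nat_mono)
  then show ?thesis by simp
qed

lemma grid_subset_cube:
  assumes "0 \<le> L" shows "grid a L n \<subseteq> cube a L"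
proof -
  have "L * real k / 2 ^ n \<le> L" if "k \<le> 2 ^ n" for k
  proof -
    have "real k \<le> 2 ^ n" using that by (metis of_nat_le_iff of_nat_numeral of_nat_power)
    then have "L * (real k / 2 ^ n) \<le> L * 1" using assms by (intro mult_left_mono) auto
    then show ?thesis by simp
  qed
  then show ?thesis using assms by (auto simp: grid_def cube_def PiE_iff)
qed

lemma grid_Suc_subset: "grid a L n \<subseteq> grid a L (Suc n)"
proof
  fix u assume "u \<in> grid a L n"
  then obtain k where k: "k \<in> UNIV \<rightarrow>\<^sub>E {..2 ^ n}" "u = (\<chi> i. a $ i + L * real (k i) / 2 ^ n)"
    by (auto simp: grid_def)
  then have "(\<lambda>i. 2 * k i) \<in> UNIV \<rightarrow>\<^sub>E {..2 ^ Suc n}" by (auto simp: PiE_iff)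
  moreover have "u = (\<chi> i. a $ i + L * real (2 * k i) / 2 ^ Suc n)" using k by simp
  ultimately show "u \<in> grid a L (Suc n)" unfolding grid_def by (intro image_eqI[where x = "\<lambda>i. 2 * k i"])
qed

lemma grid_proj_in_grid:
  assumes L: "0 < L" and t: "t \<in> cube a L"
  shows "grid_proj a L n t \<in> grid a L n"
proof -
  define k where "k i = nat \<lfloor>2 ^ n * (t $ i - a $ i) / L\<rfloor>" for i
  have 1: "0 \<le> 2 ^ n * (t $ i - a $ i) / L" "2 ^ n * (t $ i - a $ i) / L \<le> 2 ^ n" for i
  proof -
    have *: "0 \<le> (t $ i - a $ i) / L" "(t $ i - a $ i) / L \<le> 1"
      using t L by (auto simp: cube_def divide_le_eq_1 algebra_simps)
    show "0 \<le> 2 ^ n * (t $ i - a $ i) / L" "2 ^ n * (t $ i - a $ i) / L \<le> 2 ^ n"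
      using mult_left_mono[OF *(1), of "2 ^ n"] mult_left_mono[OF *(2), of "2 ^ n"] by simp_all
  qed
  have "k i \<le> 2 ^ n" for i
  proof -
    have "\<lfloor>2 ^ n * (t $ i - a $ i) / L\<rfloor> \<le> \<lfloor>2 ^ n :: real\<rfloor>" by (intro floor_mono 1)
    also have "\<dots> = 2 ^ n" by (metis floor_of_int of_int_numeral of_int_power)
    finally show ?thesis by (simp add: k_def nat_le_iff)
  qed
  then have "k \<in> UNIV \<rightarrow>\<^sub>E {..2 ^ n}" by auto
  moreover have "grid_proj a L n t = (\<chi> i. a $ i + L * real (k i) / 2 ^ n)"
    using 1 by (simp add: grid_proj_def k_def of_nat_nat)
  ultimately show ?thesis unfolding grid_def by blast
qed

text \<open>Each coordinate moves by at most one mesh width; the factor \<open>CARD('n)\<close>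
  comes from bounding the Euclidean norm by the sum of the absolute coordinates.\<close>

lemma dist_grid_proj:
  fixes t :: "real ^ 'n"
  assumes L: "0 < L"
  shows "dist t (grid_proj a L n t) \<le> L * real CARD('n) / 2 ^ n"
proof -
  have "\<bar>(t - grid_proj a L n t) $ i\<bar> \<le> L / 2 ^ n" for i
  proof -
    define x where "x = 2 ^ n * (t $ i - a $ i) / L"
    have t: "t $ i = a $ i + L * x / 2 ^ n" using L by (simp add: x_def)
    have "(t - grid_proj a L n t) $ i = t $ i - (a $ i + L * of_int \<lfloor>x\<rfloor> / 2 ^ n)"
      by (simp add: grid_proj_def x_def)
    also have "\<dots> = L / 2 ^ n * (x - of_int \<lfloor>x\<rfloor>)"
      by (subst t) (simp add: algebra_simps diff_divide_distrib)
    finally have "(t - grid_proj a L n t) $ i = L / 2 ^ n * (x - of_int \<lfloor>x\<rfloor>)" .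
    moreover have "0 \<le> x - of_int \<lfloor>x\<rfloor>" "x - of_int \<lfloor>x\<rfloor> \<le> 1" by linarith+
    ultimately show ?thesis
      using L mult_left_mono[of "x - of_int \<lfloor>x\<rfloor>" 1 "L / 2 ^ n"] by (simp add: abs_mult)
  qed
  then have "(\<Sum>i\<in>UNIV. \<bar>(t - grid_proj a L n t) $ i\<bar>) \<le> (\<Sum>i\<in>(UNIV::'n set). L / 2 ^ n)"
    by (intro sum_mono)
  then show ?thesis
    using norm_le_l1_cart[of "t - grid_proj a L n t"] by (simp add: dist_norm mult.commute)
qed

text \<open>Level \<open>Suc n\<close> halves the mesh, so the two distances to the common
  projection add up to exactly the level \<open>n\<close> scale used in
  \<open>dyadic_holder\<close>.\<close>

lemma dist_le_same_grid_proj: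
  fixes s t :: "real ^ 'n"
  assumes L: "0 < L" and eq: "grid_proj a L (Suc n) s = grid_proj a L (Suc n) t"
  shows "dist s t \<le> L * real CARD('n) / 2 ^ n"
proof -
  have "dist s t \<le> dist s (grid_proj a L (Suc n) s) + dist t (grid_proj a L (Suc n) t)"
    unfolding eq by (rule dist_triangle2)
  also have "\<dots> \<le> L * real CARD('n) / 2 ^ Suc n + L * real CARD('n) / 2 ^ Suc n"
    by (intro add_mono dist_grid_proj L)
  finally show ?thesis by (simp add: field_simps)
qed

lemma grid_proj_measurable [measurable]:
  fixes a :: "real ^ 'n"
  shows "grid_proj a L n \<in> borel_measurable borel"
proof (subst borel_measurable_euclidean_space, intro ballI)
  fix b :: "real ^ 'n" assume "b \<in> Basis"
  then obtain j where "b = axis j 1" by (auto simp: Basis_vec_def)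
  moreover have [measurable]: "(\<lambda>t::real ^ 'n. t $ j) \<in> borel_measurable borel"
    by (intro borel_measurable_continuous_onI continuous_intros)
  have "(\<lambda>t::real ^ 'n. a $ j + L * of_int \<lfloor>2 ^ n * (t $ j - a $ j) / L\<rfloor> / 2 ^ n) \<in> borel_measurable borel"
    by measurable
  ultimately show "(\<lambda>t. grid_proj a L n t \<bullet> b) \<in> borel_measurable borel"
    by (simp add: grid_proj_def inner_axis)
qed

lemma cube_cbox: "cube a L = cbox a (a + (\<chi> i. L))"
  by (auto simp: cube_def mem_box_cart)

lemma compact_cube: "compact (cube a L)" by (simp add: cube_cbox)

text \<open>Local Hoelder continuity, imposed only at the dyadic scales that coverings and chaining use.\<close>

definition dyadic_holder :: "'a::metric_space set \<Rightarrow> real \<Rightarrow> real \<Rightarrow> ('a \<Rightarrow> 'b::metric_space) \<Rightarrow> bool" where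
  "dyadic_holder S c \<alpha> f \<longleftrightarrow> (\<exists>C>0. \<exists>n0. \<forall>n\<ge>n0. \<forall>s\<in>S. \<forall>t\<in>S.
     dist s t \<le> c / 2 ^ n \<longrightarrow> dist (f s) (f t) \<le> C * 2 powr (- (\<alpha> * real n)))"

section \<open>Covering images and graphs of Hoelder maps\<close>

lemma bounded_diameter_le:
  fixes S :: "'a::metric_space set"
  assumes "\<And>x y. x \<in> S \<Longrightarrow> y \<in> S \<Longrightarrow> dist x y \<le> d" "0 \<le> d"
  shows "bounded S \<and> diameter S \<le> d"
proof
  show "bounded S" using assms(1) by (auto simp: bounded_two_points)
  show "diameter S \<le> d"
    using assms by (auto simp: diameter_def intro!: cSUP_least)
qed

text \<open>There are of order 2^(N n) cells and each image has diameter of order 2^(-\<alpha> n),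
  so the covering criterion applies with p = N and q = \<alpha>.\<close>

lemma hausdorff_dim_holder_image:
  fixes f :: "real ^ 'n \<Rightarrow> 'b::metric_space"
  assumes L: "0 < L" and \<alpha>: "0 < \<alpha>" and f: "dyadic_holder (cube a L) (L * CARD('n)) \<alpha> f"
  shows "hausdorff_dim (f ` cube a L) \<le> ereal (real CARD('n) / \<alpha>)"
proof -
  obtain C n0 where C: "0 < C" and n0: "\<And>n s t. n0 \<le> n \<Longrightarrow> s \<in> cube a L \<Longrightarrow> t \<in> cube a L \<Longrightarrow>
      dist s t \<le> L * CARD('n) / 2 ^ n \<Longrightarrow> dist (f s) (f t) \<le> C * 2 powr (- (\<alpha> * real n))"
    using f unfolding dyadic_holder_def by blast
  show ?thesis
  proof (rule hausdorff_dim_le_covers)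
    fix n :: nat assume n: "n0 \<le> n"
    let ?U = "\<lambda>u. f ` {t \<in> cube a L. grid_proj a L (Suc n) t = u}"
    have "real (card (?U ` grid a L (Suc n))) \<le> (2 * 2 ^ Suc n) ^ CARD('n)"
      using card_image_le[OF finite_grid, of ?U a L "Suc n"] card_grid_le[of a L "Suc n"] by linarith
    also have "\<dots> = 4 ^ CARD('n) * 2 powr (real CARD('n) * real n)"
      by (simp add: power_mult_distrib powr_realpow power_mult mult.commute flip: of_nat_mult)
    finally have "real (card (?U ` grid a L (Suc n))) \<le> 4 ^ CARD('n) * 2 powr (real CARD('n) * real n)" .
    moreover have "bounded (?U u) \<and> diameter (?U u) \<le> C * 2 powr (- (\<alpha> * real n))" for u
      using C n by (intro bounded_diameter_le) (auto intro!: n0 dist_le_same_grid_proj[OF L, of a])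
    moreover have "f ` cube a L \<subseteq> \<Union>(?U ` grid a L (Suc n))"
    proof
      fix y assume "y \<in> f ` cube a L"
      then obtain t where t: "t \<in> cube a L" "y = f t" by auto
      then have "y \<in> ?U (grid_proj a L (Suc n) t)" by blast
      then show "y \<in> \<Union>(?U ` grid a L (Suc n))" using grid_proj_in_grid[OF L t(1)] by blast
    qed
    ultimately show "\<exists>\<U>. finite \<U> \<and> f ` cube a L \<subseteq> \<Union>\<U> \<and>
        real (card \<U>) \<le> 4 ^ CARD('n) * 2 powr (real CARD('n) * real n) \<and>
        (\<forall>U\<in>\<U>. bounded U \<and> diameter U \<le> C * 2 powr (- (\<alpha> * real n)))"
      by (intro exI[of _ "?U ` grid a L (Suc n)"]) (simp add: finite_grid)
  qed (use C \<alpha> in auto)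
qed

text \<open>The time component is Lipschitz, and \<alpha> \<le> 1 makes 2^(-n) at most 2^(-\<alpha>
  n); the graph map then inherits the order of \<open>f\<close>.\<close>

lemma dyadic_holder_graph:
  assumes f: "dyadic_holder S c \<alpha> f" and \<alpha>: "\<alpha> \<le> 1" and c: "0 \<le> c"
  shows "dyadic_holder S c \<alpha> (\<lambda>t. (t, f t))"
proof -
  obtain C n0 where C: "0 < C" and n0: "\<And>n s t. n0 \<le> n \<Longrightarrow> s \<in> S \<Longrightarrow> t \<in> S \<Longrightarrow>
      dist s t \<le> c / 2 ^ n \<Longrightarrow> dist (f s) (f t) \<le> C * 2 powr (- (\<alpha> * real n))"
    using f unfolding dyadic_holder_def by blast
  have "dist (s, f s) (t, f t) \<le> (c + C) * 2 powr (- (\<alpha> * real n))"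
    if "n0 \<le> n" "s \<in> S" "t \<in> S" "dist s t \<le> c / 2 ^ n" for n s t
  proof -
    have "dist (s, f s) (t, f t) \<le> dist s t + dist (f s) (f t)"
      by (simp add: dist_Pair_Pair sqrt_sum_squares_le_sum)
    also have "\<dots> \<le> c * 2 powr (- real n) + C * 2 powr (- (\<alpha> * real n))"
      using that n0[OF that] by (simp add: powr_minus powr_realpow divide_inverse)
    also have "c * 2 powr (- real n) \<le> c * 2 powr (- (\<alpha> * real n))"
      using c \<alpha> by (intro mult_left_mono powr_mono) (auto intro: mult_left_le_one_le mult_right_mono[of \<alpha> 1, simplified])
    finally show ?thesis by (simp add: algebra_simps)
  qed
  then show ?thesis
    unfolding dyadic_holder_def using C c by (intro exI[of _ "c + C"]) auto
qed

text \<open>Over a cell of side of order 2^(-n) the path stays in a cube of side of order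
  2^(-\<alpha> n). Cutting that cube down to side 2^(-n) takes of order 2^(d (1 - \<alpha>) n)
  pieces, so the graph is covered by of order 2^((N + d (1 - \<alpha>)) n) sets of diameter of order
  2^(-n).\<close>

lemma hausdorff_dim_graph_le:
  fixes f :: "real ^ 'n \<Rightarrow> real ^ 'd"
  assumes L: "0 < L" and \<alpha>: "0 < \<alpha>" "\<alpha> \<le> 1" and f: "dyadic_holder (cube a L) (L * CARD('n)) \<alpha> f"
  shows "hausdorff_dim ((\<lambda>t. (t, f t)) ` cube a L) \<le> ereal (real CARD('n) + real CARD('d) * (1 - \<alpha>))"
proof -
  let ?N = "real CARD('n)" let ?d = "real CARD('d)"
  obtain C n0 where C: "0 < C" and n0: "\<And>n s t. n0 \<le> n \<Longrightarrow> s \<in> cube a L \<Longrightarrow> t \<in> cube a L \<Longrightarrow>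
      dist s t \<le> L * ?N / 2 ^ n \<Longrightarrow> dist (f s) (f t) \<le> C * 2 powr (- (\<alpha> * real n))"
    using f unfolding dyadic_holder_def by blast
  have "hausdorff_dim ((\<lambda>t. (t, f t)) ` cube a L) \<le> ereal ((?N + ?d * (1 - \<alpha>)) / 1)"
  proof (rule hausdorff_dim_le_covers)
    fix n :: nat assume n: "n0 \<le> n"
    define r where "r = C * 2 powr (- (\<alpha> * real n))"
    have r: "0 < r" using C by (simp add: r_def)
    \<comment> \<open>Number of halvings that brings a side of order 2^(-\<alpha> n) down to order
      2^(-n). The estimate \<open>m2\<close> rests on \<alpha> \<le> 1, which makes the rounded
      number nonnegative.\<close>
    define m where "m = nat \<lceil>real n * (1 - \<alpha>)\<rceil>"
    have m1: "real n * (1 - \<alpha>) \<le> real m" unfolding m_def by linarith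
    have m2: "real m \<le> real n * (1 - \<alpha>) + 1" using \<alpha> unfolding m_def by (simp add: of_nat_nat)
    \<comment> \<open>Lower corner of the cube of side 2 r centred at \<open>f u\<close>, which
      contains the path over the whole cell with projection \<open>u\<close>.\<close>
    define b where "b u = f u - (\<chi> i. r)" for u
    define U where "U u w = (\<lambda>t. (t, f t)) `
      {t \<in> cube a L. grid_proj a L (Suc n) t = u \<and> grid_proj (b u) (2 * r) m (f t) = w}" for u w
    define \<U> where "\<U> = (\<Union>u\<in>grid a L (Suc n). U u ` grid (b u) (2 * r) m)"
    have fin: "finite \<U>" unfolding \<U>_def by (auto intro: finite_grid)
    have "real (card \<U>) \<le> real (\<Sum>u\<in>grid a L (Suc n). card (U u ` grid (b u) (2 * r) m))"
      unfolding \<U>_def by (intro of_nat_mono card_UN_le finite_grid)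
    also have "\<dots> \<le> (\<Sum>u\<in>grid a L (Suc n). (2 * 2 ^ m) ^ CARD('d))"
      unfolding of_nat_sum
    proof (intro sum_mono)
      fix u
      show "real (card (U u ` grid (b u) (2 * r) m)) \<le> (2 * 2 ^ m) ^ CARD('d)"
        using card_image_le[OF finite_grid, of "U u" "b u" "2 * r" m] card_grid_le[of "b u" "2 * r" m]
        by linarith
    qed
    also have "\<dots> = real (card (grid a L (Suc n))) * (2 * 2 ^ m) ^ CARD('d)" by simp
    also have "\<dots> \<le> (2 * 2 ^ Suc n) ^ CARD('n) * (2 * (2 * 2 powr (real n * (1 - \<alpha>)))) ^ CARD('d)"
    proof (intro mult_mono card_grid_le power_mono mult_left_mono)
      have "(2::real) ^ m = 2 powr m" by (simp add: powr_realpow)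
      also have "\<dots> \<le> 2 powr (real n * (1 - \<alpha>) + 1)" using m2 by (intro powr_mono) auto
      also have "\<dots> = 2 * 2 powr (real n * (1 - \<alpha>))" by (simp add: powr_add)
      finally show "(2::real) ^ m \<le> 2 * 2 powr (real n * (1 - \<alpha>))" .
    qed auto
    also have "\<dots> = (4 ^ CARD('n) * 4 ^ CARD('d)) * 2 powr ((?N + ?d * (1 - \<alpha>)) * real n)"
    proof -
      have "(2 * 2 ^ Suc n :: real) ^ CARD('n) = 4 ^ CARD('n) * 2 powr (?N * real n)"
        by (simp add: power_mult_distrib powr_realpow power_mult mult.commute flip: of_nat_mult)
      moreover have "(2 * (2 * 2 powr (real n * (1 - \<alpha>)))) ^ CARD('d)
          = 4 ^ CARD('d) * 2 powr (?d * (1 - \<alpha>) * real n)"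
        by (simp add: power_mult_distrib powr_powr mult_ac flip: powr_realpow)
      ultimately show ?thesis by (simp add: powr_add distrib_right)
    qed
    finally have card: "real (card \<U>) \<le> (4 ^ CARD('n) * 4 ^ CARD('d)) * 2 powr ((?N + ?d * (1 - \<alpha>)) * real n)" .
    have fu: "f t \<in> cube (b u) (2 * r)" if t: "t \<in> cube a L" and u: "u = grid_proj a L (Suc n) t" for t u
    proof -
      have "u \<in> cube a L"
        using u grid_proj_in_grid[OF L t] grid_subset_cube[of L a "Suc n"] L by auto
      moreover have "dist t u \<le> L * ?N / 2 ^ n"
      proof (rule order_trans)
        show "dist t u \<le> L * ?N / 2 ^ Suc n" unfolding u by (rule dist_grid_proj[OF L])
        show "L * ?N / 2 ^ Suc n \<le> L * ?N / 2 ^ n" using L by (intro divide_left_mono) auto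
      qed
      ultimately have "dist (f t) (f u) \<le> r" unfolding r_def by (intro n0 n t)
      then have "\<bar>(f t - f u) $ i\<bar> \<le> r" for i
        using component_le_norm_cart[of "f t - f u" i] by (simp add: dist_norm)
      then have "\<bar>f t $ i - f u $ i\<bar> \<le> r" for i by simp
      then show ?thesis by (auto simp: cube_def b_def abs_le_iff algebra_simps)
    qed
    have cover: "(\<lambda>t. (t, f t)) ` cube a L \<subseteq> \<Union>\<U>"
    proof clarsimp
      fix t assume t: "t \<in> cube a L"
      let ?u = "grid_proj a L (Suc n) t"
      have "(t, f t) \<in> U ?u (grid_proj (b ?u) (2 * r) m (f t))" using t by (auto simp: U_def)
      moreover have "?u \<in> grid a L (Suc n)" by (rule grid_proj_in_grid[OF L t])
      moreover have "grid_proj (b ?u) (2 * r) m (f t) \<in> grid (b ?u) (2 * r) m"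
        using r by (intro grid_proj_in_grid fu[OF t]) auto
      ultimately show "\<exists>V\<in>\<U>. (t, f t) \<in> V" unfolding \<U>_def by blast
    qed
    have small: "bounded (U u w) \<and> diameter (U u w) \<le> (L * ?N + 4 * C * ?d) * 2 powr (- (1 * real n))" for u w
    proof (rule bounded_diameter_le)
      fix x y assume "x \<in> U u w" "y \<in> U u w"
      then obtain s t where st: "x = (s, f s)" "y = (t, f t)" "s \<in> cube a L" "t \<in> cube a L"
        "grid_proj a L (Suc n) s = u" "grid_proj a L (Suc n) t = u"
        "grid_proj (b u) (2 * r) m (f s) = w" "grid_proj (b u) (2 * r) m (f t) = w"
        by (auto simp: U_def)
      have "dist (f s) (f t) \<le> dist (f s) w + dist (f t) w" by (rule dist_triangle2)
      also have "\<dots> \<le> 2 * r * ?d / 2 ^ m + 2 * r * ?d / 2 ^ m"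
        using dist_grid_proj[of "2 * r" "f s" "b u" m] dist_grid_proj[of "2 * r" "f t" "b u" m] r st(7,8)
        by (intro add_mono) auto
      also have "\<dots> = 4 * ?d * (r / 2 ^ m)" by simp
      also have "\<dots> \<le> 4 * ?d * (C * 2 powr (- real n))"
      proof (intro mult_left_mono)
        have "r / 2 ^ m = C * 2 powr (- (\<alpha> * real n) - real m)"
          by (simp add: r_def powr_diff powr_realpow)
        also have "\<dots> \<le> C * 2 powr (- real n)"
          using C m1 by (intro mult_left_mono powr_mono) (auto simp: algebra_simps)
        finally show "r / 2 ^ m \<le> C * 2 powr (- real n)" .
      qed auto
      finally have 1: "dist (f s) (f t) \<le> 4 * ?d * (C * 2 powr (- real n))" .
      have "dist s t \<le> L * ?N * 2 powr (- real n)"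
        using dist_le_same_grid_proj[OF L, of a n s t] st by (simp add: powr_minus powr_realpow divide_inverse)
      then show "dist x y \<le> (L * ?N + 4 * C * ?d) * 2 powr (- (1 * real n))"
        using 1 st(1,2) sqrt_sum_squares_le_sum[of "dist s t" "dist (f s) (f t)"]
        by (simp add: dist_Pair_Pair algebra_simps)
    qed (use L C in auto)
    show "\<exists>\<U>. finite \<U> \<and> (\<lambda>t. (t, f t)) ` cube a L \<subseteq> \<Union>\<U> \<and>
        real (card \<U>) \<le> (4 ^ CARD('n) * 4 ^ CARD('d)) * 2 powr ((?N + ?d * (1 - \<alpha>)) * real n) \<and>
        (\<forall>U\<in>\<U>. bounded U \<and> diameter U \<le> (L * ?N + 4 * C * ?d) * 2 powr (- (1 * real n)))"
      using fin cover card small by (intro exI[of _ \<U>]) (auto simp: \<U>_def)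
  qed (use L C \<alpha> in auto)
  then show ?thesis by simp
qed

text \<open>The identity of an enclosing cube is Hoelder of order 1, so the image bound gives d /
  1.\<close>

lemma hausdorff_dim_bounded_le:
  fixes S :: "(real ^ 'd) set"
  assumes "bounded S"
  shows "hausdorff_dim S \<le> ereal (real CARD('d))"
proof -
  obtain B where B: "0 < B" "\<And>x. x \<in> S \<Longrightarrow> norm x \<le> B" using assms bounded_pos by blast
  define L where "L = 2 * B"
  define a :: "real ^ 'd" where "a = (\<chi> i. - B)"
  have L: "0 < L" using B by (simp add: L_def)
  have "S \<subseteq> (\<lambda>x. x) ` cube a L"
  proof
    fix x assume "x \<in> S"
    then have "\<bar>x $ i\<bar> \<le> B" for i using B(2) component_le_norm_cart[of x i] by (meson order_trans)
    then show "x \<in> (\<lambda>x. x) ` cube a L" by (auto simp: cube_def a_def L_def abs_le_iff minus_le_iff)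
  qed
  moreover have "dyadic_holder (cube a L) (L * CARD('d)) 1 (\<lambda>x. x)"
    unfolding dyadic_holder_def using L
    by (intro exI[of _ "L * CARD('d)"]) (auto simp: powr_minus powr_realpow divide_inverse)
  ultimately show ?thesis
    using hausdorff_dim_mono[of S "(\<lambda>x. x) ` cube a L"] hausdorff_dim_holder_image[OF L, of 1 a "\<lambda>x. x"]
    by (auto intro: order_trans)
qed

section \<open>Chaining along dyadic grids\<close>

lemma dyadic_holder_continuous_on:
  assumes f: "dyadic_holder S c \<alpha> f" and c: "0 < c" and \<alpha>: "0 < \<alpha>"
  shows "continuous_on S f"
  unfolding continuous_on_iff
proof (intro ballI allI impI)
  fix s :: 'a and e :: real assume s: "s \<in> S" and e: "0 < e"
  obtain C n0 where C: "0 < C" and n0: "\<And>n s t. n0 \<le> n \<Longrightarrow> s \<in> S \<Longrightarrow> t \<in> S \<Longrightarrow>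
      dist s t \<le> c / 2 ^ n \<Longrightarrow> dist (f s) (f t) \<le> C * 2 powr (- (\<alpha> * real n))"
    using f unfolding dyadic_holder_def by blast
  have "(\<lambda>n::nat. C * 2 powr (- (\<alpha> * real n))) \<longlonglongrightarrow> 0" using \<alpha> by real_asymp
  from order_tendstoD(2)[OF this e] eventually_ge_at_top[of n0]
  have "\<forall>\<^sub>F n in sequentially. C * 2 powr (- (\<alpha> * real n)) < e \<and> n0 \<le> n"
    by eventually_elim simp
  then obtain n where n: "C * 2 powr (- (\<alpha> * real n)) < e" "n0 \<le> n"
    using eventually_happens'[OF sequentially_bot] by blast
  show "\<exists>d>0. \<forall>t\<in>S. dist t s < d \<longrightarrow> dist (f t) (f s) < e"
  proof (intro exI[of _ "c / 2 ^ n"] conjI ballI impI)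
    fix t assume "t \<in> S" "dist t s < c / 2 ^ n"
    then show "dist (f t) (f s) < e" using n0[OF n(2), of t s] s n(1) by simp
  qed (use c in simp)
qed

text \<open>The factor 3 covers both consecutive projections of a point and projections of two nearby points.\<close>

definition grid_holder :: "real ^ 'n \<Rightarrow> real \<Rightarrow> real \<Rightarrow> (real ^ 'n \<Rightarrow> 'b::metric_space) \<Rightarrow> bool" where
  "grid_holder a L \<alpha> f \<longleftrightarrow> (\<exists>n0. \<forall>n\<ge>n0. \<forall>u\<in>grid a L n. \<forall>v\<in>grid a L n.
     dist u v \<le> 3 * (L * CARD('n)) / 2 ^ n \<longrightarrow> dist (f u) (f v) \<le> 2 powr (- (\<alpha> * real n)))"

text \<open>Refining the projection from level n to n + 1 costs q^(n + 1) with q = 2^(-\<alpha>), so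
  passing to any finer level costs at most a geometric tail. Both estimates share one threshold
  \<open>n0\<close>, as they are combined at the same level later.\<close>

lemma grid_holder_chaining:
  fixes a :: "real ^ 'n"
  assumes L: "0 < L" and \<alpha>: "0 < \<alpha>" and f: "grid_holder a L \<alpha> f"
  obtains n0 where
    "\<And>n m t. n0 \<le> n \<Longrightarrow> n \<le> m \<Longrightarrow> t \<in> cube a L \<Longrightarrow>
       dist (f (grid_proj a L n t)) (f (grid_proj a L m t)) \<le> 2 powr (- (\<alpha> * real n)) / (1 - 2 powr (- \<alpha>))"
    "\<And>n s t. n0 \<le> n \<Longrightarrow> s \<in> cube a L \<Longrightarrow> t \<in> cube a L \<Longrightarrow> dist s t \<le> L * CARD('n) / 2 ^ n \<Longrightarrow>
       dist (f (grid_proj a L n s)) (f (grid_proj a L n t)) \<le> 2 powr (- (\<alpha> * real n))"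
proof -
  define c where "c = L * real CARD('n)"
  have c: "0 < c" using L by (simp add: c_def)
  have proj: "dist t (grid_proj a L n t) \<le> c / 2 ^ n" for t n
    unfolding c_def by (rule dist_grid_proj[OF L])
  obtain n0 where n0: "\<And>n u v. n0 \<le> n \<Longrightarrow> u \<in> grid a L n \<Longrightarrow> v \<in> grid a L n \<Longrightarrow>
      dist u v \<le> 3 * c / 2 ^ n \<Longrightarrow> dist (f u) (f v) \<le> 2 powr (- (\<alpha> * real n))"
    using f unfolding grid_holder_def c_def by blast
  define q where "q = 2 powr (- \<alpha>)"
  have q: "0 < q" "q < 1" using \<alpha> powr_less_mono[of "- \<alpha>" 0 2] by (auto simp: q_def)
  have qn: "2 powr (- (\<alpha> * real n)) = q ^ n" for n
    by (simp add: q_def powr_powr flip: powr_realpow)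
  have refine: "dist (f (grid_proj a L n t)) (f (grid_proj a L (Suc n) t)) \<le> q ^ Suc n"
    if "n0 \<le> n" "t \<in> cube a L" for n t
  proof -
    have "grid_proj a L n t \<in> grid a L (Suc n)" "grid_proj a L (Suc n) t \<in> grid a L (Suc n)"
      using grid_proj_in_grid[OF L that(2)] grid_Suc_subset by blast+
    moreover have "dist (grid_proj a L n t) (grid_proj a L (Suc n) t) \<le> 3 * c / 2 ^ Suc n"
    proof -
      have "dist (grid_proj a L n t) (grid_proj a L (Suc n) t)
          \<le> dist t (grid_proj a L n t) + dist t (grid_proj a L (Suc n) t)" by (rule dist_triangle3)
      also have "\<dots> \<le> c / 2 ^ n + c / 2 ^ Suc n" by (intro add_mono proj)
      also have "\<dots> = 3 * c / 2 ^ Suc n" by (simp add: field_simps)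
      finally show ?thesis .
    qed
    ultimately show ?thesis unfolding qn[symmetric] using that by (intro n0) auto
  qed
  \<comment> \<open>Keeping the subtracted q^m makes the bound telescope, so that the induction step
    closes with the same constant.\<close>
  have chain: "dist (f (grid_proj a L n t)) (f (grid_proj a L m t)) \<le> (q ^ n - q ^ m) / (1 - q)"
    if "n0 \<le> n" "n \<le> m" "t \<in> cube a L" for n m t
    using that(2)
  proof (induction m rule: dec_induct)
    case base then show ?case by simp
  next
    case (step m)
    have "dist (f (grid_proj a L n t)) (f (grid_proj a L (Suc m) t))
        \<le> dist (f (grid_proj a L n t)) (f (grid_proj a L m t)) + dist (f (grid_proj a L m t)) (f (grid_proj a L (Suc m) t))"
      by (rule dist_triangle)
    also have "\<dots> \<le> (q ^ n - q ^ m) / (1 - q) + q ^ Suc m"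
      using step that by (intro add_mono refine) auto
    also have "\<dots> \<le> (q ^ n - q ^ m) / (1 - q) + q ^ m"
      using q by (intro add_left_mono power_decreasing) auto
    also have "\<dots> = (q ^ n - q ^ Suc m) / (1 - q)" using q by (simp add: field_simps)
    finally show ?case .
  qed
  show thesis
  proof (rule that)
    fix n m t assume *: "n0 \<le> n" "n \<le> m" "t \<in> cube a L"
    have "dist (f (grid_proj a L n t)) (f (grid_proj a L m t)) \<le> (q ^ n - q ^ m) / (1 - q)"
      by (rule chain[OF *])
    also have "\<dots> \<le> q ^ n / (1 - q)" using q by (intro divide_right_mono) auto
    finally show "dist (f (grid_proj a L n t)) (f (grid_proj a L m t)) \<le> 2 powr (- (\<alpha> * real n)) / (1 - 2 powr (- \<alpha>))"
      by (simp add: qn q_def)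
  next
    fix n s t assume *: "n0 \<le> n" "s \<in> cube a L" "t \<in> cube a L" and st: "dist s t \<le> L * CARD('n) / 2 ^ n"
    have "dist (grid_proj a L n s) (grid_proj a L n t) \<le> dist s (grid_proj a L n s) + dist s (grid_proj a L n t)"
      by (rule dist_triangle3)
    also have "dist s (grid_proj a L n t) \<le> dist s t + dist t (grid_proj a L n t)"
      by (rule dist_triangle)
    also have "dist s (grid_proj a L n s) + (dist s t + dist t (grid_proj a L n t)) \<le> c / 2 ^ n + (c / 2 ^ n + c / 2 ^ n)"
      using st by (intro add_mono proj) (simp add: c_def)
    finally have "dist (grid_proj a L n s) (grid_proj a L n t) \<le> 3 * c / 2 ^ n" by simp
    then show "dist (f (grid_proj a L n s)) (f (grid_proj a L n t)) \<le> 2 powr (- (\<alpha> * real n))"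
      using * by (intro n0 grid_proj_in_grid[OF L])
  qed
qed

text \<open>Convergence holds at all points of the cube for the same path, not merely almost surely
  at each point. This allows a modification to be defined by limits along the grids.\<close>

lemma grid_holder_convergent:
  fixes f :: "real ^ 'n \<Rightarrow> 'b::complete_space"
  assumes L: "0 < L" and \<alpha>: "0 < \<alpha>" and f: "grid_holder a L \<alpha> f" and t: "t \<in> cube a L"
  shows "convergent (\<lambda>n. f (grid_proj a L n t))"
proof -
  obtain n0 where n0: "\<And>n m t. n0 \<le> n \<Longrightarrow> n \<le> m \<Longrightarrow> t \<in> cube a L \<Longrightarrow>
      dist (f (grid_proj a L n t)) (f (grid_proj a L m t)) \<le> 2 powr (- (\<alpha> * real n)) / (1 - 2 powr (- \<alpha>))"
    using grid_holder_chaining[OF L \<alpha> f] by metis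
  have "Cauchy (\<lambda>n. f (grid_proj a L n t))"
  proof (rule metric_CauchyI)
    fix e :: real assume e: "0 < e"
    have "(\<lambda>n::nat. 2 powr (- (\<alpha> * real n)) / (1 - 2 powr (- \<alpha>))) \<longlonglongrightarrow> 0"
      using \<alpha> by real_asymp
    then have "\<forall>\<^sub>F n::nat in sequentially. 2 powr (- (\<alpha> * real n)) / (1 - 2 powr (- \<alpha>)) < e / 2"
      using e by (intro order_tendstoD(2)) auto
    from this eventually_ge_at_top[of n0]
    have "\<forall>\<^sub>F n in sequentially. 2 powr (- (\<alpha> * real n)) / (1 - 2 powr (- \<alpha>)) < e / 2 \<and> n0 \<le> n"
      by eventually_elim simp
    then obtain k where k: "2 powr (- (\<alpha> * real k)) / (1 - 2 powr (- \<alpha>)) < e / 2" "n0 \<le> k"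
      using eventually_happens'[OF sequentially_bot] by blast
    show "\<exists>K. \<forall>m\<ge>K. \<forall>n\<ge>K. dist (f (grid_proj a L m t)) (f (grid_proj a L n t)) < e"
    proof (intro exI[of _ k] allI impI)
      fix m n assume m: "k \<le> m" and n: "k \<le> n"
      then show "dist (f (grid_proj a L m t)) (f (grid_proj a L n t)) < e"
        using n0[OF k(2) m t] n0[OF k(2) n t] k(1)
          dist_triangle3[of "f (grid_proj a L m t)" "f (grid_proj a L n t)" "f (grid_proj a L k t)"]
        by linarith
    qed
  qed
  then show ?thesis by (simp add: Cauchy_convergent)
qed

text \<open>Compare \<open>g s\<close> and \<open>g t\<close> through their projections: two
  chaining tails and one grid increment, hence the constant 2 A + 1. It serves both for the
  constructed modification and for a given continuous one, whose values are limits of grid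
  values.\<close>

lemma dyadic_holder_grid_limit:
  fixes f g :: "real ^ 'n \<Rightarrow> 'b::metric_space"
  assumes L: "0 < L" and \<alpha>: "0 < \<alpha>" and f: "grid_holder a L \<alpha> f"
    and lim: "\<And>t. t \<in> cube a L \<Longrightarrow> (\<lambda>n. f (grid_proj a L n t)) \<longlonglongrightarrow> g t"
  shows "dyadic_holder (cube a L) (L * CARD('n)) \<alpha> g"
proof -
  obtain n0 where n0: "\<And>n m t. n0 \<le> n \<Longrightarrow> n \<le> m \<Longrightarrow> t \<in> cube a L \<Longrightarrow>
      dist (f (grid_proj a L n t)) (f (grid_proj a L m t)) \<le> 2 powr (- (\<alpha> * real n)) / (1 - 2 powr (- \<alpha>))"
    and n1: "\<And>n s t. n0 \<le> n \<Longrightarrow> s \<in> cube a L \<Longrightarrow> t \<in> cube a L \<Longrightarrow> dist s t \<le> L * CARD('n) / 2 ^ n \<Longrightarrow>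
       dist (f (grid_proj a L n s)) (f (grid_proj a L n t)) \<le> 2 powr (- (\<alpha> * real n))"
    using grid_holder_chaining[OF L \<alpha> f] by metis
  have q: "2 powr (- \<alpha>) < 1" using \<alpha> powr_less_mono[of "- \<alpha>" 0 2] by auto
  define A where "A = 1 / (1 - 2 powr (- \<alpha>))"
  have A: "0 < A" using q by (simp add: A_def)
  have lim': "dist (f (grid_proj a L n t)) (g t) \<le> A * 2 powr (- (\<alpha> * real n))"
    if "n0 \<le> n" "t \<in> cube a L" for n t
  proof (rule tendsto_upperbound)
    show "(\<lambda>m. dist (f (grid_proj a L n t)) (f (grid_proj a L m t))) \<longlonglongrightarrow> dist (f (grid_proj a L n t)) (g t)"
      by (intro tendsto_intros lim that)
    show "\<forall>\<^sub>F m in sequentially. dist (f (grid_proj a L n t)) (f (grid_proj a L m t)) \<le> A * 2 powr (- (\<alpha> * real n))"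
      using eventually_ge_at_top[of n] by eventually_elim (use n0 that in \<open>simp add: A_def\<close>)
  qed simp
  have "dist (g s) (g t) \<le> (2 * A + 1) * 2 powr (- (\<alpha> * real n))"
    if "n0 \<le> n" "s \<in> cube a L" "t \<in> cube a L" "dist s t \<le> L * CARD('n) / 2 ^ n" for n s t
  proof -
    have "dist (g s) (g t) \<le> dist (f (grid_proj a L n s)) (g s) + dist (f (grid_proj a L n s)) (g t)"
      by (rule dist_triangle3)
    also have "dist (f (grid_proj a L n s)) (g t)
        \<le> dist (f (grid_proj a L n s)) (f (grid_proj a L n t)) + dist (f (grid_proj a L n t)) (g t)"
      by (rule dist_triangle)
    finally show ?thesis
      using lim'[OF that(1,2)] lim'[OF that(1,3)] n1[OF that] by (simp add: algebra_simps)
  qed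
  then show ?thesis
    unfolding dyadic_holder_def using A by (intro exI[of _ "2 * A + 1"]) auto
qed

section \<open>Almost sure Hoelder bounds along the grids\<close>

context prob_space
begin

lemma borel_cantelli_geometric:
  assumes A: "\<And>n. A n \<in> events" and \<delta>: "0 < \<delta>" and le: "\<And>n. prob (A n) \<le> K * 2 powr (- (\<delta> * real n))"
  shows "AE \<omega> in M. \<forall>\<^sub>F n in sequentially. \<omega> \<notin> A n"
proof -
  have q: "2 powr (- \<delta>) < 1" using \<delta> powr_less_mono[of "- \<delta>" 0 2] by auto
  have "summable (\<lambda>n. prob (A n))"
  proof (rule summable_comparison_test')
    show "summable (\<lambda>n. K * (2 powr (- \<delta>)) ^ n)"
      using q by (intro summable_mult summable_geometric) auto
    have "(2 powr (- \<delta>)) ^ n = 2 powr (- (\<delta> * real n))" for n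
      by (simp add: powr_powr flip: powr_realpow)
    then show "norm (prob (A n)) \<le> K * (2 powr (- \<delta>)) ^ n" if "0 \<le> n" for n
      using le[of n] by simp
  qed
  from borel_cantelli_AE1[OF A _ this]
  have "AE \<omega> in M. \<forall>\<^sub>F n in sequentially. \<omega> \<in> space M - A n" by (simp add: emeasure_eq_measure)
  then show ?thesis by eventually_elim (auto elim: eventually_mono)
qed

text \<open>At level n there are at most of order 2^(2 N n) pairs, and a close pair exceeds
  2^(-\<alpha> n) with probability of order 2^(-2 \<delta> k n), where \<delta> = \<alpha>' -
  \<alpha>. The gap \<delta> may be arbitrarily small, which is why tails of every moment order
  \<open>k\<close> are assumed.\<close>

lemma AE_grid_holder:
  fixes X :: "real ^ 'n \<Rightarrow> 'a \<Rightarrow> 'b::{metric_space,second_countable_topology}"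
  assumes L: "0 < L" and \<alpha>: "\<alpha> < \<alpha>'" "0 < \<alpha>'"
    and X: "\<And>u. u \<in> cube a L \<Longrightarrow> X u \<in> borel_measurable M"
    and tail: "\<And>k. \<exists>C\<ge>0. \<forall>u\<in>cube a L. \<forall>v\<in>cube a L. \<forall>r>0.
      prob {\<omega> \<in> space M. r \<le> dist (X u \<omega>) (X v \<omega>)} \<le> C * (dist u v powr (2 * \<alpha>') / r\<^sup>2) ^ k"
  shows "AE \<omega> in M. grid_holder a L \<alpha> (\<lambda>u. X u \<omega>)"
proof -
  define c where "c = 3 * (L * real CARD('n))"
  have c: "0 < c" using L by (simp add: c_def)
  define \<delta> where "\<delta> = \<alpha>' - \<alpha>"
  have \<delta>: "0 < \<delta>" using \<alpha> by (simp add: \<delta>_def)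
  \<comment> \<open>With \<delta> k \<ge> N + 1 the number of pairs is beaten and a factor 2^(-2 n)
    is left for Borel-Cantelli.\<close>
  obtain k :: nat where "(real CARD('n) + 1) / \<delta> \<le> real k" using real_arch_simple by blast
  then have k: "real CARD('n) + 1 \<le> \<delta> * real k" using \<delta> by (simp add: field_simps)
  obtain C where C: "0 \<le> C" and tail: "\<And>u v r. u \<in> cube a L \<Longrightarrow> v \<in> cube a L \<Longrightarrow> 0 < r \<Longrightarrow>
      prob {\<omega> \<in> space M. r \<le> dist (X u \<omega>) (X v \<omega>)} \<le> C * (dist u v powr (2 * \<alpha>') / r\<^sup>2) ^ k"
    using tail[of k] by blast
  have G: "u \<in> cube a L" if "u \<in> grid a L n" for u n
    using grid_subset_cube[of L a n] L that by auto
  define P where "P n = {p \<in> grid a L n \<times> grid a L n. dist (fst p) (snd p) \<le> c / 2 ^ n}" for n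
  define B where "B n p = {\<omega> \<in> space M. 2 powr (- (\<alpha> * real n)) \<le> dist (X (fst p) \<omega>) (X (snd p) \<omega>)}" for n p
  define A where "A n = (\<Union>p\<in>P n. B n p)" for n
  have fin: "finite (P n)" for n
    unfolding P_def by (intro finite_subset[OF _ finite_cartesian_product[OF finite_grid finite_grid]]) auto
  have B: "B n p \<in> events" if "p \<in> P n" for n p
  proof -
    have [measurable]: "X (fst p) \<in> borel_measurable M" "X (snd p) \<in> borel_measurable M"
      using that by (auto simp: P_def intro!: X G)
    show ?thesis unfolding B_def by measurable
  qed
  have "prob (A n) \<le> 4 ^ CARD('n) * (C * (c powr (2 * \<alpha>')) ^ k) * 2 powr (- (2 * real n))" for n
  proof -
    have "prob (A n) \<le> (\<Sum>p\<in>P n. prob (B n p))"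
      unfolding A_def by (intro finite_measure_subadditive_finite fin) (auto simp: B)
    also have "\<dots> \<le> (\<Sum>p\<in>P n. C * ((c powr (2 * \<alpha>')) ^ k * 2 powr (- (2 * \<delta> * real k * real n))))"
    proof (rule sum_mono)
      fix p assume p: "p \<in> P n"
      have "prob (B n p) \<le> C * (dist (fst p) (snd p) powr (2 * \<alpha>') / (2 powr (- (\<alpha> * real n)))\<^sup>2) ^ k"
        unfolding B_def using p by (intro tail) (auto simp: P_def intro!: G)
      also have "\<dots> \<le> C * ((c / 2 ^ n) powr (2 * \<alpha>') / (2 powr (- (\<alpha> * real n)))\<^sup>2) ^ k"
        using p \<alpha> C by (intro mult_left_mono power_mono divide_right_mono powr_mono2) (auto simp: P_def)
      also have "(c / 2 ^ n) powr (2 * \<alpha>') / (2 powr (- (\<alpha> * real n)))\<^sup>2 = c powr (2 * \<alpha>') * 2 powr (- (2 * \<delta> * real n))"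
      proof -
        have "(c / 2 ^ n) powr (2 * \<alpha>') = c powr (2 * \<alpha>') / 2 powr (2 * \<alpha>' * real n)"
          using c by (simp add: powr_divide powr_powr mult.commute flip: powr_realpow)
        moreover have "(2 powr (- (\<alpha> * real n)))\<^sup>2 = 2 powr (- (2 * \<alpha> * real n))"
          by (simp add: power2_eq_square mult.assoc flip: powr_add)
        ultimately have "(c / 2 ^ n) powr (2 * \<alpha>') / (2 powr (- (\<alpha> * real n)))\<^sup>2
            = c powr (2 * \<alpha>') * (1 / (2 powr (2 * \<alpha>' * real n) * 2 powr (- (2 * \<alpha> * real n))))" by simp
        also have "2 powr (2 * \<alpha>' * real n) * 2 powr (- (2 * \<alpha> * real n)) = 2 powr (2 * \<delta> * real n)"
          by (simp add: \<delta>_def algebra_simps flip: powr_add)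
        finally show ?thesis by (simp add: powr_minus divide_inverse)
      qed
      also have "(c powr (2 * \<alpha>') * 2 powr (- (2 * \<delta> * real n))) ^ k = (c powr (2 * \<alpha>')) ^ k * 2 powr (- (2 * \<delta> * real k * real n))"
        by (simp add: power_mult_distrib powr_power mult_ac)
      finally show "prob (B n p) \<le> C * ((c powr (2 * \<alpha>')) ^ k * 2 powr (- (2 * \<delta> * real k * real n)))" .
    qed
    also have "\<dots> = real (card (P n)) * (C * ((c powr (2 * \<alpha>')) ^ k * 2 powr (- (2 * \<delta> * real k * real n))))" by simp
    also have "\<dots> \<le> (4 ^ CARD('n) * 2 powr (2 * real CARD('n) * real n)) * (C * ((c powr (2 * \<alpha>')) ^ k * 2 powr (- (2 * \<delta> * real k * real n))))"
    proof (rule mult_right_mono)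
      have "card (P n) \<le> card (grid a L n \<times> grid a L n)"
        unfolding P_def by (intro card_mono finite_cartesian_product finite_grid) auto
      then have "real (card (P n)) \<le> real (card (grid a L n)) * real (card (grid a L n))"
        by (simp add: card_cartesian_product flip: of_nat_mult)
      also have "\<dots> \<le> (2 * 2 ^ n) ^ CARD('n) * (2 * 2 ^ n) ^ CARD('n)"
        by (intro mult_mono card_grid_le) auto
      also have "\<dots> = ((2 * 2 ^ n) * (2 * 2 ^ n)) ^ CARD('n)"
        by (rule power_mult_distrib[symmetric])
      also have "(2 * 2 ^ n) * (2 * 2 ^ n) = (4 * (2 ^ n * 2 ^ n) :: real)" by simp
      also have "(4 * (2 ^ n * 2 ^ n) :: real) ^ CARD('n) = 4 ^ CARD('n) * 2 powr (2 * real CARD('n) * real n)"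
      proof -
        have "(2 ^ n * 2 ^ n :: real) ^ CARD('n) = 2 ^ ((n + n) * CARD('n))"
          by (simp add: power_add power_mult)
        also have "\<dots> = 2 powr (2 * real CARD('n) * real n)"
          by (subst powr_realpow[symmetric]) (auto simp: algebra_simps)
        finally show ?thesis by (simp add: power_mult_distrib)
      qed
      finally show "real (card (P n)) \<le> 4 ^ CARD('n) * 2 powr (2 * real CARD('n) * real n)" .
    qed (use C in auto)
    also have "\<dots> = 4 ^ CARD('n) * (C * (c powr (2 * \<alpha>')) ^ k) * 2 powr (2 * real CARD('n) * real n - 2 * \<delta> * real k * real n)"
      by (simp add: powr_diff powr_minus divide_inverse)
    also have "\<dots> \<le> 4 ^ CARD('n) * (C * (c powr (2 * \<alpha>')) ^ k) * 2 powr (- (2 * real n))"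
    proof (intro mult_left_mono powr_mono)
      have "(real CARD('n) + 1) * real n \<le> (\<delta> * real k) * real n" using k by (intro mult_right_mono) auto
      then show "2 * real CARD('n) * real n - 2 * \<delta> * real k * real n \<le> - (2 * real n)"
        by (simp add: algebra_simps)
    qed (use C in auto)
    finally show ?thesis .
  qed
  moreover have "A n \<in> events" for n
    unfolding A_def by (intro sets.finite_UN fin B)
  ultimately have "AE \<omega> in M. \<forall>\<^sub>F n in sequentially. \<omega> \<notin> A n"
    by (intro borel_cantelli_geometric[where \<delta> = 2]) auto
  moreover have "grid_holder a L \<alpha> (\<lambda>u. X u \<omega>)"
    if ev: "\<forall>\<^sub>F n in sequentially. \<omega> \<notin> A n" and \<omega>: "\<omega> \<in> space M" for \<omega>
  proof -
    obtain n0 where n0: "\<And>n. n0 \<le> n \<Longrightarrow> \<omega> \<notin> A n" using ev by (auto simp: eventually_sequentially)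
    have "dist (X u \<omega>) (X v \<omega>) \<le> 2 powr (- (\<alpha> * real n))"
      if "n0 \<le> n" "u \<in> grid a L n" "v \<in> grid a L n" "dist u v \<le> c / 2 ^ n" for n u v
    proof -
      have "(u, v) \<in> P n" using that by (simp add: P_def)
      then have "\<omega> \<notin> B n (u, v)" using n0[OF that(1)] by (auto simp: A_def)
      then show ?thesis using \<omega> by (simp add: B_def)
    qed
    then show ?thesis unfolding grid_holder_def c_def[symmetric] by blast
  qed
  ultimately show ?thesis by (auto elim: AE_mp)
qed

text \<open>At a single \<open>t\<close> no union over the grid occurs, so the tail of order k = 1
  suffices. The threshold 2^(-\<alpha>' n / 2) spends half of the decay 2^(-2 \<alpha>' n) on the
  deviation and leaves the other half to be summed.\<close>

lemma AE_grid_proj_tendsto: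
  fixes X :: "real ^ 'n \<Rightarrow> 'a \<Rightarrow> 'b::{metric_space,second_countable_topology}"
  assumes L: "0 < L" and \<alpha>': "0 < \<alpha>'" and t: "t \<in> cube a L"
    and X: "\<And>u. u \<in> cube a L \<Longrightarrow> X u \<in> borel_measurable M"
    and C: "0 \<le> C" and tail: "\<And>u v r. u \<in> cube a L \<Longrightarrow> v \<in> cube a L \<Longrightarrow> 0 < r \<Longrightarrow>
      prob {\<omega> \<in> space M. r \<le> dist (X u \<omega>) (X v \<omega>)} \<le> C * (dist u v powr (2 * \<alpha>') / r\<^sup>2)"
  shows "AE \<omega> in M. (\<lambda>n. X (grid_proj a L n t) \<omega>) \<longlonglongrightarrow> X t \<omega>"
proof -
  define c where "c = L * real CARD('n)"
  have c: "0 < c" using L by (simp add: c_def)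
  have P: "grid_proj a L n t \<in> cube a L" for n
    using grid_proj_in_grid[OF L t] grid_subset_cube[of L a n] L by auto
  define A where "A n = {\<omega> \<in> space M. 2 powr (- (\<alpha>' / 2 * real n)) \<le> dist (X (grid_proj a L n t) \<omega>) (X t \<omega>)}" for n
  have [measurable]: "X (grid_proj a L n t) \<in> borel_measurable M" "X t \<in> borel_measurable M" for n
    using P t by (auto intro: X)
  have A: "A n \<in> events" for n unfolding A_def by measurable
  have "prob (A n) \<le> C * c powr (2 * \<alpha>') * 2 powr (- (\<alpha>' * real n))" for n
  proof -
    have "prob (A n) \<le> C * (dist (grid_proj a L n t) t powr (2 * \<alpha>') / (2 powr (- (\<alpha>' / 2 * real n)))\<^sup>2)"
      unfolding A_def by (intro tail P t) auto
    also have "\<dots> \<le> C * ((c / 2 ^ n) powr (2 * \<alpha>') / (2 powr (- (\<alpha>' / 2 * real n)))\<^sup>2)"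
      using C \<alpha>' dist_grid_proj[OF L, of t a n]
      by (intro mult_left_mono divide_right_mono powr_mono2) (auto simp: c_def dist_commute)
    also have "(c / 2 ^ n) powr (2 * \<alpha>') = c powr (2 * \<alpha>') / 2 powr (2 * \<alpha>' * real n)"
      using c by (simp add: powr_divide powr_powr mult.commute flip: powr_realpow)
    also have "(2 powr (- (\<alpha>' / 2 * real n)))\<^sup>2 = 2 powr (- (\<alpha>' * real n))"
      by (simp add: power2_eq_square flip: powr_add)
    also have "C * (c powr (2 * \<alpha>') / 2 powr (2 * \<alpha>' * real n) / 2 powr (- (\<alpha>' * real n)))
        = C * c powr (2 * \<alpha>') * (1 / (2 powr (2 * \<alpha>' * real n) * 2 powr (- (\<alpha>' * real n))))" by simp
    also have "2 powr (2 * \<alpha>' * real n) * 2 powr (- (\<alpha>' * real n)) = 2 powr (\<alpha>' * real n)"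
      by (simp flip: powr_add)
    finally show ?thesis by (simp add: powr_minus divide_inverse)
  qed
  from borel_cantelli_geometric[OF A \<alpha>' this]
  have "AE \<omega> in M. \<forall>\<^sub>F n in sequentially. \<omega> \<notin> A n" .
  moreover have "(\<lambda>n. X (grid_proj a L n t) \<omega>) \<longlonglongrightarrow> X t \<omega>"
    if ev: "\<forall>\<^sub>F n in sequentially. \<omega> \<notin> A n" and \<omega>: "\<omega> \<in> space M" for \<omega>
  proof (rule metric_tendsto_imp_tendsto)
    show "(\<lambda>n::nat. 2 powr (- (\<alpha>' / 2 * real n))) \<longlonglongrightarrow> 0" using \<alpha>' by real_asymp
    show "\<forall>\<^sub>F n in sequentially. dist (X (grid_proj a L n t) \<omega>) (X t \<omega>) \<le> dist (2 powr (- (\<alpha>' / 2 * real n))) 0"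
      using ev by eventually_elim (use \<omega> in \<open>auto simp: A_def\<close>)
  qed
  ultimately show ?thesis by (auto elim: AE_mp)
qed

end

section \<open>Gaussian increments\<close>

context prob_space
begin

text \<open>Common interface of the tail and small-ball estimates: \<open>g\<close> is a moment
  integrand in the former and a constant on an interval in the latter.\<close>

lemma prob_normal_le:
  assumes D: "distributed M lborel D (normal_density \<mu> \<sigma>)" and A [measurable]: "A \<in> sets borel"
    and g: "\<And>x. x \<in> A \<Longrightarrow> normal_density \<mu> \<sigma> x \<le> g x" and g0: "\<And>x. 0 \<le> g x"
    and int: "has_bochner_integral lborel g c"
  shows "prob {\<omega> \<in> space M. D \<omega> \<in> A} \<le> c"
proof -
  have "emeasure M (D -` A \<inter> space M) = (\<integral>\<^sup>+x. ennreal (normal_density \<mu> \<sigma> x) * indicator A x \<partial>lborel)"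
    by (rule distributed_emeasure[OF D]) simp
  also have "\<dots> \<le> (\<integral>\<^sup>+x. ennreal (g x) \<partial>lborel)"
    using g g0 by (intro nn_integral_mono) (auto simp: indicator_def intro: ennreal_leI)
  also have "\<dots> = ennreal c"
    using int g0 by (simp add: nn_integral_eq_integral has_bochner_integral_iff)
  finally have "ennreal (prob (D -` A \<inter> space M)) \<le> ennreal c" by (simp add: emeasure_eq_measure)
  moreover have "0 \<le> c"
    using int g0 by (auto simp: has_bochner_integral_iff intro: integral_nonneg_AE)
  ultimately show ?thesis by (simp add: vimage_def Int_def conj_commute)
qed

lemma normal_second_moment:
  assumes D: "distributed M lborel D (normal_density \<mu> \<sigma>)" and \<sigma>: "0 < \<sigma>"
  shows "expectation (\<lambda>\<omega>. \<bar>D \<omega>\<bar>\<^sup>2) = \<mu>\<^sup>2 + \<sigma>\<^sup>2" "integrable M (\<lambda>\<omega>. \<bar>D \<omega>\<bar>\<^sup>2)"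
proof -
  let ?f = "normal_density \<mu> \<sigma>"
  have 2: "has_bochner_integral lborel (\<lambda>x. ?f x * (x - \<mu>)\<^sup>2) (\<sigma>\<^sup>2)"
    using normal_moment_even[OF \<sigma>, of \<mu> 1] by simp
  have 1: "has_bochner_integral lborel (\<lambda>x. ?f x * (x - \<mu>)) 0"
    using normal_moment_odd[OF \<sigma>, of \<mu> 0] by simp
  have 0: "has_bochner_integral lborel ?f 1"
    using \<sigma> by (auto simp: has_bochner_integral_iff)
  have "has_bochner_integral lborel
      (\<lambda>x. ?f x * (x - \<mu>)\<^sup>2 + (?f x * (x - \<mu>)) * (2 * \<mu>) + ?f x * \<mu>\<^sup>2) (\<sigma>\<^sup>2 + 0 * (2 * \<mu>) + 1 * \<mu>\<^sup>2)"
    by (intro has_bochner_integral_add has_bochner_integral_mult_left 0 1 2)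
  also have "(\<lambda>x. ?f x * (x - \<mu>)\<^sup>2 + (?f x * (x - \<mu>)) * (2 * \<mu>) + ?f x * \<mu>\<^sup>2) = (\<lambda>x. ?f x * \<bar>x\<bar>\<^sup>2)"
    by (auto simp: fun_eq_iff power2_eq_square algebra_simps)
  finally have *: "has_bochner_integral lborel (\<lambda>x. ?f x * \<bar>x\<bar>\<^sup>2) (\<mu>\<^sup>2 + \<sigma>\<^sup>2)" by (simp add: add.commute)
  show "integrable M (\<lambda>\<omega>. \<bar>D \<omega>\<bar>\<^sup>2)"
    using * distributed_integrable[OF D, of "\<lambda>x. \<bar>x\<bar>\<^sup>2"] by (auto simp: has_bochner_integral_iff)
  show "expectation (\<lambda>\<omega>. \<bar>D \<omega>\<bar>\<^sup>2) = \<mu>\<^sup>2 + \<sigma>\<^sup>2"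
    using * distributed_integral[OF D, of "\<lambda>x. \<bar>x\<bar>\<^sup>2"] by (auto simp: has_bochner_integral_iff)
qed

lemma gaussian_square_integrable:
  assumes "gaussian_rv M D"
  shows "integrable M (\<lambda>\<omega>. \<bar>D \<omega>\<bar>\<^sup>2)"
proof -
  have [measurable]: "D \<in> borel_measurable M" using assms by (auto simp: gaussian_rv_def)
  consider \<mu> \<sigma> where "0 < \<sigma>" "distributed M lborel D (normal_density \<mu> \<sigma>)"
    | \<mu> where "AE \<omega> in M. D \<omega> = \<mu>"
    using assms by (auto simp: gaussian_rv_def)
  then show ?thesis
  proof cases
    case 1 then show ?thesis by (intro normal_second_moment)
  next
    case 2
    have "integrable M (\<lambda>\<omega>. \<bar>D \<omega>\<bar>\<^sup>2) \<longleftrightarrow> integrable M (\<lambda>\<omega>. \<bar>\<mu>\<bar>\<^sup>2)"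
      using 2 by (intro integrable_cong_AE) auto
    then show ?thesis by simp
  qed
qed

text \<open>The mean may be nonzero, so Markov's inequality is applied to a central moment. In the
  nondegenerate case, if |\<mu>| < r / 2 then |x| \<ge> r forces |x - \<mu>| \<ge> r / 2, whence
  4^k; otherwise the second moment is at least r^2 / 4 and the right-hand side is at least
  1.\<close>

lemma gaussian_tail:
  assumes G: "gaussian_rv M D" and r: "0 < r"
  shows "prob {\<omega> \<in> space M. r \<le> \<bar>D \<omega>\<bar>} \<le> 4 ^ k * fact (2 * k) * (expectation (\<lambda>\<omega>. \<bar>D \<omega>\<bar>\<^sup>2) / r\<^sup>2) ^ k"
    (is "?P \<le> _ * (?q / _) ^ k")
proof -
  have [measurable]: "D \<in> borel_measurable M" using G by (auto simp: gaussian_rv_def)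
  have big: ?thesis if "r\<^sup>2 / 4 \<le> ?q"
  proof -
    have "1 \<le> (4 * (?q / r\<^sup>2)) ^ k"
      using that r by (intro one_le_power) (simp add: field_simps)
    also have "\<dots> \<le> fact (2 * k) * (4 * (?q / r\<^sup>2)) ^ k"
    proof -
      have "1 \<le> (fact (2 * k) :: real)" by (rule fact_ge_1)
      moreover have "0 \<le> (4 * (?q / r\<^sup>2)) ^ k"
        by (rule order_trans[OF zero_le_one \<open>1 \<le> (4 * (?q / r\<^sup>2)) ^ k\<close>])
      ultimately show ?thesis using mult_right_mono[of 1 "fact (2 * k)" "(4 * (?q / r\<^sup>2)) ^ k"] by simp
    qed
    finally show ?thesis using prob_le_1 by (simp add: power_mult_distrib mult_ac power_divide) (meson order_trans prob_le_1)
  qed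
  consider \<mu> \<sigma> where "0 < \<sigma>" "distributed M lborel D (normal_density \<mu> \<sigma>)"
    | \<mu> where "AE \<omega> in M. D \<omega> = \<mu>"
    using G by (auto simp: gaussian_rv_def)
  then show ?thesis
  proof cases
    case 2
    have q: "?q = \<mu>\<^sup>2"
    proof -
      have "?q = expectation (\<lambda>\<omega>. \<bar>\<mu>\<bar>\<^sup>2)" using 2 by (intro integral_cong_AE) auto
      then show ?thesis by (simp add: prob_space)
    qed
    show ?thesis
    proof (cases "r \<le> \<bar>\<mu>\<bar>")
      case True
      then have "r\<^sup>2 \<le> \<mu>\<^sup>2" using r by (simp add: abs_le_square_iff[symmetric])
      then have "r\<^sup>2 / 4 \<le> ?q" using q zero_le_power2[of r] by linarith
      then show ?thesis by (rule big)
    next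
      case False
      have "AE \<omega> in M. \<not> r \<le> \<bar>D \<omega>\<bar>" using 2 False by auto
      then have "?P = 0" by (subst prob_eq_0) auto
      then show ?thesis by simp
    qed
  next
    case 1
    have q: "?q = \<mu>\<^sup>2 + \<sigma>\<^sup>2" using normal_second_moment[OF 1(2,1)] by simp
    show ?thesis
    proof (cases "r / 2 \<le> \<bar>\<mu>\<bar>")
      case True
      then have "(r / 2)\<^sup>2 \<le> \<mu>\<^sup>2" using r by (simp add: abs_le_square_iff[symmetric])
      then have "r\<^sup>2 / 4 \<le> \<mu>\<^sup>2" by (simp add: power_divide)
      then have "r\<^sup>2 / 4 \<le> ?q" using q zero_le_power2[of \<sigma>] by linarith
      then show ?thesis by (rule big)
    next
      case False
      \<comment> \<open>The central moment of order 2 k, that is (2 k)! \<sigma>^(2 k) / (2^k k!);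
        below, its denominator is bounded from below by 1.\<close>
      let ?c = "fact (2 * k) / ((2 / \<sigma>\<^sup>2)^k * fact k) :: real"
      have "prob {\<omega> \<in> space M. D \<omega> \<in> {x. r \<le> \<bar>x\<bar>}} \<le> ?c * (2 / r) ^ (2 * k)"
      proof (rule prob_normal_le[OF 1(2)])
        show "has_bochner_integral lborel (\<lambda>x. normal_density \<mu> \<sigma> x * (x - \<mu>) ^ (2 * k) * (2 / r) ^ (2 * k))
            (?c * (2 / r) ^ (2 * k))"
          by (intro has_bochner_integral_mult_left normal_moment_even 1)
        fix x assume "x \<in> {x. r \<le> \<bar>x\<bar>}"
        then have "1 \<le> \<bar>(x - \<mu>) * (2 / r)\<bar>" using False r by (auto simp: abs_mult field_simps)
        then have "1 \<le> \<bar>(x - \<mu>) * (2 / r)\<bar> ^ (2 * k)" by (rule one_le_power)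
        then have "1 \<le> (x - \<mu>) ^ (2 * k) * (2 / r) ^ (2 * k)"
          by (simp only: power_even_abs[OF dvd_triv_left] power_mult_distrib)
        from mult_left_mono[OF this normal_density_nonneg]
        show "normal_density \<mu> \<sigma> x \<le> normal_density \<mu> \<sigma> x * (x - \<mu>) ^ (2 * k) * (2 / r) ^ (2 * k)"
          by (simp add: mult.assoc)
      qed (auto simp: power_mult)
      then have "?P \<le> ?c * (2 / r) ^ (2 * k)" by simp
      also have "?c \<le> fact (2 * k) * (\<sigma>\<^sup>2) ^ k"
      proof -
        have "(1::real) \<le> 2 ^ k * fact k"
          using mult_mono[of 1 "2 ^ k::real" 1 "fact k"] by simp
        then have "fact (2 * k) * (\<sigma>\<^sup>2) ^ k * 1 \<le> fact (2 * k) * (\<sigma>\<^sup>2) ^ k * (2 ^ k * fact k)"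
          by (intro mult_left_mono) auto
        then show ?thesis using 1 by (simp add: field_simps power_divide)
      qed
      also have "fact (2 * k) * (\<sigma>\<^sup>2) ^ k \<le> fact (2 * k) * ?q ^ k"
        unfolding q by (intro mult_left_mono power_mono) auto
      finally have "?P \<le> fact (2 * k) * ?q ^ k * (2 / r) ^ (2 * k)"
        using r by (simp add: mult_right_mono)
      also have "\<dots> = 4 ^ k * fact (2 * k) * (?q / r\<^sup>2) ^ k"
        by (simp add: power_mult power_divide)
      finally show ?thesis .
    qed
  qed
qed

text \<open>The bound involves \<mu>^2 + \<sigma>^2, so a large mean has to help as much as a large
  variance. If |\<mu>| \<le> \<sigma>, the maximum of the density is enough. If \<sigma> < |\<mu>|
  and r < |\<mu>| / 2, the interval [-r, r] is at distance at least |\<mu>| / 2 from the mean, where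
  Gaussian decay bounds the density by 1 / |\<mu>|; for larger r the claim is trivial.\<close>

lemma gaussian_small_ball:
  assumes G: "gaussian_rv M D" and r: "0 \<le> r" and q0: "0 < expectation (\<lambda>\<omega>. \<bar>D \<omega>\<bar>\<^sup>2)"
  shows "prob {\<omega> \<in> space M. \<bar>D \<omega>\<bar> \<le> r} \<le> 4 * r / sqrt (expectation (\<lambda>\<omega>. \<bar>D \<omega>\<bar>\<^sup>2))"
    (is "?P \<le> 4 * r / sqrt ?q")
proof -
  have [measurable]: "D \<in> borel_measurable M" using G by (auto simp: gaussian_rv_def)
  consider \<mu> \<sigma> where "0 < \<sigma>" "distributed M lborel D (normal_density \<mu> \<sigma>)"
    | \<mu> where "AE \<omega> in M. D \<omega> = \<mu>"
    using G by (auto simp: gaussian_rv_def)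
  then show ?thesis
  proof cases
    case 2
    have q: "?q = \<mu>\<^sup>2"
    proof -
      have "?q = expectation (\<lambda>\<omega>. \<bar>\<mu>\<bar>\<^sup>2)" using 2 by (intro integral_cong_AE) auto
      then show ?thesis by (simp add: prob_space)
    qed
    show ?thesis
    proof (cases "\<bar>\<mu>\<bar> \<le> r")
      case True
      have "?P \<le> 1" by (rule prob_le_1)
      also have "1 \<le> 4 * r / sqrt ?q" using True q q0 by (simp add: field_simps)
      finally show ?thesis .
    next
      case False
      have "AE \<omega> in M. \<not> \<bar>D \<omega>\<bar> \<le> r" using 2 False by auto
      then have "?P = 0" by (subst prob_eq_0) auto
      then show ?thesis using r q0 by simp
    qed
  next
    case 1
    note \<sigma> = 1(1)
    have q: "?q = \<mu>\<^sup>2 + \<sigma>\<^sup>2" using normal_second_moment[OF 1(2,1)] by simp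
    have "prob {\<omega> \<in> space M. D \<omega> \<in> {x. \<bar>x\<bar> \<le> r}} \<le> 2 * r * K"
      if "\<And>x. \<bar>x\<bar> \<le> r \<Longrightarrow> normal_density \<mu> \<sigma> x \<le> K" "0 \<le> K" for K
    proof (rule prob_normal_le[OF 1(2)])
      have "has_bochner_integral lborel (\<lambda>x. indicator {-r..r} x * K) (2 * r * K)"
        using r by (intro has_bochner_integral_mult_left) (auto simp: has_bochner_integral_iff)
      then show "has_bochner_integral lborel (\<lambda>x. indicator {-r..r} x * K) (2 * r * K)" .
    qed (use that in \<open>auto simp: indicator_def abs_le_iff\<close>)
    then have bd: "?P \<le> 2 * r * K" if "\<And>x. \<bar>x\<bar> \<le> r \<Longrightarrow> normal_density \<mu> \<sigma> x \<le> K" "0 \<le> K" for K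
      using that by simp
    \<comment> \<open>Replaces sqrt (2 pi) by 2, so that all constants stay rational.\<close>
    have s2: "2 * \<sigma> \<le> sqrt (2 * pi * \<sigma>\<^sup>2)"
      using \<sigma> pi_gt3 by (intro real_le_rsqrt) (auto simp: power2_eq_square)
    have dens: "normal_density \<mu> \<sigma> x \<le> exp (- (x - \<mu>)\<^sup>2 / (2 * \<sigma>\<^sup>2)) / (2 * \<sigma>)" for x
      unfolding normal_density_def using s2 \<sigma> by (simp add: frac_le)
    show ?thesis
    proof (cases "\<bar>\<mu>\<bar> \<le> \<sigma>")
      case True
      then have "\<mu>\<^sup>2 \<le> \<sigma>\<^sup>2" using \<sigma> by (simp add: abs_le_square_iff[symmetric])
      then have "?q \<le> (2 * \<sigma>)\<^sup>2" unfolding q power_mult_distrib power2_eq_square[of 2] using zero_le_power2[of \<sigma>] by linarith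
      then have "sqrt ?q \<le> 2 * \<sigma>" using \<sigma> by (intro real_le_lsqrt) auto
      have "?P \<le> 2 * r * (1 / (2 * \<sigma>))"
      proof (rule bd)
        fix x
        have "exp (- (x - \<mu>)\<^sup>2 / (2 * \<sigma>\<^sup>2)) / (2 * \<sigma>) \<le> 1 / (2 * \<sigma>)"
          using \<sigma> by (intro divide_right_mono) auto
        with dens[of x] show "normal_density \<mu> \<sigma> x \<le> 1 / (2 * \<sigma>)" by linarith
      qed (use \<sigma> in auto)
      also have "\<dots> = 4 * r / (4 * \<sigma>)" by simp
      also have "\<dots> \<le> 4 * r / sqrt ?q"
        using \<open>sqrt ?q \<le> 2 * \<sigma>\<close> q0 r \<sigma> by (intro divide_left_mono) auto
      finally show ?thesis .
    next
      case False
      then have \<mu>: "0 < \<bar>\<mu>\<bar>" using \<sigma> by linarith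
      have "\<sigma>\<^sup>2 \<le> \<mu>\<^sup>2" using False \<sigma> by (simp add: abs_le_square_iff[symmetric])
      then have "\<mu>\<^sup>2 + \<sigma>\<^sup>2 \<le> (2 * \<bar>\<mu>\<bar>)\<^sup>2"
        unfolding power_mult_distrib[of 2] power2_abs power2_eq_square[of 2] using zero_le_power2[of \<mu>] by linarith
      then have "?q \<le> (2 * \<bar>\<mu>\<bar>)\<^sup>2" by (simp only: q)
      then have sq: "sqrt ?q \<le> 2 * \<bar>\<mu>\<bar>" by (intro real_le_lsqrt) auto
      have "?P \<le> 2 * r / \<bar>\<mu>\<bar>"
      proof (cases "\<bar>\<mu>\<bar> / 2 \<le> r")
        case True
        have "?P \<le> 1" by (rule prob_le_1)
        also have "1 \<le> 2 * r / \<bar>\<mu>\<bar>" using True \<mu> by (simp add: field_simps)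
        finally show ?thesis .
      next
        case r2: False
        have "?P \<le> 2 * r * (1 / \<bar>\<mu>\<bar>)"
        proof (rule bd)
          fix x assume x: "\<bar>x\<bar> \<le> r"
          define u where "u = \<bar>\<mu>\<bar> / \<sigma>"
          have u: "0 < u" using \<mu> \<sigma> by (simp add: u_def)
          have "(\<mu> / 2)\<^sup>2 \<le> (x - \<mu>)\<^sup>2"
          proof (subst abs_le_square_iff[symmetric])
            show "\<bar>\<mu> / 2\<bar> \<le> \<bar>x - \<mu>\<bar>" using x r2 by arith
          qed
          then have "u\<^sup>2 / 8 \<le> (x - \<mu>)\<^sup>2 / (2 * \<sigma>\<^sup>2)"
            using \<sigma> by (simp add: u_def power_divide field_simps)
          then have "exp (- (x - \<mu>)\<^sup>2 / (2 * \<sigma>\<^sup>2)) \<le> exp (- (u\<^sup>2 / 8))" by simp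
          also have "\<dots> \<le> 2 / u"
          proof -
            \<comment> \<open>Gives u / 2 \<le> 1 + u^2 / 8 \<le> exp (u^2 / 8), a polynomial
              substitute for the Gaussian decay that suffices to trade \<sigma> for |\<mu>|.\<close>
            have "0 \<le> (u - 2)\<^sup>2" by simp
            then have "u / 2 \<le> 1 + u\<^sup>2 / 8" by (simp add: power2_eq_square algebra_simps)
            also have "\<dots> \<le> exp (u\<^sup>2 / 8)" by (rule exp_ge_add_one_self)
            finally show ?thesis using u by (simp add: exp_minus field_simps)
          qed
          finally have "exp (- (x - \<mu>)\<^sup>2 / (2 * \<sigma>\<^sup>2)) / (2 * \<sigma>) \<le> 2 / u / (2 * \<sigma>)"
            using \<sigma> by (intro divide_right_mono) auto
          also have "\<dots> = 1 / \<bar>\<mu>\<bar>" using \<sigma> by (simp add: u_def)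
          finally show "normal_density \<mu> \<sigma> x \<le> 1 / \<bar>\<mu>\<bar>" using dens[of x] by linarith
        qed auto
        then show ?thesis by simp
      qed
      also have "\<dots> = 4 * r / (2 * \<bar>\<mu>\<bar>)" by simp
      also have "\<dots> \<le> 4 * r / sqrt ?q"
        using sq q0 r \<mu> by (intro divide_left_mono) auto
      finally show ?thesis .
    qed
  qed
qed

end

section \<open>Increments of a vector-valued Gaussian field\<close>

lemma gaussian_processD:
  "gaussian_process M T Y \<Longrightarrow> finite F \<Longrightarrow> F \<subseteq> T \<Longrightarrow> gaussian_rv M (\<lambda>\<omega>. \<Sum>t\<in>F. c t * Y t \<omega>)"
  by (simp add: gaussian_process_def)

lemma gaussian_process_increment:
  assumes Y: "gaussian_process M T Y" and st: "s \<in> T" "t \<in> T"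
  shows "gaussian_rv M (\<lambda>\<omega>. Y t \<omega> - Y s \<omega>)"
proof (cases "s = t")
  \<comment> \<open>For s = t the set \<open>{s, t}\<close> is a singleton and cannot carry two
    coefficients, so the zero increment is taken as the empty combination.\<close>
  case True
  then show ?thesis using gaussian_processD[OF Y, of "{}"] by simp
next
  case False
  then show ?thesis
    using gaussian_processD[OF Y, of "{s, t}" "\<lambda>u. if u = t then 1 else - 1"] st by simp
qed

lemma gaussian_process_measurable:
  assumes Y: "gaussian_process M T Y" and t: "t \<in> T"
  shows "Y t \<in> borel_measurable M"
  using gaussian_processD[OF Y, of "{t}" "\<lambda>_. 1"] t by (simp add: gaussian_rv_def)

lemma gaussian_fieldD:
  assumes "gaussian_field M X"
  shows "gaussian_process M orthant (coord_process X i)"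
    and "prob_space.indep_vars M (\<lambda>i. PiM orthant (\<lambda>t. borel))
       (\<lambda>i \<omega>. \<lambda>t\<in>orthant. coord_process X i t \<omega>) UNIV"
    and "distr M (PiM orthant (\<lambda>t. borel)) (\<lambda>\<omega>. \<lambda>t\<in>orthant. coord_process X i t \<omega>)
          = distr M (PiM orthant (\<lambda>t. borel)) (\<lambda>\<omega>. \<lambda>t\<in>orthant. coord_process X j t \<omega>)"
proof -
  note F = assms[unfolded gaussian_field_def]
  show "gaussian_process M orthant (coord_process X i)"
    by (rule F[THEN conjunct1, THEN spec])
  show "prob_space.indep_vars M (\<lambda>i. PiM orthant (\<lambda>t. borel))
       (\<lambda>i \<omega>. \<lambda>t\<in>orthant. coord_process X i t \<omega>) UNIV"
    by (rule F[THEN conjunct2, THEN conjunct1])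
  show "distr M (PiM orthant (\<lambda>t. borel)) (\<lambda>\<omega>. \<lambda>t\<in>orthant. coord_process X i t \<omega>)
          = distr M (PiM orthant (\<lambda>t. borel)) (\<lambda>\<omega>. \<lambda>t\<in>orthant. coord_process X j t \<omega>)"
    by (rule F[THEN conjunct2, THEN conjunct2, THEN spec, THEN spec])
qed

lemma gaussian_field_coord_measurable:
  "gaussian_field M X \<Longrightarrow> t \<in> orthant \<Longrightarrow> coord_process X i t \<in> borel_measurable M"
  by (intro gaussian_process_measurable[OF gaussian_fieldD(1)])

lemma gaussian_field_increment:
  "gaussian_field M X \<Longrightarrow> s \<in> orthant \<Longrightarrow> t \<in> orthant \<Longrightarrow>
    gaussian_rv M (\<lambda>\<omega>. coord_process X i t \<omega> - coord_process X i s \<omega>)"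
  by (intro gaussian_process_increment[OF gaussian_fieldD(1)])

lemma gaussian_field_measurable:
  fixes X :: "real ^ 'n \<Rightarrow> 'w \<Rightarrow> real ^ 'd"
  assumes "gaussian_field M X" "t \<in> orthant"
  shows "X t \<in> borel_measurable M"
proof (subst borel_measurable_euclidean_space, intro ballI)
  fix b :: "real ^ 'd" assume "b \<in> Basis"
  then obtain j where "b = axis j 1" by (auto simp: Basis_vec_def)
  then show "(\<lambda>\<omega>. X t \<omega> \<bullet> b) \<in> borel_measurable M"
    using gaussian_field_coord_measurable[OF assms, of j]
    by (simp add: coord_process_def inner_axis)
qed

text \<open>The square of the canonical pseudometric of the process, and the numerator of
  \<open>increment_ratio\<close>.\<close>

definition sq_increment :: "'w measure \<Rightarrow> ('t \<Rightarrow> 'w \<Rightarrow> real) \<Rightarrow> 't \<Rightarrow> 't \<Rightarrow> real" where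
  "sq_increment M Y s t = (\<integral>\<omega>. \<bar>Y t \<omega> - Y s \<omega>\<bar>\<^sup>2 \<partial>M)"

lemma sq_increment_nonneg: "0 \<le> sq_increment M Y s t"
  unfolding sq_increment_def by simp

text \<open>The quantity is the integral of the path functional |x t - x s|^2 against the law of a
  coordinate process, and these laws agree. The exponents of one coordinate thereby control the
  whole vector.\<close>

lemma gaussian_field_sq_increment_eq:
  assumes F: "gaussian_field M X" and st: "s \<in> orthant" "t \<in> orthant"
  shows "sq_increment M (coord_process X i) s t = sq_increment M (coord_process X j) s t"
proof -
  let ?N = "PiM orthant (\<lambda>t. borel :: real measure)"
  let ?R = "\<lambda>i \<omega>. \<lambda>t\<in>orthant. coord_process X i t \<omega>"
  have m: "?R i \<in> measurable M ?N" for i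
    by (intro measurable_restrict gaussian_field_coord_measurable[OF F])
  have [measurable]: "(\<lambda>x. x t) \<in> borel_measurable ?N" "(\<lambda>x. x s) \<in> borel_measurable ?N"
    using st by (auto intro: measurable_component_singleton)
  have *: "sq_increment M (coord_process X i) s t = (\<integral>x. \<bar>x t - x s\<bar>\<^sup>2 \<partial>distr M ?N (?R i))" for i
    by (subst integral_distr[OF m]) (use st in \<open>auto simp: sq_increment_def\<close>)
  have "distr M ?N (?R i) = distr M ?N (?R j)" by (rule gaussian_fieldD(3)[OF F])
  then show ?thesis by (simp only: *)
qed

text \<open>If the vector moves by r, some coordinate moves by at least r / d. The union bound
  contributes the factor d, and the rescaling of r the factor d^(2 k).\<close>

lemma gaussian_field_tail:
  fixes X :: "real ^ 'n \<Rightarrow> 'w \<Rightarrow> real ^ 'd"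
  assumes M: "prob_space M" and F: "gaussian_field M X" and st: "s \<in> orthant" "t \<in> orthant" and r: "0 < r"
  shows "measure M {\<omega> \<in> space M. r \<le> dist (X t \<omega>) (X s \<omega>)}
    \<le> real CARD('d) * (4 ^ k * fact (2 * k) * (real CARD('d))\<^sup>2 ^ k) * (sq_increment M (coord_process X i) s t / r\<^sup>2) ^ k"
proof -
  interpret prob_space M by fact
  let ?d = "real CARD('d)"
  have d: "0 < ?d" by simp
  have [measurable]: "X s \<in> borel_measurable M" "X t \<in> borel_measurable M"
    using gaussian_field_measurable[OF F] st by auto
  define A where "A j = {\<omega> \<in> space M. r / ?d \<le> \<bar>coord_process X j t \<omega> - coord_process X j s \<omega>\<bar>}" for j
  have [measurable]: "coord_process X j t \<in> borel_measurable M" "coord_process X j s \<in> borel_measurable M" for j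
    using st by (auto intro: gaussian_field_coord_measurable[OF F])
  have A [measurable]: "A j \<in> sets M" for j unfolding A_def by measurable
  have "prob {\<omega> \<in> space M. r \<le> dist (X t \<omega>) (X s \<omega>)} \<le> prob (\<Union>j\<in>UNIV. A j)"
  proof (rule finite_measure_mono)
    show "{\<omega> \<in> space M. r \<le> dist (X t \<omega>) (X s \<omega>)} \<subseteq> (\<Union>j\<in>UNIV. A j)"
    proof
      fix \<omega> assume "\<omega> \<in> {\<omega> \<in> space M. r \<le> dist (X t \<omega>) (X s \<omega>)}"
      then have \<omega>: "\<omega> \<in> space M" "r \<le> norm (X t \<omega> - X s \<omega>)" by (auto simp: dist_norm)
      show "\<omega> \<in> (\<Union>j\<in>UNIV. A j)"
      proof (rule ccontr)
        assume "\<not> ?thesis"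
        then have "\<bar>(X t \<omega> - X s \<omega>) $ j\<bar> < r / ?d" for j
          using \<omega> by (auto simp: A_def coord_process_def not_le)
        then have "(\<Sum>j\<in>UNIV. \<bar>(X t \<omega> - X s \<omega>) $ j\<bar>) < (\<Sum>j\<in>(UNIV::'d set). r / ?d)"
          by (intro sum_strict_mono) auto
        also have "\<dots> = r" by simp
        finally show False using \<omega>(2) norm_le_l1_cart[of "X t \<omega> - X s \<omega>"] by linarith
      qed
    qed
  qed auto
  also have "\<dots> \<le> (\<Sum>j\<in>UNIV. prob (A j))"
    by (rule finite_measure_subadditive_finite) auto
  also have "\<dots> \<le> (\<Sum>j\<in>(UNIV::'d set). 4 ^ k * fact (2 * k) * (sq_increment M (coord_process X i) s t / (r / ?d)\<^sup>2) ^ k)"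
  proof (rule sum_mono)
    fix j
    have "gaussian_rv M (\<lambda>\<omega>. coord_process X j t \<omega> - coord_process X j s \<omega>)"
      by (rule gaussian_field_increment[OF F st])
    from gaussian_tail[OF this, of "r / ?d" k] r
    have "prob (A j) \<le> 4 ^ k * fact (2 * k) * (sq_increment M (coord_process X j) s t / (r / ?d)\<^sup>2) ^ k"
      by (simp add: A_def sq_increment_def)
    then show "prob (A j) \<le> 4 ^ k * fact (2 * k) * (sq_increment M (coord_process X i) s t / (r / ?d)\<^sup>2) ^ k"
      using gaussian_field_sq_increment_eq[OF F st, of j i] by simp
  qed
  also have "\<dots> = ?d * (4 ^ k * fact (2 * k) * ?d\<^sup>2 ^ k) * (sq_increment M (coord_process X i) s t / r\<^sup>2) ^ k"
    by (simp add: power_divide power_mult_distrib)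
  finally show ?thesis .
qed

text \<open>A small vector has every coordinate in [-r, r]. Independence of the coordinate paths
  passes to their increments, and the one-dimensional bound is raised to the power d; this is how
  the dimension of the target enters the lower bounds.\<close>

lemma gaussian_field_small_ball:
  fixes X :: "real ^ 'n \<Rightarrow> 'w \<Rightarrow> real ^ 'd"
  assumes M: "prob_space M" and F: "gaussian_field M X" and st: "s \<in> orthant" "t \<in> orthant" and r: "0 \<le> r"
    and q: "0 < sq_increment M (coord_process X i) s t"
  shows "measure M {\<omega> \<in> space M. dist (X t \<omega>) (X s \<omega>) \<le> r}
    \<le> (4 * r / sqrt (sq_increment M (coord_process X i) s t)) ^ CARD('d)"
proof -
  interpret prob_space M by fact
  have [measurable]: "X s \<in> borel_measurable M" "X t \<in> borel_measurable M"
    using gaussian_field_measurable[OF F] st by auto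
  let ?N = "PiM orthant (\<lambda>t. borel :: real measure)"
  let ?D = "\<lambda>j \<omega>. coord_process X j t \<omega> - coord_process X j s \<omega>"
  have [measurable]: "coord_process X j t \<in> borel_measurable M" "coord_process X j s \<in> borel_measurable M" for j
    using st by (auto intro: gaussian_field_coord_measurable[OF F])
  have comp [measurable]: "(\<lambda>x. x t) \<in> borel_measurable ?N" "(\<lambda>x. x s) \<in> borel_measurable ?N"
    using st by (auto intro: measurable_component_singleton)
  have "indep_vars (\<lambda>j::'d. borel) (\<lambda>j \<omega>. (\<lambda>x. x t - x s) (\<lambda>t\<in>orthant. coord_process X j t \<omega>)) UNIV"
    by (intro indep_vars_compose2[OF gaussian_fieldD(2)[OF F]]) auto
  then have ind: "indep_vars (\<lambda>j. borel) ?D UNIV" using st by simp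
  have "prob {\<omega> \<in> space M. dist (X t \<omega>) (X s \<omega>) \<le> r} \<le> prob (\<Inter>j\<in>UNIV. ?D j -` {-r..r} \<inter> space M)"
  proof (rule finite_measure_mono)
    show "{\<omega> \<in> space M. dist (X t \<omega>) (X s \<omega>) \<le> r} \<subseteq> (\<Inter>j\<in>UNIV. ?D j -` {-r..r} \<inter> space M)"
    proof clarsimp
      fix j \<omega> assume "dist (X t \<omega>) (X s \<omega>) \<le> r"
      then have "\<bar>(X t \<omega> - X s \<omega>) $ j\<bar> \<le> r"
        using component_le_norm_cart[of "X t \<omega> - X s \<omega>" j] by (simp add: dist_norm)
      then show "- r \<le> coord_process X j t \<omega> - coord_process X j s \<omega> \<and>
          coord_process X j t \<omega> - coord_process X j s \<omega> \<le> r"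
        by (simp add: coord_process_def abs_le_iff)
    qed
  qed auto
  also have "\<dots> = (\<Prod>j\<in>UNIV. prob (?D j -` {-r..r} \<inter> space M))"
    by (rule indep_varsD_finite[OF ind]) auto
  also have "\<dots> \<le> (\<Prod>j\<in>(UNIV::'d set). 4 * r / sqrt (sq_increment M (coord_process X i) s t))"
  proof (intro prod_mono conjI)
    fix j
    have eq: "sq_increment M (coord_process X i) s t = sq_increment M (coord_process X j) s t"
      by (rule gaussian_field_sq_increment_eq[OF F st])
    have "gaussian_rv M (?D j)"
      by (rule gaussian_field_increment[OF F st])
    from gaussian_small_ball[OF this r] q
    have "prob {\<omega> \<in> space M. \<bar>?D j \<omega>\<bar> \<le> r} \<le> 4 * r / sqrt (sq_increment M (coord_process X i) s t)"
      unfolding eq by (simp add: sq_increment_def)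
    also have "{\<omega> \<in> space M. \<bar>?D j \<omega>\<bar> \<le> r} = ?D j -` {-r..r} \<inter> space M"
      by (auto simp: abs_le_iff)
    finally show "prob (?D j -` {-r..r} \<inter> space M) \<le> 4 * r / sqrt (sq_increment M (coord_process X i) s t)" .
  qed auto
  also have "\<dots> = (4 * r / sqrt (sq_increment M (coord_process X i) s t)) ^ CARD('d)" by simp
  finally show ?thesis .
qed

section \<open>Energy of random paths\<close>

text \<open>Cut at the scales \<tau> 2^(-k). On the layer just below \<tau> 2^(-k) the integrand is
  at most \<tau>^(-\<gamma>) 2^(\<gamma> (k + 1)), while the mass there is at most K 2^(-p k); the
  sum is geometric with ratio 2^(\<gamma> - p). It is applied once to probability and once to
  Lebesgue measure.\<close>

lemma nn_integral_inverse_powr_le: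
  fixes g :: "'a \<Rightarrow> real"
  assumes g [measurable]: "g \<in> borel_measurable \<mu>" and g0: "\<And>x. x \<in> space \<mu> \<Longrightarrow> 0 \<le> g x"
    and \<tau>: "0 < \<tau>" and \<gamma>: "0 < \<gamma>" "\<gamma> < p" and K: "0 \<le> K"
    and total: "emeasure \<mu> (space \<mu>) \<le> ennreal K"
    and small: "\<And>r. 0 < r \<Longrightarrow> emeasure \<mu> {x \<in> space \<mu>. g x \<le> r} \<le> ennreal (K * (r / \<tau>) powr p)"
  shows "(\<integral>\<^sup>+x. inverse (ennreal (g x powr \<gamma>)) \<partial>\<mu>)
    \<le> ennreal (K * (1 + 2 powr \<gamma> / (1 - 2 powr (\<gamma> - p))) * \<tau> powr (- \<gamma>))"
proof -
  define A where "A k = {x \<in> space \<mu>. g x \<le> \<tau> * 2 powr (- real k)}" for k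
  define w where "w k = ennreal (2 powr (\<gamma> * (real k + 1)))" for k
  have [measurable]: "A k \<in> sets \<mu>" for k unfolding A_def by measurable
  have pw: "inverse (ennreal (g x powr \<gamma>)) \<le> ennreal (\<tau> powr (- \<gamma>)) * (1 + (\<Sum>k. w k * indicator (A k) x))"
    (is "_ \<le> ?R") if x: "x \<in> space \<mu>" for x
  proof -
    have R: "ennreal (\<tau> powr (- \<gamma>)) * w k \<le> ?R" if "x \<in> A k" for k
    proof -
      have "w k = (\<Sum>j\<in>{k}. w j * indicator (A j) x)" using that by simp
      also have "\<dots> \<le> (\<Sum>k. w k * indicator (A k) x)" by (rule sum_le_suminf) auto
      also have "\<dots> \<le> 1 + (\<Sum>k. w k * indicator (A k) x)" by (simp add: add_increasing)
      finally show ?thesis by (rule mult_left_mono) simp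
    qed
    consider "\<tau> < g x" | "0 < g x" "g x \<le> \<tau>" | "g x = 0" using g0[OF x] by force
    then show ?thesis
    proof cases
      case 1
      have "inverse (ennreal (g x powr \<gamma>)) \<le> inverse (ennreal (\<tau> powr \<gamma>))"
        using 1 \<tau> \<gamma> by (intro inverse_ennreal_antimono ennreal_leI powr_mono2) auto
      also have "\<dots> = ennreal (\<tau> powr (- \<gamma>)) * 1" using \<tau> by (simp add: inverse_ennreal powr_minus)
      also have "\<dots> \<le> ?R" by (intro mult_left_mono add_increasing2) auto
      finally show ?thesis .
    next
      case 2
      \<comment> \<open>The layer with \<tau> 2^(-(k + 1)) < g x \<le> \<tau> 2^(-k).\<close>
      define k where "k = nat \<lfloor>log 2 (\<tau> / g x)\<rfloor>"
      have "0 \<le> log 2 (\<tau> / g x)" using 2 by (simp add: zero_le_log_cancel_iff)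
      then have k: "real k \<le> log 2 (\<tau> / g x)" "log 2 (\<tau> / g x) < real k + 1"
        unfolding k_def by linarith+
      have l: "2 powr log 2 (\<tau> / g x) = \<tau> / g x" using 2 \<tau> by simp
      have k1: "2 powr real k \<le> \<tau> / g x" using powr_mono[OF k(1), of 2] by (simp only: l)
      have k2: "\<tau> / g x < 2 powr (real k + 1)" using powr_less_mono[OF k(2), of 2] by (simp only: l)
      have "x \<in> A k" using k1 2 x by (simp add: A_def powr_minus field_simps)
      have "inverse (ennreal (g x powr \<gamma>)) = ennreal (g x powr (- \<gamma>))"
        using 2 by (simp add: inverse_ennreal powr_minus)
      also have "\<dots> \<le> ennreal (\<tau> powr (- \<gamma>) * 2 powr (\<gamma> * (real k + 1)))"
      proof (rule ennreal_leI)
        have "(\<tau> / g x) powr \<gamma> \<le> (2 powr (real k + 1)) powr \<gamma>"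
          using k2 2 \<tau> \<gamma> by (intro powr_mono2) auto
        then show "g x powr (- \<gamma>) \<le> \<tau> powr (- \<gamma>) * 2 powr (\<gamma> * (real k + 1))"
          using 2 \<tau> by (simp add: powr_powr powr_divide powr_minus field_simps)
      qed
      also have "\<dots> = ennreal (\<tau> powr (- \<gamma>)) * w k" by (simp add: w_def ennreal_mult)
      also have "\<dots> \<le> ?R" by (rule R) fact
      finally show ?thesis .
    next
      \<comment> \<open>The left-hand side is infinite here; \<open>x\<close> lies in every
        \<open>A k\<close>, and the unbounded weights make the right-hand side infinite too.\<close>
      case 3
      have "?R = \<infinity>"
      proof (rule ccontr)
        assume "?R \<noteq> \<infinity>"
        then obtain z where z: "?R = ennreal z" "0 \<le> z" by (cases ?R) auto
        have le: "\<tau> powr (- \<gamma>) * 2 powr (\<gamma> * (real k + 1)) \<le> z" for k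
        proof -
          have "x \<in> A k" using 3 x \<tau> by (simp add: A_def)
          from R[OF this] show ?thesis unfolding z(1) using z(2)
            by (simp add: w_def flip: ennreal_mult)
        qed
        have "filterlim (\<lambda>k::nat. \<tau> powr (- \<gamma>) * 2 powr (\<gamma> * (real k + 1))) at_top sequentially"
          using \<gamma> \<tau> by real_asymp
        then obtain k :: nat where "z < \<tau> powr (- \<gamma>) * 2 powr (\<gamma> * (real k + 1))"
          unfolding filterlim_at_top_dense using eventually_happens'[OF sequentially_bot] by blast
        with le[of k] show False by simp
      qed
      then show ?thesis by simp
    qed
  qed
  define q where "q = 2 powr (\<gamma> - p)"
  have q: "0 < q" "q < 1" using \<gamma> powr_less_mono[of "\<gamma> - p" 0 2] by (auto simp: q_def)
  have "(\<integral>\<^sup>+x. inverse (ennreal (g x powr \<gamma>)) \<partial>\<mu>)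
      \<le> (\<integral>\<^sup>+x. ennreal (\<tau> powr (- \<gamma>)) * (1 + (\<Sum>k. w k * indicator (A k) x)) \<partial>\<mu>)"
    by (intro nn_integral_mono pw)
  also have "\<dots> = ennreal (\<tau> powr (- \<gamma>)) * (emeasure \<mu> (space \<mu>) + (\<Sum>k. w k * emeasure \<mu> (A k)))"
    by (simp add: nn_integral_cmult nn_integral_add nn_integral_suminf nn_integral_cmult_indicator)
  also have "\<dots> \<le> ennreal (\<tau> powr (- \<gamma>)) * (ennreal K + (\<Sum>k. ennreal (K * 2 powr \<gamma> * q ^ k)))"
  proof (intro mult_left_mono add_mono total suminf_le)
    fix k
    have "emeasure \<mu> (A k) \<le> ennreal (K * (\<tau> * 2 powr (- real k) / \<tau>) powr p)"
      unfolding A_def using \<tau> by (intro small) auto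
    also have "(\<tau> * 2 powr (- real k) / \<tau>) powr p = 2 powr (- (p * real k))"
      using \<tau> by (simp add: powr_powr mult.commute)
    finally have "w k * emeasure \<mu> (A k) \<le> w k * ennreal (K * 2 powr (- (p * real k)))"
      by (intro mult_left_mono) auto
    also have "\<dots> = ennreal (K * (2 powr (\<gamma> * (real k + 1)) * 2 powr (- (p * real k))))"
      using K by (simp add: w_def mult_ac flip: ennreal_mult)
    also have "2 powr (\<gamma> * (real k + 1)) * 2 powr (- (p * real k)) = 2 powr \<gamma> * q ^ k"
    proof -
      have "q ^ k = 2 powr ((\<gamma> - p) * real k)" by (simp add: q_def powr_power mult.commute)
      then show ?thesis by (simp add: algebra_simps flip: powr_add)
    qed
    finally show "w k * emeasure \<mu> (A k) \<le> ennreal (K * 2 powr \<gamma> * q ^ k)" by (simp add: mult.assoc)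
  qed auto
  also have "(\<Sum>k. ennreal (K * 2 powr \<gamma> * q ^ k)) = ennreal (K * 2 powr \<gamma> * (1 / (1 - q)))"
    using q K by (subst suminf_ennreal2) (auto simp: suminf_mult suminf_geometric intro!: summable_mult summable_geometric)
  also have "ennreal (\<tau> powr (- \<gamma>)) * (ennreal K + ennreal (K * 2 powr \<gamma> * (1 / (1 - q))))
      = ennreal (K * (1 + 2 powr \<gamma> / (1 - q)) * \<tau> powr (- \<gamma>))"
    using K q by (simp add: algebra_simps flip: ennreal_mult ennreal_plus)
  finally show ?thesis by (simp add: q_def)
qed

section \<open>Potentials of Lebesgue measure on a cube\<close>

lemma emeasure_lborel_cube:
  fixes a :: "real ^ 'n"
  assumes "0 \<le> L" shows "emeasure lborel (cube a L) = ennreal (L ^ CARD('n))"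
proof -
  have "(a + (\<chi> i. L) - a) \<bullet> b = L" if "b \<in> Basis" for b :: "real ^ 'n"
    using that by (auto simp: Basis_vec_def inner_axis)
  moreover have "a \<bullet> b \<le> (a + (\<chi> i. L)) \<bullet> b" if "b \<in> Basis" for b :: "real ^ 'n"
    using that assms by (auto simp: Basis_vec_def inner_axis)
  ultimately show ?thesis
    unfolding cube_cbox by (subst emeasure_lborel_cbox) (simp_all add: DIM_cart)
qed

lemma cube_borel [measurable]: "cube a L \<in> sets borel"
  by (simp add: cube_cbox)

abbreviation cube_measure :: "real ^ 'n \<Rightarrow> real \<Rightarrow> (real ^ 'n) measure" where
  "cube_measure a L \<equiv> restrict_space lborel (cube a L)"

lemma space_cube_measure: "space (cube_measure a L) = cube a L"
  by (simp add: space_restrict_space)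

lemma emeasure_cube_measure:
  assumes "A \<in> sets (cube_measure a L)"
  shows "emeasure (cube_measure a L) A = emeasure lborel A"
  using assms by (subst emeasure_restrict_space) (auto simp: sets_restrict_space)

lemma finite_cube_measure:
  assumes "0 \<le> L" shows "finite_measure (cube_measure a L)"
  using assms by (intro finite_measureI) (simp add: emeasure_restrict_space emeasure_lborel_cube)

lemma cube_measure_id [measurable]: "(\<lambda>t. t) \<in> measurable (cube_measure a L) borel"
  by (intro measurable_restrict_space1) simp

text \<open>Balls of radius r have volume of order r^N, so the layer estimate applies with p = N.
  The bound is uniform in \<open>s\<close>, so a second integration over the cube stays
  finite.\<close>

lemma nn_integral_cube_inverse_dist:
  fixes a :: "real ^ 'n" and \<theta> :: real
  assumes L: "0 < L" and \<theta>: "0 < \<theta>" "\<theta> < CARD('n)"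
  obtains B where "0 \<le> B"
    "\<And>s. (\<integral>\<^sup>+t. inverse (ennreal (dist s t powr \<theta>)) \<partial>cube_measure a L) \<le> ennreal B"
proof -
  \<comment> \<open>One constant has to dominate both the total mass L^N and the coefficient 2^N in
    the volume of the cube of side 2 r around a ball.\<close>
  define K where "K = max (2 ^ CARD('n)) (L ^ CARD('n))"
  have K: "0 \<le> K" by (simp add: K_def le_max_iff_disj)
  define B where "B = K * (1 + 2 powr \<theta> / (1 - 2 powr (\<theta> - real CARD('n))))"
  have "2 powr (\<theta> - real CARD('n)) < 1" using \<theta> powr_less_mono[of "\<theta> - real CARD('n)" 0 2] by auto
  then have "0 \<le> B" using K by (simp add: B_def)
  moreover have "(\<integral>\<^sup>+t. inverse (ennreal (dist s t powr \<theta>)) \<partial>cube_measure a L) \<le> ennreal B" for s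
  proof -
    have "(\<integral>\<^sup>+t. inverse (ennreal (dist s t powr \<theta>)) \<partial>cube_measure a L)
      \<le> ennreal (K * (1 + 2 powr \<theta> / (1 - 2 powr (\<theta> - real CARD('n)))) * 1 powr (- \<theta>))"
    proof (rule nn_integral_inverse_powr_le)
      show [measurable]: "dist s \<in> borel_measurable (cube_measure a L)" by measurable
      have "emeasure (cube_measure a L) (space (cube_measure a L)) = ennreal (L ^ CARD('n))"
        using L by (subst emeasure_cube_measure) (auto simp: space_cube_measure sets_restrict_space emeasure_lborel_cube)
      also have "\<dots> \<le> ennreal K" by (intro ennreal_leI) (simp add: K_def)
      finally show "emeasure (cube_measure a L) (space (cube_measure a L)) \<le> ennreal K" .
      fix r :: real assume r: "0 < r"
      define b :: "real ^ 'n" where "b = s - (\<chi> i. r)"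
      have m: "{t \<in> space (cube_measure a L). dist s t \<le> r} \<in> sets (cube_measure a L)" by measurable
      have "emeasure (cube_measure a L) {t \<in> space (cube_measure a L). dist s t \<le> r}
          = emeasure lborel {t \<in> space (cube_measure a L). dist s t \<le> r}"
        by (rule emeasure_cube_measure[OF m])
      also have "\<dots> \<le> emeasure lborel (cube b (2 * r))"
      proof (rule emeasure_mono)
        show "{t \<in> space (cube_measure a L). dist s t \<le> r} \<subseteq> cube b (2 * r)"
        proof clarsimp
          fix t assume "dist s t \<le> r"
          then have "\<bar>(s - t) $ i\<bar> \<le> r" for i
            using component_le_norm_cart[of "s - t" i] by (simp add: dist_norm)
          then have "\<bar>s $ i - t $ i\<bar> \<le> r" for i by simp
          then show "t \<in> cube b (2 * r)" by (auto simp: cube_def b_def abs_le_iff algebra_simps)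
        qed
      qed simp
      also have "\<dots> = ennreal ((2 * r) ^ CARD('n))" using r by (intro emeasure_lborel_cube) simp
      also have "\<dots> \<le> ennreal (K * (r / 1) powr real CARD('n))"
      proof (rule ennreal_leI)
        have "(2 * r) ^ CARD('n) = 2 ^ CARD('n) * r powr real CARD('n)"
          using r by (simp add: power_mult_distrib powr_realpow)
        also have "\<dots> \<le> K * (r / 1) powr real CARD('n)"
          by (auto simp: K_def intro!: mult_right_mono)
        finally show "(2 * r) ^ CARD('n) \<le> K * (r / 1) powr real CARD('n)" .
      qed
      finally show "emeasure (cube_measure a L) {t \<in> space (cube_measure a L). dist s t \<le> r}
          \<le> ennreal (K * (r / 1) powr real CARD('n))" .
    qed (use \<theta> K in auto)
    then show ?thesis by (simp add: B_def)
  qed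
  ultimately show thesis by (rule that)
qed

section \<open>Joint measurability and expected energy\<close>

lemma grid_proj_tendsto:
  fixes a :: "real ^ 'n"
  assumes L: "0 < L"
  shows "(\<lambda>n. grid_proj a L n t) \<longlonglongrightarrow> t"
proof (rule metric_tendsto_imp_tendsto)
  have "(\<lambda>n::nat. L * real CARD('n) * (1 / 2) ^ n) \<longlonglongrightarrow> 0"
    by (intro tendsto_mult_right_zero LIMSEQ_realpow_zero) auto
  then show "(\<lambda>n::nat. L * real CARD('n) / 2 ^ n) \<longlonglongrightarrow> 0" by (simp add: power_divide)
  show "\<forall>\<^sub>F n in sequentially. dist (grid_proj a L n t) t \<le> dist (L * real CARD('n) / 2 ^ n) 0"
    using dist_grid_proj[OF L, of t a] L by (intro always_eventually allI) (simp add: dist_commute)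
qed

text \<open>Replacing t by its projection leaves finitely many times, so the approximants are
  jointly measurable, and by continuity they converge at every point. Fubini's theorem for the
  energy depends on this.\<close>

lemma borel_measurable_pair_continuous:
  fixes Z :: "real ^ 'n \<Rightarrow> 'w \<Rightarrow> 'b::{metric_space,second_countable_topology}"
  assumes L: "0 < L" and Z: "\<And>u. u \<in> cube a L \<Longrightarrow> Z u \<in> borel_measurable M"
    and cont: "\<And>\<omega>. \<omega> \<in> space M \<Longrightarrow> continuous_on (cube a L) (\<lambda>t. Z t \<omega>)"
  shows "(\<lambda>(\<omega>, t). Z t \<omega>) \<in> borel_measurable (M \<Otimes>\<^sub>M cube_measure a L)"
proof (rule borel_measurable_LIMSEQ_metric)
  fix x assume x: "x \<in> space (M \<Otimes>\<^sub>M cube_measure a L)"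
  then have *: "fst x \<in> space M" "snd x \<in> cube a L"
    by (auto simp: space_pair_measure space_cube_measure)
  have P: "grid_proj a L n (snd x) \<in> cube a L" for n
    using grid_proj_in_grid[OF L *(2)] grid_subset_cube[of L a n] L by auto
  have "(\<lambda>n. Z (grid_proj a L n (snd x)) (fst x)) \<longlonglongrightarrow> Z (snd x) (fst x)"
    using cont[OF *(1)] *(2) P grid_proj_tendsto[OF L]
    by (intro continuous_on_tendsto_compose[where f = "\<lambda>t. Z t (fst x)"]) (auto intro: always_eventually)
  then show "(\<lambda>n. (\<lambda>x. Z (grid_proj a L n (snd x)) (fst x)) x) \<longlonglongrightarrow> (case x of (\<omega>, t) \<Rightarrow> Z t \<omega>)"
    by (simp add: case_prod_beta)
next
  fix n
  show "(\<lambda>x. Z (grid_proj a L n (snd x)) (fst x)) \<in> borel_measurable (M \<Otimes>\<^sub>M cube_measure a L)"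
  proof (rule measurable_compose_countable'[where I = "grid a L n"])
    fix u assume "u \<in> grid a L n"
    then have [measurable]: "Z u \<in> borel_measurable M"
      using grid_subset_cube[of L a n] L by (auto intro: Z)
    show "(\<lambda>x. Z u (fst x)) \<in> borel_measurable (M \<Otimes>\<^sub>M cube_measure a L)" by measurable
  next
    show "(\<lambda>x. grid_proj a L n (snd x)) \<in> measurable (M \<Otimes>\<^sub>M cube_measure a L) (count_space (grid a L n))"
    proof (subst measurable_count_space_eq2[OF finite_grid], intro conjI ballI)
      show "(\<lambda>x. grid_proj a L n (snd x)) \<in> space (M \<Otimes>\<^sub>M cube_measure a L) \<rightarrow> grid a L n"
        by (auto simp: space_pair_measure space_cube_measure intro!: grid_proj_in_grid[OF L])
      fix u assume "u \<in> grid a L n"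
      have [measurable]: "grid_proj a L n \<in> borel_measurable (cube_measure a L)"
        by (intro measurable_restrict_space1) simp
      show "(\<lambda>x. grid_proj a L n (snd x)) -` {u} \<inter> space (M \<Otimes>\<^sub>M cube_measure a L) \<in> sets (M \<Otimes>\<^sub>M cube_measure a L)"
        by measurable
    qed
  qed (simp add: countable_finite finite_grid)
qed

text \<open>By Fubini and the layer estimate with \<tau> = |s - t|^b, the expected energy is at most
  a constant times the double integral of |s - t|^(-(b \<gamma> + \<eta>)), which is finite since
  the exponent stays below N. Finite expectation gives almost sure finiteness.\<close>

lemma AE_energy_finite:
  fixes Y :: "real ^ 'n \<Rightarrow> 'w \<Rightarrow> 'b::{metric_space,second_countable_topology}"
  assumes M: "prob_space M" and L: "0 < L"
    and Y: "\<And>u. u \<in> cube a L \<Longrightarrow> Y u \<in> borel_measurable M"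
    and cont: "AE \<omega> in M. continuous_on (cube a L) (\<lambda>t. Y t \<omega>)"
    and b: "0 < b" and K: "0 \<le> K"
    and small: "\<And>s t r. s \<in> cube a L \<Longrightarrow> t \<in> cube a L \<Longrightarrow> s \<noteq> t \<Longrightarrow> 0 < r \<Longrightarrow>
      measure M {\<omega> \<in> space M. dist (Y s \<omega>) (Y t \<omega>) \<le> r} \<le> K * (r / dist s t powr b) powr p"
    and \<gamma>: "0 < \<gamma>" "\<gamma> < p" and \<eta>: "0 \<le> \<eta>" and sum: "b * \<gamma> + \<eta> < CARD('n)"
  shows "AE \<omega> in M. (\<integral>\<^sup>+s. \<integral>\<^sup>+t. inverse (ennreal (dist (Y s \<omega>) (Y t \<omega>) powr \<gamma> * dist s t powr \<eta>))
    \<partial>cube_measure a L \<partial>cube_measure a L) < \<infinity>"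
proof -
  interpret prob_space M by fact
  let ?\<nu> = "cube_measure a L"
  interpret \<nu>: finite_measure ?\<nu> using L by (intro finite_cube_measure) simp
  interpret \<nu>2: pair_sigma_finite ?\<nu> ?\<nu> ..
  have sf2: "sigma_finite_measure (?\<nu> \<Otimes>\<^sub>M ?\<nu>)" by (rule \<nu>2.P.sigma_finite_measure_axioms)
  interpret FU: pair_sigma_finite M "?\<nu> \<Otimes>\<^sub>M ?\<nu>"
    by (intro pair_sigma_finite.intro sf2) unfold_locales
  obtain N where N: "{\<omega> \<in> space M. \<not> continuous_on (cube a L) (\<lambda>t. Y t \<omega>)} \<subseteq> N" "emeasure M N = 0" "N \<in> sets M"
    using AE_E[OF cont] by blast
  \<comment> \<open>On the exceptional null set the path is replaced by a constant one, so that
    continuity, and with it joint measurability, holds for every \<omega>.\<close>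
  define Z where "Z t \<omega> = (if \<omega> \<in> N then undefined else Y t \<omega>)" for t \<omega>
  have Z: "Z u \<in> borel_measurable M" if "u \<in> cube a L" for u
  proof -
    have [measurable]: "Y u \<in> borel_measurable M" "N \<in> sets M" using that Y N by auto
    show ?thesis unfolding Z_def by measurable
  qed
  have AEN: "AE \<omega> in M. \<omega> \<notin> N" using N by (intro AE_not_in) auto
  have [measurable]: "(\<lambda>(\<omega>, t). Z t \<omega>) \<in> borel_measurable (M \<Otimes>\<^sub>M ?\<nu>)"
  proof (rule borel_measurable_pair_continuous[OF L Z])
    fix \<omega> assume "\<omega> \<in> space M"
    then show "continuous_on (cube a L) (\<lambda>t. Z t \<omega>)"
      using N(1) by (cases "\<omega> \<in> N") (auto simp: Z_def)
  qed
  have [measurable]: "(\<lambda>x. Z (fst (snd x)) (fst x)) \<in> borel_measurable (M \<Otimes>\<^sub>M (?\<nu> \<Otimes>\<^sub>M ?\<nu>))"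
    by (rule measurable_compose[of "\<lambda>x. (fst x, fst (snd x))" _ "M \<Otimes>\<^sub>M ?\<nu>" "\<lambda>(\<omega>, t). Z t \<omega>", simplified]) measurable
  have [measurable]: "(\<lambda>x. Z (snd (snd x)) (fst x)) \<in> borel_measurable (M \<Otimes>\<^sub>M (?\<nu> \<Otimes>\<^sub>M ?\<nu>))"
    by (rule measurable_compose[of "\<lambda>x. (fst x, snd (snd x))" _ "M \<Otimes>\<^sub>M ?\<nu>" "\<lambda>(\<omega>, t). Z t \<omega>", simplified]) measurable
  have [measurable]: "(\<lambda>x. dist (fst (snd x)) (snd (snd x))) \<in> borel_measurable (M \<Otimes>\<^sub>M (?\<nu> \<Otimes>\<^sub>M ?\<nu>))"
    by (intro borel_measurable_dist measurable_compose[OF _ cube_measure_id]) measurable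
  define h where "h x = inverse (ennreal (dist (Z (fst (snd x)) (fst x)) (Z (snd (snd x)) (fst x)) powr \<gamma>
      * dist (fst (snd x)) (snd (snd x)) powr \<eta>))" for x
  have hm [measurable]: "h \<in> borel_measurable (M \<Otimes>\<^sub>M (?\<nu> \<Otimes>\<^sub>M ?\<nu>))" unfolding h_def by measurable
  define \<theta> where "\<theta> = b * \<gamma> + \<eta>"
  have \<theta>: "0 < \<theta>" "\<theta> < CARD('n)" using b \<gamma> \<eta> sum by (auto simp: \<theta>_def add_pos_nonneg)
  obtain B where B: "0 \<le> B" "\<And>s. (\<integral>\<^sup>+t. inverse (ennreal (dist s t powr \<theta>)) \<partial>?\<nu>) \<le> ennreal B"
    using nn_integral_cube_inverse_dist[OF L \<theta>] by blast
  have q: "2 powr (\<gamma> - p) < 1" using \<gamma> powr_less_mono[of "\<gamma> - p" 0 2] by auto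
  \<comment> \<open>The layer estimate takes one constant for the total mass, here 1, and for the
    small-ball bound, hence \<open>max 1 K\<close>.\<close>
  define C where "C = max 1 K * (1 + 2 powr \<gamma> / (1 - 2 powr (\<gamma> - p)))"
  have C: "0 < C" using q by (auto simp: C_def intro!: mult_pos_pos add_pos_nonneg)
  have E: "(\<integral>\<^sup>+\<omega>. h (\<omega>, s, t) \<partial>M) \<le> ennreal C * inverse (ennreal (dist s t powr \<theta>))"
    if st: "s \<in> cube a L" "t \<in> cube a L" for s t
  proof (cases "s = t")
    case True
    then show ?thesis using C by (simp add: ennreal_mult_top)
  next
    case False
    define \<delta> where "\<delta> = dist s t"
    have \<delta>: "0 < \<delta>" using False by (simp add: \<delta>_def)
    note Z[OF st(1), measurable] Z[OF st(2), measurable]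
    have "(\<integral>\<^sup>+\<omega>. inverse (ennreal (dist (Z s \<omega>) (Z t \<omega>) powr \<gamma>)) \<partial>M)
      \<le> ennreal (max 1 K * (1 + 2 powr \<gamma> / (1 - 2 powr (\<gamma> - p))) * (\<delta> powr b) powr (- \<gamma>))"
    proof (rule nn_integral_inverse_powr_le)
      show "emeasure M (space M) \<le> ennreal (max 1 K)" by (simp add: emeasure_space_1 le_max_iff_disj)
      fix r :: real assume r: "0 < r"
      have [measurable]: "Y s \<in> borel_measurable M" "Y t \<in> borel_measurable M" using st Y by auto
      have "prob {\<omega> \<in> space M. dist (Z s \<omega>) (Z t \<omega>) \<le> r} = prob {\<omega> \<in> space M. dist (Y s \<omega>) (Y t \<omega>) \<le> r}"
      proof (rule finite_measure_eq_AE)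
        show "AE \<omega> in M. \<omega> \<in> {\<omega> \<in> space M. dist (Z s \<omega>) (Z t \<omega>) \<le> r}
            \<longleftrightarrow> \<omega> \<in> {\<omega> \<in> space M. dist (Y s \<omega>) (Y t \<omega>) \<le> r}"
          using AEN by eventually_elim (simp add: Z_def)
      qed measurable
      also have "\<dots> \<le> K * (r / \<delta> powr b) powr p" unfolding \<delta>_def by (rule small[OF st False r])
      also have "\<dots> \<le> max 1 K * (r / \<delta> powr b) powr p" by (intro mult_right_mono) auto
      finally show "emeasure M {\<omega> \<in> space M. dist (Z s \<omega>) (Z t \<omega>) \<le> r} \<le> ennreal (max 1 K * (r / \<delta> powr b) powr p)"
        by (simp add: emeasure_eq_measure ennreal_leI)
    qed (use \<delta> \<gamma> in auto)
    also have "\<dots> = ennreal (C * \<delta> powr (- (b * \<gamma>)))" by (simp add: C_def powr_powr)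
    finally have 1: "(\<integral>\<^sup>+\<omega>. inverse (ennreal (dist (Z s \<omega>) (Z t \<omega>) powr \<gamma>)) \<partial>M) \<le> ennreal (C * \<delta> powr (- (b * \<gamma>)))" .
    \<comment> \<open>Off the diagonal the time factor is deterministic and positive, so it leaves
      the expectation.\<close>
    have "(\<integral>\<^sup>+\<omega>. h (\<omega>, s, t) \<partial>M) = (\<integral>\<^sup>+\<omega>. inverse (ennreal (dist (Z s \<omega>) (Z t \<omega>) powr \<gamma>)) * ennreal (\<delta> powr (- \<eta>)) \<partial>M)"
    proof (intro nn_integral_cong)
      fix \<omega>
      show "h (\<omega>, s, t) = inverse (ennreal (dist (Z s \<omega>) (Z t \<omega>) powr \<gamma>)) * ennreal (\<delta> powr (- \<eta>))"
        using \<delta> by (simp add: h_def \<delta>_def[symmetric] ennreal_mult ennreal_inverse_mult inverse_ennreal powr_minus)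
    qed
    also have "\<dots> = (\<integral>\<^sup>+\<omega>. inverse (ennreal (dist (Z s \<omega>) (Z t \<omega>) powr \<gamma>)) \<partial>M) * ennreal (\<delta> powr (- \<eta>))"
      by (intro nn_integral_multc) measurable
    also have "\<dots> \<le> ennreal (C * \<delta> powr (- (b * \<gamma>))) * ennreal (\<delta> powr (- \<eta>))"
      by (intro mult_right_mono 1) auto
    also have "\<dots> = ennreal C * ennreal (\<delta> powr (- \<theta>))"
      using C by (simp add: \<theta>_def mult.assoc flip: ennreal_mult powr_add)
    also have "ennreal (\<delta> powr (- \<theta>)) = inverse (ennreal (\<delta> powr \<theta>))"
      using \<delta> by (simp add: inverse_ennreal powr_minus)
    finally show ?thesis by (simp add: \<delta>_def)
  qed
  have [measurable]: "(\<lambda>x. dist (fst x) (snd x)) \<in> borel_measurable (?\<nu> \<Otimes>\<^sub>M ?\<nu>)"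
    by (intro borel_measurable_dist measurable_compose[OF _ cube_measure_id]) measurable
  have "(\<integral>\<^sup>+\<omega>. \<integral>\<^sup>+y. h (\<omega>, y) \<partial>(?\<nu> \<Otimes>\<^sub>M ?\<nu>) \<partial>M) = (\<integral>\<^sup>+y. \<integral>\<^sup>+\<omega>. h (\<omega>, y) \<partial>M \<partial>(?\<nu> \<Otimes>\<^sub>M ?\<nu>))"
    by (rule FU.Fubini[symmetric]) measurable
  also have "\<dots> \<le> (\<integral>\<^sup>+y. ennreal C * inverse (ennreal (dist (fst y) (snd y) powr \<theta>)) \<partial>(?\<nu> \<Otimes>\<^sub>M ?\<nu>))"
  proof (rule nn_integral_mono)
    fix y assume "y \<in> space (?\<nu> \<Otimes>\<^sub>M ?\<nu>)"
    then show "(\<integral>\<^sup>+\<omega>. h (\<omega>, y) \<partial>M) \<le> ennreal C * inverse (ennreal (dist (fst y) (snd y) powr \<theta>))"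
      using E[of "fst y" "snd y"] by (auto simp: space_pair_measure space_cube_measure)
  qed
  also have "\<dots> = (\<integral>\<^sup>+s. \<integral>\<^sup>+t. ennreal C * inverse (ennreal (dist s t powr \<theta>)) \<partial>?\<nu> \<partial>?\<nu>)"
    by (subst \<nu>.nn_integral_fst[symmetric]) auto
  also have "\<dots> \<le> (\<integral>\<^sup>+s. ennreal C * ennreal B \<partial>?\<nu>)"
  proof (rule nn_integral_mono)
    fix s
    have [measurable]: "dist s \<in> borel_measurable ?\<nu>" by measurable
    have "(\<integral>\<^sup>+t. ennreal C * inverse (ennreal (dist s t powr \<theta>)) \<partial>?\<nu>) = ennreal C * (\<integral>\<^sup>+t. inverse (ennreal (dist s t powr \<theta>)) \<partial>?\<nu>)"
      by (intro nn_integral_cmult) measurable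
    also have "\<dots> \<le> ennreal C * ennreal B" by (intro mult_left_mono B) auto
    finally show "(\<integral>\<^sup>+t. ennreal C * inverse (ennreal (dist s t powr \<theta>)) \<partial>?\<nu>) \<le> ennreal C * ennreal B" .
  qed
  also have "\<dots> < \<infinity>"
    by (simp add: \<nu>.emeasure_eq_measure ennreal_mult_less_top)
  finally have "(\<integral>\<^sup>+\<omega>. \<integral>\<^sup>+y. h (\<omega>, y) \<partial>(?\<nu> \<Otimes>\<^sub>M ?\<nu>) \<partial>M) \<noteq> \<infinity>" by simp
  then have "AE \<omega> in M. (\<integral>\<^sup>+y. h (\<omega>, y) \<partial>(?\<nu> \<Otimes>\<^sub>M ?\<nu>)) \<noteq> \<infinity>"
    by (intro nn_integral_PInf_AE \<nu>2.P.borel_measurable_nn_integral) (auto simp: case_prod_beta)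
  with AEN AE_space show ?thesis
  proof eventually_elim
    case (elim \<omega>)
    have "(\<lambda>y. h (\<omega>, y)) \<in> borel_measurable (?\<nu> \<Otimes>\<^sub>M ?\<nu>)"
      using elim by measurable
    from \<nu>.nn_integral_fst[OF this]
    have "(\<integral>\<^sup>+s. \<integral>\<^sup>+t. h (\<omega>, s, t) \<partial>?\<nu> \<partial>?\<nu>) < \<infinity>" using elim by (simp add: less_top)
    then show ?case using elim by (simp add: h_def Z_def)
  qed
qed

lemma AE_hausdorff_dim_ge:
  fixes Y :: "real ^ 'n \<Rightarrow> 'w \<Rightarrow> 'b::{metric_space,second_countable_topology}"
  assumes M: "prob_space M" and L: "0 < L"
    and Y: "\<And>u. u \<in> cube a L \<Longrightarrow> Y u \<in> borel_measurable M"
    and cont: "AE \<omega> in M. continuous_on (cube a L) (\<lambda>t. Y t \<omega>)"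
    and b: "0 < b" and K: "0 \<le> K"
    and small: "\<And>s t r. s \<in> cube a L \<Longrightarrow> t \<in> cube a L \<Longrightarrow> s \<noteq> t \<Longrightarrow> 0 < r \<Longrightarrow>
      measure M {\<omega> \<in> space M. dist (Y s \<omega>) (Y t \<omega>) \<le> r} \<le> K * (r / dist s t powr b) powr p"
    and \<gamma>: "0 < \<gamma>" "\<gamma> < p" and \<eta>: "0 \<le> \<eta>" and sum: "b * \<gamma> + \<eta> < CARD('n)"
  shows "AE \<omega> in M. ereal (\<gamma> + \<eta>) \<le> hausdorff_dim ((\<lambda>t. (t, Y t \<omega>)) ` cube a L)"
    and "AE \<omega> in M. ereal \<gamma> \<le> hausdorff_dim ((\<lambda>t. Y t \<omega>) ` cube a L)"
proof -
  let ?\<nu> = "cube_measure a L"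
  have fin: "finite_measure ?\<nu>" using L by (intro finite_cube_measure) simp
  have pos: "emeasure ?\<nu> (space ?\<nu>) \<noteq> 0"
    using L by (subst emeasure_cube_measure) (auto simp: space_cube_measure sets_restrict_space emeasure_lborel_cube)
  have meas: "F \<in> borel_measurable ?\<nu>" if "continuous_on (cube a L) F" for F :: "real ^ 'n \<Rightarrow> 'c::topological_space"
  proof -
    have "sets ?\<nu> = sets (restrict_space borel (cube a L))" by (simp add: sets_restrict_space)
    from measurable_cong_sets[OF this refl] show ?thesis
      using borel_measurable_continuous_on_restrict[OF that] by blast
  qed
  have en: "AE \<omega> in M. (\<integral>\<^sup>+s. \<integral>\<^sup>+t. inverse (ennreal (dist (Y s \<omega>) (Y t \<omega>) powr \<gamma> * dist s t powr \<eta>))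
      \<partial>?\<nu> \<partial>?\<nu>) < \<infinity>"
    by (rule AE_energy_finite[OF M L Y cont b K small \<gamma> \<eta> sum])
  \<comment> \<open>The range sees no time coordinate, so its energy is the case \<eta> = 0.\<close>
  have en0: "AE \<omega> in M. (\<integral>\<^sup>+s. \<integral>\<^sup>+t. inverse (ennreal (dist (Y s \<omega>) (Y t \<omega>) powr \<gamma> * dist s t powr 0))
      \<partial>?\<nu> \<partial>?\<nu>) < \<infinity>"
    by (rule AE_energy_finite[OF M L Y cont b K small \<gamma>]) (use sum \<eta> in auto)
  from en cont show "AE \<omega> in M. ereal (\<gamma> + \<eta>) \<le> hausdorff_dim ((\<lambda>t. (t, Y t \<omega>)) ` cube a L)"
  proof eventually_elim
    case (elim \<omega>)
    have "(\<integral>\<^sup>+s. \<integral>\<^sup>+t. inverse (ennreal (dist (s, Y s \<omega>) (t, Y t \<omega>) powr (\<gamma> + \<eta>))) \<partial>?\<nu> \<partial>?\<nu>)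
      \<le> (\<integral>\<^sup>+s. \<integral>\<^sup>+t. inverse (ennreal (dist (Y s \<omega>) (Y t \<omega>) powr \<gamma> * dist s t powr \<eta>)) \<partial>?\<nu> \<partial>?\<nu>)"
    proof (intro nn_integral_mono inverse_ennreal_antimono ennreal_leI)
      fix s t
      have "dist (Y s \<omega>) (Y t \<omega>) powr \<gamma> * dist s t powr \<eta>
          \<le> dist (s, Y s \<omega>) (t, Y t \<omega>) powr \<gamma> * dist (s, Y s \<omega>) (t, Y t \<omega>) powr \<eta>"
        using \<gamma> \<eta> dist_snd_le[of "(s, Y s \<omega>)" "(t, Y t \<omega>)"] dist_fst_le[of "(s, Y s \<omega>)" "(t, Y t \<omega>)"]
        by (intro mult_mono powr_mono2) auto
      then show "dist (Y s \<omega>) (Y t \<omega>) powr \<gamma> * dist s t powr \<eta> \<le> dist (s, Y s \<omega>) (t, Y t \<omega>) powr (\<gamma> + \<eta>)"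
        by (simp add: powr_add)
    qed
    then have "(\<integral>\<^sup>+s. \<integral>\<^sup>+t. inverse (ennreal (dist (s, Y s \<omega>) (t, Y t \<omega>) powr (\<gamma> + \<eta>))) \<partial>?\<nu> \<partial>?\<nu>) < \<infinity>"
      using elim(1) by (rule le_less_trans)
    then show ?case
      using hausdorff_dim_ge_energy[OF fin meas pos, of "\<lambda>t. (t, Y t \<omega>)" "\<gamma> + \<eta>"] \<gamma> \<eta> elim(2)
      by (simp add: space_cube_measure continuous_on_Pair)
  qed
  from en0 cont show "AE \<omega> in M. ereal \<gamma> \<le> hausdorff_dim ((\<lambda>t. Y t \<omega>) ` cube a L)"
  proof eventually_elim
    case (elim \<omega>)
    \<comment> \<open>On the diagonal \<open>dist s t powr 0\<close> is 0 rather than 1, but there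
      the other factor is 0 already.\<close>
    have "dist (Y s \<omega>) (Y t \<omega>) powr \<gamma> * dist s t powr 0 = dist (Y s \<omega>) (Y t \<omega>) powr \<gamma>" for s t
      by (cases "s = t") auto
    then have "(\<integral>\<^sup>+s. \<integral>\<^sup>+t. inverse (ennreal (dist (Y s \<omega>) (Y t \<omega>) powr \<gamma>)) \<partial>?\<nu> \<partial>?\<nu>) < \<infinity>"
      using elim(1) by (simp only:)
    then show ?case
      using hausdorff_dim_ge_energy[OF fin meas pos, of "\<lambda>t. Y t \<omega>" \<gamma>] \<gamma> elim(2)
      by (simp add: space_cube_measure)
  qed
qed

section \<open>Local exponents and dimension bounds near a point\<close>

lemma range_over_image: "range_over Y \<omega> A = (\<lambda>t. Y t \<omega>) ` A"
  by (auto simp: range_over_def)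

lemma graph_over_image: "graph_over Y \<omega> A = (\<lambda>t. (t, Y t \<omega>)) ` A"
  by (auto simp: graph_over_def)

lemma orthant_ball_mono: "\<rho> \<le> \<rho>' \<Longrightarrow> orthant_ball t0 \<rho> \<subseteq> orthant_ball t0 \<rho>'"
  by (auto simp: orthant_ball_def)

lemma midpoint_orthant_ball:
  assumes "s \<in> orthant_ball t0 \<rho>" "t \<in> orthant_ball t0 \<rho>"
  shows "midpoint s t \<in> orthant_ball t0 \<rho>"
proof -
  have "s \<in> ball t0 \<rho>" "t \<in> ball t0 \<rho>" using assms by (auto simp: orthant_ball_def)
  from convexD[OF convex_ball this, of "1 / 2" "1 / 2"]
  have "midpoint s t \<in> ball t0 \<rho>" by (simp add: midpoint_def scaleR_add_right)
  moreover have "midpoint s t \<in> orthant"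
    using assms by (auto simp: orthant_ball_def orthant_def midpoint_def)
  ultimately show ?thesis by (simp add: orthant_ball_def)
qed

text \<open>Moving upwards along an axis stays in the orthant even from a boundary point. Index sets
  of the suprema over small balls are thus nonempty, and a supremum of zeros is 0 rather than minus
  infinity.\<close>

lemma orthant_ball_distinct_points:
  fixes t0 :: "real ^ 'n"
  assumes "t0 \<in> orthant" "0 < \<rho>"
  obtains s t where "s \<in> orthant_ball t0 \<rho>" "t \<in> orthant_ball t0 \<rho>" "s \<noteq> t"
proof (rule that[of t0 "t0 + axis undefined (\<rho> / 2)"])
  show "t0 \<in> orthant_ball t0 \<rho>" using assms by (simp add: orthant_ball_def)
  have "axis (undefined :: 'n) (\<rho> / 2) = (\<rho> / 2) *\<^sub>R axis undefined 1"
    by (simp add: vec_eq_iff axis_def)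
  then have "norm (axis (undefined :: 'n) (\<rho> / 2)) = \<rho> / 2" using assms by (simp add: norm_axis_1)
  then show "t0 + axis undefined (\<rho> / 2) \<in> orthant_ball t0 \<rho>"
    using assms by (auto simp: orthant_ball_def orthant_def dist_norm axis_def)
  show "t0 \<noteq> t0 + axis undefined (\<rho> / 2)" using assms by (simp add: axis_eq_0_iff)
qed

lemma cube_near:
  fixes t0 :: "real ^ 'n"
  assumes "t0 \<in> orthant" "0 < \<rho>"
  obtains r a L where "0 < r" "0 < L" "orthant_ball t0 r \<subseteq> cube a L" "cube a L \<subseteq> orthant_ball t0 \<rho>"
proof -
  \<comment> \<open>A cube of side 2 r has coordinate distances from \<open>t0\<close> at most 2 r,
    hence Euclidean distance at most 2 r N = \<rho> / 2.\<close>
  define r where "r = \<rho> / (4 * CARD('n))"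
  \<comment> \<open>Clipping the corner at 0 keeps the cube inside the orthant; a side of 2 r still
    reaches every orthant point within r of \<open>t0\<close>.\<close>
  define a :: "real ^ 'n" where "a = (\<chi> i. max 0 (t0 $ i - r))"
  have r: "0 < r" using assms by (simp add: r_def)
  have t0: "0 \<le> t0 $ i" for i using assms by (simp add: orthant_def)
  show thesis
  proof (rule that[of r "2 * r" a])
    show "orthant_ball t0 r \<subseteq> cube a (2 * r)"
    proof
      fix t assume t: "t \<in> orthant_ball t0 r"
      have "a $ i \<le> t $ i \<and> t $ i \<le> a $ i + 2 * r" for i
      proof -
        have "0 \<le> t $ i" using t by (simp add: orthant_ball_def orthant_def)
        moreover have "\<bar>(t0 - t) $ i\<bar> \<le> r"
          using t component_le_norm_cart[of "t0 - t" i] by (simp add: orthant_ball_def dist_norm)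
        then have "\<bar>t0 $ i - t $ i\<bar> \<le> r" by simp
        ultimately show ?thesis by (auto simp: a_def)
      qed
      then show "t \<in> cube a (2 * r)" by (simp add: cube_def)
    qed
    show "cube a (2 * r) \<subseteq> orthant_ball t0 \<rho>"
    proof
      fix t assume t: "t \<in> cube a (2 * r)"
      have *: "0 \<le> t $ i" "\<bar>t0 $ i - t $ i\<bar> \<le> 2 * r" for i
      proof -
        have "a $ i \<le> t $ i" "t $ i \<le> a $ i + 2 * r" using t by (auto simp: cube_def)
        then show "0 \<le> t $ i" "\<bar>t0 $ i - t $ i\<bar> \<le> 2 * r"
          using t0[of i] r by (auto simp: a_def max_def split: if_splits)
      qed
      have "dist t0 t \<le> (\<Sum>i\<in>UNIV. \<bar>(t0 - t) $ i\<bar>)" unfolding dist_norm by (rule norm_le_l1_cart)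
      also have "\<dots> \<le> (\<Sum>i\<in>(UNIV::'n set). 2 * r)" using * by (intro sum_mono) simp
      also have "\<dots> = \<rho> / 2" by (simp add: r_def)
      also have "\<dots> < \<rho>" using assms by simp
      finally show "t \<in> orthant_ball t0 \<rho>" using * by (simp add: orthant_ball_def orthant_def)
    qed
  qed (use r in auto)
qed

section \<open>Increment bounds extracted from the local exponents\<close>

text \<open>Strictly below the supremum there is an admissible a' > a, whose finite limit bounds the
  ratios on small balls; at distances at most 1 the power may then be lowered from a' to a.\<close>

lemma holder_exponent_bound:
  assumes "ereal a < local_holder_exponent M Y t0"
  obtains \<rho> C where "0 < \<rho>" "0 \<le> C"
    "\<And>s t. s \<in> orthant_ball t0 \<rho> \<Longrightarrow> t \<in> orthant_ball t0 \<rho> \<Longrightarrow> sq_increment M Y s t \<le> C * dist s t powr (2 * a)"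
proof -
  obtain a' L where a': "a < a'"
    and lim: "((\<lambda>\<rho>. SUP (s, t) \<in> {(s, t). s \<in> orthant_ball t0 \<rho> \<and> t \<in> orthant_ball t0 \<rho> \<and> s \<noteq> t}.
                ereal (increment_ratio M Y a' s t)) \<longlongrightarrow> L) (at_right 0)" and L: "L < \<infinity>"
    using assms unfolding local_holder_exponent_def less_Sup_iff by auto
  obtain c where c: "L < ereal c" using ereal_dense2[OF L] by blast
  have "\<forall>\<^sub>F \<rho> in at_right 0. (SUP (s, t) \<in> {(s, t). s \<in> orthant_ball t0 \<rho> \<and> t \<in> orthant_ball t0 \<rho> \<and> s \<noteq> t}.
                ereal (increment_ratio M Y a' s t)) < ereal c"
    using order_tendstoD(2)[OF lim c] .
  then obtain \<rho>1 :: real where \<rho>1: "0 < \<rho>1" and bd: "\<And>\<rho>. 0 < \<rho> \<Longrightarrow> \<rho> < \<rho>1 \<Longrightarrow>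
      (SUP (s, t) \<in> {(s, t). s \<in> orthant_ball t0 \<rho> \<and> t \<in> orthant_ball t0 \<rho> \<and> s \<noteq> t}.
                ereal (increment_ratio M Y a' s t)) < ereal c"
    unfolding eventually_at_right_field by auto
  \<comment> \<open>A radius of at most 1 / 2 makes all distances in the ball at most 1, where
    powers decrease in the exponent.\<close>
  define \<rho> where "\<rho> = min \<rho>1 1 / 2"
  have \<rho>: "0 < \<rho>" "\<rho> < \<rho>1" "\<rho> \<le> 1 / 2" using \<rho>1 by (auto simp: \<rho>_def)
  show thesis
  proof (rule that[of \<rho> "max c 0"])
    fix s t assume st: "s \<in> orthant_ball t0 \<rho>" "t \<in> orthant_ball t0 \<rho>"
    show "sq_increment M Y s t \<le> max c 0 * dist s t powr (2 * a)"
    proof (cases "s = t")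
      case True then show ?thesis by (simp add: sq_increment_def)
    next
      case False
      have "ereal (increment_ratio M Y a' s t) \<le> (SUP (s, t) \<in> {(s, t). s \<in> orthant_ball t0 \<rho> \<and> t \<in> orthant_ball t0 \<rho> \<and> s \<noteq> t}.
                ereal (increment_ratio M Y a' s t))"
        using st False by (intro SUP_upper2[where i = "(s, t)"]) auto
      also have "\<dots> < ereal c" by (rule bd[OF \<rho>(1,2)])
      finally have "increment_ratio M Y a' s t < c" by simp
      then have "sq_increment M Y s t / dist s t powr (2 * a') \<le> c"
        by (simp add: increment_ratio_def sq_increment_def dist_norm norm_minus_commute)
      then have "sq_increment M Y s t \<le> c * dist s t powr (2 * a')"
        using False by (simp add: divide_le_eq)
      also have "\<dots> \<le> max c 0 * dist s t powr (2 * a')" by (intro mult_right_mono) auto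
      also have "\<dots> \<le> max c 0 * dist s t powr (2 * a)"
      proof (intro mult_left_mono powr_mono')
        have "dist s t \<le> dist t0 s + dist t0 t" by (rule dist_triangle3)
        then show "dist s t \<le> 1" using st \<rho> by (simp add: orthant_ball_def)
      qed (use a' in auto)
      finally show ?thesis .
    qed
  qed (use \<rho> in auto)
qed

text \<open>An infinite limit eventually exceeds 1, so the lower bound comes with constant 1, first
  for some b' < b and then for b at distances at most 1.\<close>

lemma sub_exponent_bound:
  assumes "local_sub_exponent M Y t0 < ereal b"
  obtains \<rho> where "0 < \<rho>"
    "\<And>s t. s \<in> orthant_ball t0 \<rho> \<Longrightarrow> t \<in> orthant_ball t0 \<rho> \<Longrightarrow> s \<noteq> t \<Longrightarrow> dist s t powr (2 * b) \<le> sq_increment M Y s t"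
proof -
  obtain b' where b': "b' < b"
    and lim: "((\<lambda>\<rho>. INF (s, t) \<in> {(s, t). s \<in> orthant_ball t0 \<rho> \<and> t \<in> orthant_ball t0 \<rho> \<and> s \<noteq> t}.
                ereal (increment_ratio M Y b' s t)) \<longlongrightarrow> \<infinity>) (at_right 0)"
    using assms unfolding local_sub_exponent_def Inf_less_iff by auto
  have "\<forall>\<^sub>F \<rho> in at_right 0. ereal 1 < (INF (s, t) \<in> {(s, t). s \<in> orthant_ball t0 \<rho> \<and> t \<in> orthant_ball t0 \<rho> \<and> s \<noteq> t}.
                ereal (increment_ratio M Y b' s t))"
    using order_tendstoD(1)[OF lim] by simp
  then obtain \<rho>1 :: real where \<rho>1: "0 < \<rho>1" and bd: "\<And>\<rho>. 0 < \<rho> \<Longrightarrow> \<rho> < \<rho>1 \<Longrightarrow>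
      ereal 1 < (INF (s, t) \<in> {(s, t). s \<in> orthant_ball t0 \<rho> \<and> t \<in> orthant_ball t0 \<rho> \<and> s \<noteq> t}.
                ereal (increment_ratio M Y b' s t))"
    unfolding eventually_at_right_field by auto
  define \<rho> where "\<rho> = min \<rho>1 1 / 2"
  have \<rho>: "0 < \<rho>" "\<rho> < \<rho>1" "\<rho> \<le> 1 / 2" using \<rho>1 by (auto simp: \<rho>_def)
  show thesis
  proof (rule that[of \<rho>])
    fix s t assume st: "s \<in> orthant_ball t0 \<rho>" "t \<in> orthant_ball t0 \<rho>" "s \<noteq> t"
    have "ereal 1 < (INF (s, t) \<in> {(s, t). s \<in> orthant_ball t0 \<rho> \<and> t \<in> orthant_ball t0 \<rho> \<and> s \<noteq> t}.
                ereal (increment_ratio M Y b' s t))" by (rule bd[OF \<rho>(1,2)])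
    also have "\<dots> \<le> ereal (increment_ratio M Y b' s t)"
      using st by (intro INF_lower2[where i = "(s, t)"]) auto
    finally have "1 < sq_increment M Y s t / dist s t powr (2 * b')"
      by (simp add: increment_ratio_def sq_increment_def dist_norm norm_minus_commute)
    then have "dist s t powr (2 * b') \<le> sq_increment M Y s t"
      using st by (simp add: less_divide_eq)
    moreover have "dist s t powr (2 * b) \<le> dist s t powr (2 * b')"
    proof (rule powr_mono')
      have "dist s t \<le> dist t0 s + dist t0 t" by (rule dist_triangle3)
      then show "dist s t \<le> 1" using st \<rho> by (simp add: orthant_ball_def)
    qed (use b' in auto)
    ultimately show "dist s t powr (2 * b) \<le> sq_increment M Y s t" by simp
  qed (use \<rho> in auto)
qed

text \<open>Integrates (x + y)^2 \<le> 2 x^2 + 2 y^2. The square integrability that the comparison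
  requires comes from Gaussianity.\<close>

lemma sq_increment_le_midpoint:
  assumes M: "prob_space M" and Y: "gaussian_process M T Y" and T: "r \<in> T" "s \<in> T" "t \<in> T"
  shows "sq_increment M Y r t \<le> 2 * sq_increment M Y r s + 2 * sq_increment M Y s t"
proof -
  interpret prob_space M by fact
  have int: "integrable M (\<lambda>\<omega>. \<bar>Y v \<omega> - Y u \<omega>\<bar>\<^sup>2)" if "u \<in> T" "v \<in> T" for u v
    by (intro gaussian_square_integrable gaussian_process_increment[OF Y] that)
  have "sq_increment M Y r t \<le> (\<integral>\<omega>. 2 * \<bar>Y s \<omega> - Y r \<omega>\<bar>\<^sup>2 + 2 * \<bar>Y t \<omega> - Y s \<omega>\<bar>\<^sup>2 \<partial>M)"
    unfolding sq_increment_def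
  proof (intro integral_mono)
    fix \<omega>
    have "0 \<le> ((Y s \<omega> - Y r \<omega>) - (Y t \<omega> - Y s \<omega>))\<^sup>2" by simp
    then show "\<bar>Y t \<omega> - Y r \<omega>\<bar>\<^sup>2 \<le> 2 * \<bar>Y s \<omega> - Y r \<omega>\<bar>\<^sup>2 + 2 * \<bar>Y t \<omega> - Y s \<omega>\<bar>\<^sup>2"
      by (simp add: power2_eq_square algebra_simps)
  qed (use int T in auto)
  also have "\<dots> = 2 * sq_increment M Y r s + 2 * sq_increment M Y s t"
    unfolding sq_increment_def using int T by (subst Bochner_Integration.integral_add) auto
  finally show ?thesis .
qed

text \<open>
  Halving a segment improves the constant in \<open>E \<bar>Y t - Y s\<bar>\<^sup>2 \<le> C \<bar>t - s\<bar>\<^sup>2\<^sup>a\<close> by the factor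
  \<open>2 powr (2 - 2 a)\<close>, so an exponent beyond 1 forces the increments to vanish.
\<close>

lemma holder_exponent_gt_1:
  assumes M: "prob_space M" and Y: "gaussian_process M orthant Y" and t0: "t0 \<in> orthant"
    and gt: "1 < local_holder_exponent M Y t0"
  shows "local_holder_exponent M Y t0 = \<infinity>"
proof -
  obtain a where a: "1 < a" "ereal a < local_holder_exponent M Y t0"
    using ereal_dense2[OF gt] by (auto simp: one_ereal_def)
  obtain \<rho> C where \<rho>: "0 < \<rho>" and C: "0 \<le> C"
    and bd: "\<And>s t. s \<in> orthant_ball t0 \<rho> \<Longrightarrow> t \<in> orthant_ball t0 \<rho> \<Longrightarrow> sq_increment M Y s t \<le> C * dist s t powr (2 * a)"
    by (rule holder_exponent_bound[OF a(2)]) (iprover intro: that)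
  \<comment> \<open>Two halves, each doubled by the quadratic inequality and each with distance
    scaled by 1 / 2; the product is below 1 because a > 1.\<close>
  define q where "q = 4 * (1 / 2) powr (2 * a)"
  have "(1 / 2 :: real) powr (2 * a) < (1 / 2) powr 2" using a by (intro powr_less_mono') auto
  then have q: "0 < q" "q < 1" by (auto simp: q_def power2_eq_square powr_numeral)
  have it: "sq_increment M Y s t \<le> C * q ^ n * dist s t powr (2 * a)"
    if "s \<in> orthant_ball t0 \<rho>" "t \<in> orthant_ball t0 \<rho>" for s t n
    using that
  proof (induction n arbitrary: s t)
    case 0 then show ?case using bd by simp
  next
    case (Suc n)
    let ?m = "midpoint s t"
    have m: "?m \<in> orthant_ball t0 \<rho>" by (rule midpoint_orthant_ball[OF Suc.prems])
    have "sq_increment M Y s t \<le> 2 * sq_increment M Y s ?m + 2 * sq_increment M Y ?m t"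
      using Suc.prems m by (intro sq_increment_le_midpoint[OF M Y]) (auto simp: orthant_ball_def)
    also have "\<dots> \<le> 2 * (C * q ^ n * dist s ?m powr (2 * a)) + 2 * (C * q ^ n * dist ?m t powr (2 * a))"
      using Suc.IH[OF Suc.prems(1) m] Suc.IH[OF m Suc.prems(2)] by linarith
    also have "\<dots> = C * q ^ Suc n * dist s t powr (2 * a)"
      by (simp add: dist_midpoint powr_divide q_def)
    finally show ?case .
  qed
  have zero: "sq_increment M Y s t = 0" if "s \<in> orthant_ball t0 \<rho>" "t \<in> orthant_ball t0 \<rho>" for s t
  proof (rule antisym)
    have "(\<lambda>n. C * q ^ n * dist s t powr (2 * a)) \<longlonglongrightarrow> 0"
      using q by (intro tendsto_mult_left_zero tendsto_mult_right_zero LIMSEQ_realpow_zero) auto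
    then show "sq_increment M Y s t \<le> 0"
      using it[OF that] by (intro tendsto_lowerbound[of _ 0 sequentially]) auto
  qed (rule sq_increment_nonneg)
  \<comment> \<open>When the increments vanish near \<open>t0\<close>, all ratios there are 0 and
    every positive order is admissible in the supremum.\<close>
  have "ereal c \<le> local_holder_exponent M Y t0" if c: "0 < c" for c
    unfolding local_holder_exponent_def
  proof (intro Sup_upper, clarsimp, intro conjI c exI)
    let ?S = "\<lambda>\<rho>'. SUP (s, t) \<in> {(s, t). s \<in> orthant_ball t0 \<rho>' \<and> t \<in> orthant_ball t0 \<rho>' \<and> s \<noteq> t}.
                ereal (increment_ratio M Y c s t)"
    have "\<forall>\<^sub>F \<rho>' in at_right 0. ?S \<rho>' = 0"
      unfolding eventually_at_right_field
    proof (intro exI[of _ \<rho>] conjI allI impI \<rho>)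
      fix \<rho>' :: real assume \<rho>': "0 < \<rho>'" "\<rho>' < \<rho>"
      obtain s t where st: "s \<in> orthant_ball t0 \<rho>'" "t \<in> orthant_ball t0 \<rho>'" "s \<noteq> t"
        using orthant_ball_distinct_points[OF t0 \<rho>'(1)] by blast
      have "increment_ratio M Y c s t = 0" if "s \<in> orthant_ball t0 \<rho>'" "t \<in> orthant_ball t0 \<rho>'" for s t
        using zero[of s t] that orthant_ball_mono[of \<rho>' \<rho> t0] \<rho>'
        by (auto simp: increment_ratio_def sq_increment_def)
      then show "?S \<rho>' = 0"
        using st by (intro SUP_eq_const) (auto simp: zero_ereal_def)
    qed
    then show "(?S \<longlongrightarrow> 0) (at_right 0)" by (rule tendsto_eventually)
  qed auto
  moreover have "ereal c \<le> local_holder_exponent M Y t0" if "c \<le> 0" for c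
  proof -
    have "ereal c \<le> 1" using that by (simp add: one_ereal_def)
    then show ?thesis using gt by (meson less_imp_le order_trans)
  qed
  ultimately have "ereal c \<le> local_holder_exponent M Y t0" for c by (cases "0 < c") auto
  then show ?thesis by (rule ereal_top)
qed

text \<open>The probabilistic bounds hold off null sets that depend on the order, so they are
  requested for rational orders and, from below, for the radii 1 / (n + 1) only. Monotonicity makes
  the limit an infimum over radii, so an upper bound is needed at just one radius.\<close>

lemma tendsto_at_right_mono_bounds:
  fixes f :: "real \<Rightarrow> ereal"
  assumes mono: "\<And>x y. x \<le> y \<Longrightarrow> f x \<le> f y"
    and low: "\<And>q n. ereal (of_rat q) < lo \<Longrightarrow> ereal (of_rat q) \<le> f (1 / real (Suc n))"
    and up: "\<And>q. hi < ereal (of_rat q) \<Longrightarrow> \<exists>\<rho>>0. f \<rho> \<le> ereal (of_rat q)"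
  shows "\<exists>g. (f \<longlongrightarrow> g) (at_right 0) \<and> lo \<le> g \<and> g \<le> hi"
proof (intro exI[of _ "INF \<rho>\<in>{0<..}. f \<rho>"] conjI)
  let ?g = "INF \<rho>\<in>{0<..}. f \<rho>"
  show "(f \<longlongrightarrow> ?g) (at_right 0)"
  proof (rule order_tendstoI)
    fix l assume "l < ?g"
    then have "l < f \<rho>" if "0 < \<rho>" for \<rho> using that INF_lower[of \<rho> "{0<..}" f] by (auto intro: less_le_trans)
    then show "\<forall>\<^sub>F \<rho> in at_right 0. l < f \<rho>"
      unfolding eventually_at_right_field by (intro exI[of _ 1]) auto
  next
    fix u assume "?g < u"
    then obtain \<rho>0 where "0 < \<rho>0" "f \<rho>0 < u" by (auto simp: INF_less_iff)
    then show "\<forall>\<^sub>F \<rho> in at_right 0. f \<rho> < u"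
      unfolding eventually_at_right_field
      using mono by (intro exI[of _ \<rho>0]) (auto intro: le_less_trans[where y = "f \<rho>0"])
  qed
  show "lo \<le> ?g"
  proof (rule ccontr)
    assume "\<not> lo \<le> ?g"
    then obtain q where q: "?g < ereal (of_rat q)" "ereal (of_rat q) < lo"
      using ereal_dense3[of ?g lo] by (auto simp: not_le)
    then obtain \<rho>0 where \<rho>0: "0 < \<rho>0" "f \<rho>0 < ereal (of_rat q)" by (auto simp: INF_less_iff)
    obtain n where "1 / real (Suc n) < \<rho>0" using \<rho>0(1) nat_approx_posE by blast
    then have "f (1 / real (Suc n)) \<le> f \<rho>0" by (intro mono) simp
    then show False using low[OF q(2), of n] \<rho>0(2) by simp
  qed
  show "?g \<le> hi"
  proof (rule ccontr)
    assume "\<not> ?g \<le> hi"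
    then obtain q where q: "hi < ereal (of_rat q)" "ereal (of_rat q) < ?g"
      using ereal_dense3[of hi ?g] by (auto simp: not_le)
    obtain \<rho> where "0 < \<rho>" "f \<rho> \<le> ereal (of_rat q)" using up[OF q(1)] by blast
    then have "?g \<le> ereal (of_rat q)" by (intro INF_lower2[of \<rho>]) auto
    then show False using q(2) by simp
  qed
qed

section \<open>Continuous modification and dimension bounds at fixed orders\<close>

locale gaussian_field_at = prob_space M
  for M :: "'w measure" and X :: "real ^ 'n \<Rightarrow> 'w \<Rightarrow> real ^ 'd" and t0 :: "real ^ 'n" and i :: 'd +
  assumes field: "gaussian_field M X" and t0: "t0 \<in> orthant"
begin

abbreviation "\<alpha> \<equiv> local_holder_exponent M (coord_process X i) t0"
abbreviation "\<beta> \<equiv> local_sub_exponent M (coord_process X i) t0"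

text \<open>The tail hypothesis of \<open>AE_grid_holder\<close>, with a constant that may depend on
  the moment order.\<close>

definition increment_tail :: "real ^ 'n \<Rightarrow> real \<Rightarrow> real \<Rightarrow> bool" where
  "increment_tail a L h \<longleftrightarrow> (\<forall>k. \<exists>C\<ge>0. \<forall>u\<in>cube a L. \<forall>v\<in>cube a L. \<forall>r>0.
      prob {\<omega> \<in> space M. r \<le> dist (X u \<omega>) (X v \<omega>)} \<le> C * (dist u v powr (2 * h) / r\<^sup>2) ^ k)"

lemma tail_bound:
  assumes "cube a L \<subseteq> orthant" and C: "0 \<le> C"
    and le: "\<And>s t. s \<in> cube a L \<Longrightarrow> t \<in> cube a L \<Longrightarrow> sq_increment M (coord_process X i) s t \<le> C * dist s t powr (2 * h)"
  shows "increment_tail a L h"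
  unfolding increment_tail_def
proof
  fix k
  define A where "A = real CARD('d) * (4 ^ k * fact (2 * k) * (real CARD('d))\<^sup>2 ^ k)"
  have A: "0 \<le> A" by (simp add: A_def)
  have "prob {\<omega> \<in> space M. r \<le> dist (X u \<omega>) (X v \<omega>)} \<le> A * C ^ k * (dist u v powr (2 * h) / r\<^sup>2) ^ k"
    if uv: "u \<in> cube a L" "v \<in> cube a L" and r: "0 < r" for u v r
  proof -
    have "prob {\<omega> \<in> space M. r \<le> dist (X u \<omega>) (X v \<omega>)} \<le> A * (sq_increment M (coord_process X i) v u / r\<^sup>2) ^ k"
      unfolding A_def using assms(1) uv by (intro gaussian_field_tail[OF _ field _ _ r] prob_space_axioms) auto
    also have "\<dots> \<le> A * (C * dist v u powr (2 * h) / r\<^sup>2) ^ k"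
      using le[OF uv(2,1)] A by (intro mult_left_mono power_mono divide_right_mono) (auto simp: sq_increment_nonneg)
    also have "\<dots> = A * C ^ k * (dist u v powr (2 * h) / r\<^sup>2) ^ k"
      by (simp add: dist_commute power_mult_distrib power_divide)
    finally show ?thesis .
  qed
  then show "\<exists>C\<ge>0. \<forall>u\<in>cube a L. \<forall>v\<in>cube a L. \<forall>r>0.
      prob {\<omega> \<in> space M. r \<le> dist (X u \<omega>) (X v \<omega>)} \<le> C * (dist u v powr (2 * h) / r\<^sup>2) ^ k"
    using A C by (intro exI[of _ "A * C ^ k"]) auto
qed

lemma ex_cube_tail:
  fixes h :: real
  assumes h: "ereal h < \<alpha>" and \<rho>: "0 < \<rho>"
  obtains r a L where "0 < r" "0 < L" "orthant_ball t0 r \<subseteq> cube a L" "cube a L \<subseteq> orthant_ball t0 \<rho>"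
    "increment_tail a L h"
proof -
  obtain \<rho>' C where \<rho>': "0 < \<rho>'" and C: "0 \<le> C" and bd: "\<And>s t. s \<in> orthant_ball t0 \<rho>' \<Longrightarrow> t \<in> orthant_ball t0 \<rho>' \<Longrightarrow>
      sq_increment M (coord_process X i) s t \<le> C * dist s t powr (2 * h)"
    by (rule holder_exponent_bound[OF h]) (iprover intro: that)
  obtain r a L where c: "0 < r" "0 < L" "orthant_ball t0 r \<subseteq> cube a L" "cube a L \<subseteq> orthant_ball t0 (min \<rho> \<rho>')"
    by (rule cube_near[OF t0, of "min \<rho> \<rho>'"]) (use \<rho> \<rho>' in simp, iprover intro: that)
  have sub: "cube a L \<subseteq> orthant_ball t0 \<rho>" "cube a L \<subseteq> orthant_ball t0 \<rho>'" "cube a L \<subseteq> orthant"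
    using c(4) orthant_ball_mono[of "min \<rho> \<rho>'" \<rho> t0] orthant_ball_mono[of "min \<rho> \<rho>'" \<rho>' t0]
    by (auto simp: orthant_ball_def)
  show thesis
  proof (rule that[OF c(1-3) sub(1)])
    show "increment_tail a L h"
      using sub by (intro tail_bound[OF sub(3) C] bd) auto
  qed
qed

text \<open>Kolmogorov's construction on a cube around \<open>t0\<close>: chaining makes the grid
  limits continuous in t, and Borel-Cantelli at each single t identifies the limit with
  \<open>X t\<close> almost surely.\<close>

lemma ex_continuous_modification:
  assumes "0 < \<alpha>"
  shows "\<exists>Y. modification M orthant Y X \<and> continuous_paths_near M t0 Y"
proof -
  obtain h where h: "0 < h" "ereal h < \<alpha>" using ereal_dense2[OF assms] by auto
  obtain r a L where c: "0 < r" "0 < L" "orthant_ball t0 r \<subseteq> cube a L" "cube a L \<subseteq> orthant_ball t0 1"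
    and "increment_tail a L h"
    by (rule ex_cube_tail[OF h(2) zero_less_one]) (iprover intro: that)
  then have tail: "\<And>k. \<exists>C\<ge>0. \<forall>u\<in>cube a L. \<forall>v\<in>cube a L. \<forall>r>0.
      prob {\<omega> \<in> space M. r \<le> dist (X u \<omega>) (X v \<omega>)} \<le> C * (dist u v powr (2 * h) / r\<^sup>2) ^ k"
    by (simp add: increment_tail_def)
  have orth: "cube a L \<subseteq> orthant" using c(4) by (auto simp: orthant_ball_def)
  have X: "X u \<in> borel_measurable M" if "u \<in> orthant" for u by (rule gaussian_field_measurable[OF field that])
  \<comment> \<open>Where the grid values fail to converge, \<open>lim\<close> has an unspecified
    value, but it is still a measurable function of \<omega>.\<close>
  define Y where "Y t \<omega> = (if t \<in> cube a L then lim (\<lambda>n. X (grid_proj a L n t) \<omega>) else X t \<omega>)" for t \<omega>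
  have P: "grid_proj a L n t \<in> cube a L" if "t \<in> cube a L" for n t
    using grid_proj_in_grid[OF c(2) that] grid_subset_cube[of L a n] c(2) by auto
  have "modification M orthant Y X"
    unfolding modification_def
  proof (intro ballI conjI)
    fix t :: "real ^ 'n" assume t: "t \<in> orthant"
    show "Y t \<in> borel_measurable M"
    proof (cases "t \<in> cube a L")
      case True
      have "X (grid_proj a L n t) \<in> borel_measurable M" for n using P[OF True] orth by (intro X) auto
      then have "(\<lambda>\<omega>. lim (\<lambda>n. X (grid_proj a L n t) \<omega>)) \<in> borel_measurable M"
        by (rule borel_measurable_lim_metric)
      then show ?thesis using True by (simp add: Y_def[abs_def])
    next
      case False then show ?thesis using X[OF t] by (simp add: Y_def[abs_def])
    qed
    show "AE \<omega> in M. Y t \<omega> = X t \<omega>"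
    proof (cases "t \<in> cube a L")
      case True
      obtain C where C: "0 \<le> C" "\<And>u v r. u \<in> cube a L \<Longrightarrow> v \<in> cube a L \<Longrightarrow> 0 < r \<Longrightarrow>
          prob {\<omega> \<in> space M. r \<le> dist (X u \<omega>) (X v \<omega>)} \<le> C * (dist u v powr (2 * h) / r\<^sup>2)"
        using tail[of 1] by (auto simp: power_one_right)
      have "AE \<omega> in M. (\<lambda>n. X (grid_proj a L n t) \<omega>) \<longlonglongrightarrow> X t \<omega>"
        using orth by (intro AE_grid_proj_tendsto[OF c(2) h(1) True _ C]) (auto intro: X)
      then show ?thesis by eventually_elim (simp add: Y_def True limI)
    qed (simp add: Y_def)
  qed
  moreover have "continuous_paths_near M t0 Y"
    unfolding continuous_paths_near_def
  proof (intro exI[of _ r] conjI c(1))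
    have "AE \<omega> in M. grid_holder a L (h / 2) (\<lambda>u. X u \<omega>)"
      using h orth by (intro AE_grid_holder[OF c(2), of "h / 2" h] tail) (auto intro: X)
    then show "AE \<omega> in M. continuous_on (orthant_ball t0 r) (\<lambda>t. Y t \<omega>)"
    proof eventually_elim
      case (elim \<omega>)
      have "dyadic_holder (cube a L) (L * CARD('n)) (h / 2) (\<lambda>t. Y t \<omega>)"
      proof (rule dyadic_holder_grid_limit[OF c(2) _ elim])
        fix t assume t: "t \<in> cube a L"
        then show "(\<lambda>n. X (grid_proj a L n t) \<omega>) \<longlonglongrightarrow> Y t \<omega>"
          using grid_holder_convergent[OF c(2) _ elim t] h by (simp add: Y_def convergent_LIMSEQ_iff)
      qed (use h in simp)
      from dyadic_holder_continuous_on[OF this] have "continuous_on (cube a L) (\<lambda>t. Y t \<omega>)"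
        using h c(2) by simp
      then show ?case using c(3) continuous_on_subset by blast
    qed
  qed
  ultimately show ?thesis by blast
qed

context
  fixes Y assumes mod: "modification M orthant Y X" and cont: "continuous_paths_near M t0 Y"
begin

lemma modification_measurable: "t \<in> orthant \<Longrightarrow> Y t \<in> borel_measurable M"
  using mod by (simp add: modification_def)

lemma modification_AE: "t \<in> orthant \<Longrightarrow> AE \<omega> in M. Y t \<omega> = X t \<omega>"
  using mod by (simp add: modification_def)

text \<open>Almost surely \<open>Y\<close> agrees with \<open>X\<close> on all grids at once, since
  these are countable, and a continuous path is the limit of its grid values. The grid bound for
  \<open>X\<close> thus becomes a Hoelder bound of order \<open>h\<close> for \<open>Y\<close>
  itself.\<close>

lemma AE_dim_upper:
  fixes h :: real
  assumes h: "0 < h" "ereal h < \<alpha>"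
  obtains r where "0 < r"
    "AE \<omega> in M. hausdorff_dim (range_over Y \<omega> (orthant_ball t0 r)) \<le> ereal (CARD('n) / h) \<and>
      hausdorff_dim (range_over Y \<omega> (orthant_ball t0 r)) \<le> ereal (CARD('d)) \<and>
      (h \<le> 1 \<longrightarrow> hausdorff_dim (graph_over Y \<omega> (orthant_ball t0 r)) \<le> ereal (CARD('n) / h) \<and>
        hausdorff_dim (graph_over Y \<omega> (orthant_ball t0 r)) \<le> ereal (CARD('n) + CARD('d) * (1 - h)))"
proof -
  obtain \<rho> where \<rho>: "0 < \<rho>" and cont: "AE \<omega> in M. continuous_on (orthant_ball t0 \<rho>) (\<lambda>t. Y t \<omega>)"
    using cont unfolding continuous_paths_near_def by blast
  \<comment> \<open>Moments of order h' > h are needed because the union over the grid consumes part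
    of the exponent.\<close>
  obtain h' where h': "h < h'" "ereal h' < \<alpha>" using ereal_dense2[OF h(2)] by auto
  obtain r a L where c: "0 < r" "0 < L" "orthant_ball t0 r \<subseteq> cube a L" "cube a L \<subseteq> orthant_ball t0 \<rho>"
    and "increment_tail a L h'"
    by (rule ex_cube_tail[OF h'(2) \<rho>]) (iprover intro: that)
  then have tail: "\<And>k. \<exists>C\<ge>0. \<forall>u\<in>cube a L. \<forall>v\<in>cube a L. \<forall>r>0.
      prob {\<omega> \<in> space M. r \<le> dist (X u \<omega>) (X v \<omega>)} \<le> C * (dist u v powr (2 * h') / r\<^sup>2) ^ k"
    by (simp add: increment_tail_def)
  have orth: "cube a L \<subseteq> orthant" using c(4) by (auto simp: orthant_ball_def)
  have G: "grid a L n \<subseteq> cube a L" for n using c(2) by (intro grid_subset_cube) simp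
  have "AE \<omega> in M. grid_holder a L h (\<lambda>u. X u \<omega>)"
    using h h' orth by (intro AE_grid_holder[OF c(2) h'(1)] tail) (auto intro: gaussian_field_measurable[OF field])
  moreover have "AE \<omega> in M. \<forall>u\<in>(\<Union>n. grid a L n). Y u \<omega> = X u \<omega>"
  proof -
    have cnt: "countable (\<Union>n. grid a L n)" by (rule countable_UN) (auto intro: countable_finite finite_grid)
    show ?thesis
      unfolding AE_ball_countable[OF cnt]
    proof
      fix u assume "u \<in> (\<Union>n. grid a L n)"
      then show "AE \<omega> in M. Y u \<omega> = X u \<omega>" using G orth by (intro modification_AE) blast
    qed
  qed
  ultimately have "AE \<omega> in M. dyadic_holder (cube a L) (L * CARD('n)) h (\<lambda>t. Y t \<omega>)"
    using cont
  proof eventually_elim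
    case (elim \<omega>)
    show ?case
    proof (rule dyadic_holder_grid_limit[OF c(2) h(1) elim(1)])
      fix t assume t: "t \<in> cube a L"
      have g: "grid_proj a L n t \<in> grid a L n" for n by (rule grid_proj_in_grid[OF c(2) t])
      have "continuous_on (cube a L) (\<lambda>t. Y t \<omega>)" using elim(3) c(4) by (rule continuous_on_subset)
      then have "(\<lambda>n. Y (grid_proj a L n t) \<omega>) \<longlonglongrightarrow> Y t \<omega>"
        using g G t by (intro continuous_on_tendsto_compose[where f = "\<lambda>t. Y t \<omega>"] grid_proj_tendsto[OF c(2)])
          (auto intro!: always_eventually)
      moreover have "Y (grid_proj a L n t) \<omega> = X (grid_proj a L n t) \<omega>" for n using elim(2) g by blast
      ultimately show "(\<lambda>n. X (grid_proj a L n t) \<omega>) \<longlonglongrightarrow> Y t \<omega>" by simp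
    qed
  qed
  then have "AE \<omega> in M. hausdorff_dim (range_over Y \<omega> (orthant_ball t0 r)) \<le> ereal (CARD('n) / h) \<and>
      hausdorff_dim (range_over Y \<omega> (orthant_ball t0 r)) \<le> ereal (CARD('d)) \<and>
      (h \<le> 1 \<longrightarrow> hausdorff_dim (graph_over Y \<omega> (orthant_ball t0 r)) \<le> ereal (CARD('n) / h) \<and>
        hausdorff_dim (graph_over Y \<omega> (orthant_ball t0 r)) \<le> ereal (CARD('n) + CARD('d) * (1 - h)))"
  proof eventually_elim
    case (elim \<omega>)
    have r: "hausdorff_dim (range_over Y \<omega> (orthant_ball t0 r)) \<le> hausdorff_dim ((\<lambda>t. Y t \<omega>) ` cube a L)"
      unfolding range_over_image using c(3) by (intro hausdorff_dim_mono image_mono)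
    have g: "hausdorff_dim (graph_over Y \<omega> (orthant_ball t0 r)) \<le> hausdorff_dim ((\<lambda>t. (t, Y t \<omega>)) ` cube a L)"
      unfolding graph_over_image using c(3) by (intro hausdorff_dim_mono image_mono)
    have "continuous_on (cube a L) (\<lambda>t. Y t \<omega>)"
      using c(2) h by (intro dyadic_holder_continuous_on[OF elim]) auto
    then have "bounded ((\<lambda>t. Y t \<omega>) ` cube a L)"
      using compact_cube by (intro compact_imp_bounded compact_continuous_image)
    then have 1: "hausdorff_dim ((\<lambda>t. Y t \<omega>) ` cube a L) \<le> ereal (CARD('d))" by (rule hausdorff_dim_bounded_le)
    have 2: "hausdorff_dim ((\<lambda>t. Y t \<omega>) ` cube a L) \<le> ereal (CARD('n) / h)"
      by (rule hausdorff_dim_holder_image[OF c(2) h(1) elim])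
    have 3: "hausdorff_dim ((\<lambda>t. (t, Y t \<omega>)) ` cube a L) \<le> ereal (CARD('n) / h)" if "h \<le> 1"
      using c(2) that by (intro hausdorff_dim_holder_image[OF c(2) h(1)] dyadic_holder_graph[OF elim]) auto
    have 4: "hausdorff_dim ((\<lambda>t. (t, Y t \<omega>)) ` cube a L) \<le> ereal (CARD('n) + CARD('d) * (1 - h))" if "h \<le> 1"
      by (rule hausdorff_dim_graph_le[OF c(2) h(1) that elim])
    show ?case using order_trans[OF r 1] order_trans[OF r 2] order_trans[OF g 3] order_trans[OF g 4] by blast
  qed
  then show thesis by (rule that[OF c(1)])
qed

text \<open>For b > \<beta> the increments have standard deviation scale at least |t - s|^b, so the
  small-ball bound becomes 4^d (r / |t - s|^b)^d. It involves two fixed times and so transfers from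
  \<open>X\<close> to \<open>Y\<close>. A smaller cube inside the ball is enough by monotonicity of
  the dimension.\<close>

lemma AE_dim_lower:
  fixes b \<gamma> \<eta> \<rho> :: real
  assumes b: "0 < b" "\<beta> < ereal b" and \<gamma>: "0 < \<gamma>" "\<gamma> < CARD('d)" and \<eta>: "0 \<le> \<eta>"
    and sum: "b * \<gamma> + \<eta> < CARD('n)" and \<rho>: "0 < \<rho>"
  shows "AE \<omega> in M. ereal (\<gamma> + \<eta>) \<le> hausdorff_dim (graph_over Y \<omega> (orthant_ball t0 \<rho>))"
    and "AE \<omega> in M. ereal \<gamma> \<le> hausdorff_dim (range_over Y \<omega> (orthant_ball t0 \<rho>))"
proof -
  obtain \<rho>1 where \<rho>1: "0 < \<rho>1" and cont: "AE \<omega> in M. continuous_on (orthant_ball t0 \<rho>1) (\<lambda>t. Y t \<omega>)"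
    using cont unfolding continuous_paths_near_def by blast
  obtain \<rho>2 where \<rho>2: "0 < \<rho>2" and bd: "\<And>s t. s \<in> orthant_ball t0 \<rho>2 \<Longrightarrow> t \<in> orthant_ball t0 \<rho>2 \<Longrightarrow> s \<noteq> t \<Longrightarrow>
      dist s t powr (2 * b) \<le> sq_increment M (coord_process X i) s t"
    by (rule sub_exponent_bound[OF b(2)]) (iprover intro: that)
  define \<rho>' where "\<rho>' = min \<rho> (min \<rho>1 \<rho>2)"
  have "0 < \<rho>'" using \<rho> \<rho>1 \<rho>2 by (simp add: \<rho>'_def)
  obtain r a L where c: "0 < r" "0 < L" "orthant_ball t0 r \<subseteq> cube a L" "cube a L \<subseteq> orthant_ball t0 \<rho>'"
    by (rule cube_near[OF t0 \<open>0 < \<rho>'\<close>]) (iprover intro: that)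
  have sub: "cube a L \<subseteq> orthant_ball t0 \<rho>" "cube a L \<subseteq> orthant_ball t0 \<rho>1" "cube a L \<subseteq> orthant_ball t0 \<rho>2"
    "cube a L \<subseteq> orthant"
    using c(4) by (auto simp: orthant_ball_def \<rho>'_def)
  have "AE \<omega> in M. continuous_on (cube a L) (\<lambda>t. Y t \<omega>)"
    using cont by eventually_elim (rule continuous_on_subset[OF _ sub(2)])
  have small: "prob {\<omega> \<in> space M. dist (Y s \<omega>) (Y t \<omega>) \<le> r} \<le> 4 ^ CARD('d) * (r / dist s t powr b) powr real CARD('d)"
    if st: "s \<in> cube a L" "t \<in> cube a L" "s \<noteq> t" and r: "0 < r" for s t r
  proof -
    have o: "s \<in> orthant" "t \<in> orthant" using st sub by auto
    note [measurable] = modification_measurable[OF o(1)] modification_measurable[OF o(2)]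
      gaussian_field_measurable[OF field o(1)] gaussian_field_measurable[OF field o(2)]
    have q: "dist s t powr (2 * b) \<le> sq_increment M (coord_process X i) t s"
      using bd[of t s] st sub by (simp add: dist_commute subset_iff)
    have pos: "0 < dist s t powr (2 * b)" using st(3) by simp
    have "dist s t powr b = sqrt (dist s t powr (2 * b))"
      using st(3) by (simp add: powr_half_sqrt[symmetric] powr_powr)
    then have sq: "dist s t powr b \<le> sqrt (sq_increment M (coord_process X i) t s)"
      using q by simp
    have "prob {\<omega> \<in> space M. dist (Y s \<omega>) (Y t \<omega>) \<le> r} = prob {\<omega> \<in> space M. dist (X s \<omega>) (X t \<omega>) \<le> r}"
    proof (rule finite_measure_eq_AE)
      show "AE \<omega> in M. \<omega> \<in> {\<omega> \<in> space M. dist (Y s \<omega>) (Y t \<omega>) \<le> r}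
          \<longleftrightarrow> \<omega> \<in> {\<omega> \<in> space M. dist (X s \<omega>) (X t \<omega>) \<le> r}"
        using modification_AE[OF o(1)] modification_AE[OF o(2)] by eventually_elim simp
    qed measurable
    also have "\<dots> \<le> (4 * r / sqrt (sq_increment M (coord_process X i) t s)) ^ CARD('d)"
      using r o less_le_trans[OF pos q] by (intro gaussian_field_small_ball[OF prob_space_axioms field]) auto
    also have "\<dots> \<le> (4 * r / dist s t powr b) ^ CARD('d)"
      using sq r st(3) sq_increment_nonneg[of M "coord_process X i" t s]
      by (intro power_mono divide_left_mono) (auto intro!: mult_pos_pos less_le_trans[OF _ sq])
    also have "\<dots> = 4 ^ CARD('d) * (r / dist s t powr b) powr real CARD('d)"
      using r st(3) by (simp add: powr_realpow power_mult_distrib power_divide)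
    finally show ?thesis .
  qed
  have Y: "Y u \<in> borel_measurable M" if "u \<in> cube a L" for u
    using that sub(4) by (auto intro: modification_measurable)
  have K: "0 \<le> (4 :: real) ^ CARD('d)" by simp
  note dims = AE_hausdorff_dim_ge[OF prob_space_axioms c(2) Y \<open>AE \<omega> in M. continuous_on (cube a L) (\<lambda>t. Y t \<omega>)\<close>
      b(1) K small \<gamma> \<eta> sum]
  have "AE \<omega> in M. ereal (\<gamma> + \<eta>) \<le> hausdorff_dim ((\<lambda>t. (t, Y t \<omega>)) ` cube a L)"
    by (rule dims(1))
  then show "AE \<omega> in M. ereal (\<gamma> + \<eta>) \<le> hausdorff_dim (graph_over Y \<omega> (orthant_ball t0 \<rho>))"
  proof eventually_elim
    case (elim \<omega>)
    also have "hausdorff_dim ((\<lambda>t. (t, Y t \<omega>)) ` cube a L) \<le> hausdorff_dim (graph_over Y \<omega> (orthant_ball t0 \<rho>))"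
      unfolding graph_over_image by (intro hausdorff_dim_mono image_mono sub(1))
    finally show ?case .
  qed
  have "AE \<omega> in M. ereal \<gamma> \<le> hausdorff_dim ((\<lambda>t. Y t \<omega>) ` cube a L)"
    by (rule dims(2))
  then show "AE \<omega> in M. ereal \<gamma> \<le> hausdorff_dim (range_over Y \<omega> (orthant_ball t0 \<rho>))"
  proof eventually_elim
    case (elim \<omega>)
    also have "hausdorff_dim ((\<lambda>t. Y t \<omega>) ` cube a L) \<le> hausdorff_dim (range_over Y \<omega> (orthant_ball t0 \<rho>))"
      unfolding range_over_image by (intro hausdorff_dim_mono image_mono sub(1))
    finally show ?case .
  qed
qed

end

end

section \<open>Choosing the free orders and passing to the limit\<close>

lemma ex_exponent_below:
  fixes \<alpha> :: ereal and x N :: real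
  assumes \<alpha>: "0 < \<alpha>" and N: "0 < N" and x: "ereal N / \<alpha> < ereal x"
  shows "\<exists>h>0. ereal h < \<alpha> \<and> N / h \<le> x"
proof -
  have "0 \<le> ereal N / \<alpha>" using \<alpha> N by (cases \<alpha>) auto
  then have x0: "0 < x" using x by (metis ereal_less(2) le_less_trans)
  have "ereal (N / x) < \<alpha>"
  proof (cases \<alpha>)
    case (real c)
    then have "0 < c" "N / c < x" using \<alpha> x by auto
    then show ?thesis using real x0 by (simp add: field_simps)
  qed (use \<alpha> in auto)
  then obtain h where h: "N / x < h" "ereal h < \<alpha>" using ereal_dense2 by force
  then have "0 < h" using N x0 by (meson divide_pos_pos less_trans)
  moreover have "N / h \<le> x" using h(1) x0 \<open>0 < h\<close> by (simp add: field_simps)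
  ultimately show ?thesis using h(2) by blast
qed

text \<open>The case distinction encodes the minimum of N / \<beta> and d, and being below it
  amounts to these two conditions. For infinite \<beta> the bound is 0, which contradicts x >
  0.\<close>

lemma lower_dim_cases:
  fixes \<beta> :: ereal and x N d :: real
  assumes \<beta>: "0 \<le> \<beta>" and N: "0 < N" and x: "0 < x"
    and less: "ereal x < (if ereal N \<le> ereal d * \<beta> then ereal N / \<beta> else ereal d)" and d: "0 < d"
  shows "x < d" "\<beta> * ereal x < ereal N"
proof -
  have "x < d \<and> \<beta> * ereal x < ereal N"
  proof (cases \<beta>)
    case (real c)
    show ?thesis
    proof (cases "N \<le> d * c")
      case True
      then have c: "0 < c" using N \<beta> real d by (cases "c = 0") auto
      have "x < N / c" using less True real c by simp
      then have "x * c < N" using c by (simp add: field_simps)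
      moreover from this have "x * c < d * c" using True by linarith
      ultimately show ?thesis using c real by (simp add: mult.commute)
    next
      case False
      then have "x < d" using less real by simp
      moreover have "c * x \<le> c * d" using \<open>x < d\<close> \<beta> real by (intro mult_left_mono) auto
      ultimately show ?thesis using False real by (simp add: mult.commute)
    qed
  next
    case PInf
    then have False using less x d by simp
    then show ?thesis ..
  qed (use \<beta> in auto)
  then show "x < d" "\<beta> * ereal x < ereal N" by auto
qed

context gaussian_field_at
begin

context
  fixes Y assumes mod: "modification M orthant Y X" and cont: "continuous_paths_near M t0 Y"
begin

lemma sub_exponent_nonneg: "0 \<le> \<beta>"
  unfolding local_sub_exponent_def by (rule Inf_greatest) auto

text \<open>Any b strictly between \<beta> and N / x admits the energy of order \<gamma> = x with
  \<eta> = 0.\<close>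

lemma AE_range_ge:
  fixes x \<rho> :: real
  assumes \<rho>: "0 < \<rho>" and x: "0 < x" "x < CARD('d)" and \<beta>: "\<beta> * ereal x < ereal (CARD('n))"
  shows "AE \<omega> in M. ereal x \<le> hausdorff_dim (range_over Y \<omega> (orthant_ball t0 \<rho>)) \<and>
    ereal x \<le> hausdorff_dim (graph_over Y \<omega> (orthant_ball t0 \<rho>))"
proof -
  have "\<beta> \<noteq> \<infinity>" using \<beta> x by auto
  then obtain c where c: "\<beta> = ereal c" "0 \<le> c" using sub_exponent_nonneg by (cases \<beta>) auto
  then have "c < CARD('n) / x" using \<beta> x by (simp add: field_simps)
  then obtain b where b: "c < b" "b < CARD('n) / x" using dense by blast
  then have "0 < b" "\<beta> < ereal b" "b * x + 0 < CARD('n)" using c x by (auto simp: field_simps)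
  from AE_dim_lower[OF mod cont this(1,2) x order_refl this(3) \<rho>] show ?thesis
    by eventually_elim simp
qed

text \<open>Orders below d are already reached without the time factor. Beyond d, \<gamma> is kept
  slightly below d and the rest of x is carried by \<eta>.\<close>

lemma AE_graph_ge:
  fixes x \<rho> :: real
  assumes \<rho>: "0 < \<rho>" and \<beta>: "ereal (CARD('d)) * \<beta> < ereal (CARD('n))"
    and x: "0 < x" "ereal x < ereal (CARD('n)) + ereal (CARD('d)) * (1 - \<beta>)"
  shows "AE \<omega> in M. ereal x \<le> hausdorff_dim (graph_over Y \<omega> (orthant_ball t0 \<rho>))"
proof -
  let ?N = "real CARD('n)" let ?d = "real CARD('d)"
  have d: "0 < ?d" by simp
  have "\<beta> \<noteq> \<infinity>" using \<beta> by auto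
  then obtain c where c: "\<beta> = ereal c" "0 \<le> c" using sub_exponent_nonneg by (cases \<beta>) auto
  have dc: "?d * c < ?N" using \<beta> c by simp
  have xN: "x < ?N + ?d * (1 - c)" using x c by (simp add: one_ereal_def)
  show ?thesis
  proof (cases "x < ?d")
    case True
    have "c * x \<le> c * ?d" using True c by (intro mult_left_mono) auto
    then have "\<beta> * ereal x < ereal ?N" using dc c by (simp add: mult.commute)
    from AE_range_ge[OF \<rho> x(1) True this] show ?thesis by eventually_elim simp
  next
    case False
    \<comment> \<open>The slack in the target order. Raising b above \<beta> costs \<epsilon> / 4 in
      b d, and lowering \<gamma> below d costs at most another \<epsilon> / 4, so b \<gamma> +
      \<eta> < N survives.\<close>
    define \<epsilon> where "\<epsilon> = ?N + ?d * (1 - c) - x"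
    have \<epsilon>: "0 < \<epsilon>" using xN by (simp add: \<epsilon>_def)
    define b where "b = c + \<epsilon> / (4 * ?d)"
    have b: "0 < b" "\<beta> < ereal b" using \<epsilon> c d by (auto simp: b_def add_nonneg_pos)
    \<comment> \<open>The cap d / 2 keeps \<gamma> = d - \<delta> positive.\<close>
    define \<delta> where "\<delta> = min (\<epsilon> / 4) (?d / 2)"
    have \<delta>: "0 < \<delta>" "\<delta> \<le> \<epsilon> / 4" "\<delta> \<le> ?d / 2" using \<epsilon> d by (auto simp: \<delta>_def)
    have \<gamma>: "0 < ?d - \<delta>" "?d - \<delta> < ?d" using \<delta> d by linarith+
    have \<eta>: "0 \<le> x - (?d - \<delta>)" using False \<delta> by linarith
    have "(b - c) * ?d = \<epsilon> / 4" using d by (simp add: b_def)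
    moreover have "0 \<le> b * \<delta>" using b \<delta> by simp
    ultimately have "b * (?d - \<delta>) + (x - (?d - \<delta>)) < ?N"
      using \<delta>(2) \<epsilon> unfolding \<epsilon>_def by (simp add: algebra_simps)
    from AE_dim_lower(1)[OF mod cont b \<gamma> \<eta> this \<rho>] show ?thesis by simp
  qed
qed

lemma AE_range_le:
  fixes x :: real
  assumes \<alpha>: "0 < \<alpha>" and x: "min (ereal (CARD('n)) / \<alpha>) (ereal (CARD('d))) < ereal x"
  shows "AE \<omega> in M. \<exists>\<rho>>0. hausdorff_dim (range_over Y \<omega> (orthant_ball t0 \<rho>)) \<le> ereal x"
proof -
  obtain h :: real where h: "0 < h" "ereal h < \<alpha>" "CARD('n) / h \<le> x \<or> real CARD('d) < x"
  proof (cases "ereal (CARD('n)) / \<alpha> < ereal x")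
    case True
    then show ?thesis using ex_exponent_below[OF \<alpha> _ True] that by auto
  next
    case False
    then have "real CARD('d) < x" using x by (simp add: min_less_iff_disj)
    \<comment> \<open>The bound by d holds at every order, so any positive h below the exponent
      serves.\<close>
    moreover obtain h where "0 < h" "ereal h < \<alpha>" using ereal_dense2[OF \<alpha>] by auto
    ultimately show ?thesis using that by blast
  qed
  show ?thesis
  proof (rule AE_dim_upper[OF mod cont h(1,2)])
    fix r :: real assume r: "0 < r"
    assume "AE \<omega> in M. hausdorff_dim (range_over Y \<omega> (orthant_ball t0 r)) \<le> ereal (CARD('n) / h) \<and>
      hausdorff_dim (range_over Y \<omega> (orthant_ball t0 r)) \<le> ereal (CARD('d)) \<and>
      (h \<le> 1 \<longrightarrow> hausdorff_dim (graph_over Y \<omega> (orthant_ball t0 r)) \<le> ereal (CARD('n) / h) \<and>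
        hausdorff_dim (graph_over Y \<omega> (orthant_ball t0 r)) \<le> ereal (CARD('n) + CARD('d) * (1 - h)))"
    then show ?thesis
    proof eventually_elim
      case (elim \<omega>)
      have "ereal (CARD('n) / h) \<le> ereal x \<or> ereal (CARD('d)) \<le> ereal x" using h(3) by auto
      then show ?case using elim r by (meson order_trans)
    qed
  qed
qed

lemma holder_exponent_le_1:
  assumes "\<alpha> < \<infinity>" shows "\<alpha> \<le> 1"
  using holder_exponent_gt_1[OF prob_space_axioms gaussian_fieldD(1)[OF field] t0, of i] assms
  by (cases "1 < \<alpha>") auto

lemma AE_graph_le:
  fixes x :: real
  assumes \<alpha>: "0 < \<alpha>" "\<alpha> < \<infinity>"
    and x: "min (ereal (CARD('n)) / \<alpha>) (ereal (CARD('n)) + ereal (CARD('d)) * (1 - \<alpha>)) < ereal x"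
  shows "AE \<omega> in M. \<exists>\<rho>>0. hausdorff_dim (graph_over Y \<omega> (orthant_ball t0 \<rho>)) \<le> ereal x"
proof -
  obtain c where c: "\<alpha> = ereal c" "0 < c" "c \<le> 1"
    using \<alpha> holder_exponent_le_1[OF \<alpha>(2)] by (cases \<alpha>) (auto simp: one_ereal_def)
  obtain h :: real where h: "0 < h" "ereal h < \<alpha>" "CARD('n) / h \<le> x \<or> CARD('n) + CARD('d) * (1 - h) \<le> x"
  proof (cases "ereal (CARD('n)) / \<alpha> < ereal x")
    case True
    then show ?thesis using ex_exponent_below[OF \<alpha>(1) _ True] that by auto
  next
    case False
    then have "CARD('n) + CARD('d) * (1 - c) < x" using x c by (simp add: min_less_iff_disj one_ereal_def)
    \<comment> \<open>The left-hand side is the value of h at which N + d (1 - h) equals x; every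
      larger h keeps the graph bound below x.\<close>
    then have "1 - (x - CARD('n)) / CARD('d) < c" by (simp add: field_simps)
    then obtain h where h: "max 0 (1 - (x - CARD('n)) / CARD('d)) < h" "h < c"
      using dense[of "max 0 (1 - (x - CARD('n)) / CARD('d))" c] c(2) by auto
    have "CARD('n) + CARD('d) * (1 - h) \<le> x" using h(1) by (simp add: field_simps)
    then show ?thesis using that h c(1) by auto
  qed
  have h1: "h \<le> 1" using h(2) c by simp
  show ?thesis
  proof (rule AE_dim_upper[OF mod cont h(1,2)])
    fix r :: real assume r: "0 < r"
    assume "AE \<omega> in M. hausdorff_dim (range_over Y \<omega> (orthant_ball t0 r)) \<le> ereal (CARD('n) / h) \<and>
      hausdorff_dim (range_over Y \<omega> (orthant_ball t0 r)) \<le> ereal (CARD('d)) \<and>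
      (h \<le> 1 \<longrightarrow> hausdorff_dim (graph_over Y \<omega> (orthant_ball t0 r)) \<le> ereal (CARD('n) / h) \<and>
        hausdorff_dim (graph_over Y \<omega> (orthant_ball t0 r)) \<le> ereal (CARD('n) + CARD('d) * (1 - h)))"
    then show ?thesis
    proof eventually_elim
      case (elim \<omega>)
      have "ereal (CARD('n) / h) \<le> ereal x \<or> ereal (CARD('n) + CARD('d) * (1 - h)) \<le> ereal x" using h(3) by auto
      then show ?case using elim r h1 by (meson order_trans)
    qed
  qed
qed

lemma AE_range_limit:
  assumes \<alpha>: "0 < \<alpha>"
  shows "AE \<omega> in M. \<exists>r. ((\<lambda>\<rho>. hausdorff_dim (range_over Y \<omega> (orthant_ball t0 \<rho>))) \<longlongrightarrow> r) (at_right 0) \<and>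
    (if ereal (CARD('n)) \<le> ereal (CARD('d)) * \<beta> then ereal (CARD('n)) / \<beta> else ereal (CARD('d))) \<le> r \<and>
    r \<le> min (ereal (CARD('n)) / \<alpha>) (ereal (CARD('d)))"
proof -
  let ?f = "\<lambda>\<omega> \<rho>. hausdorff_dim (range_over Y \<omega> (orthant_ball t0 \<rho>))"
  let ?lo = "if ereal (CARD('n)) \<le> ereal (CARD('d)) * \<beta> then ereal (CARD('n)) / \<beta> else ereal (CARD('d))"
  let ?hi = "min (ereal (CARD('n)) / \<alpha>) (ereal (CARD('d)))"
  have "AE \<omega> in M. ereal (of_rat q) < ?lo \<longrightarrow> ereal (of_rat q) \<le> ?f \<omega> (1 / real (Suc n))" for q n
  proof (cases "0 < (of_rat q :: real) \<and> ereal (of_rat q) < ?lo")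
    case True
    note cond = lower_dim_cases[OF sub_exponent_nonneg _ _ conjunct2[OF True]]
    have "AE \<omega> in M. ereal (of_rat q) \<le> ?f \<omega> (1 / real (Suc n)) \<and>
        ereal (of_rat q) \<le> hausdorff_dim (graph_over Y \<omega> (orthant_ball t0 (1 / real (Suc n))))"
      using True cond by (intro AE_range_ge) auto
    then show ?thesis by eventually_elim simp
  next
    \<comment> \<open>A rational that is not positive lies below every Hausdorff dimension.\<close>
    case False
    have "ereal (of_rat q) \<le> ?f \<omega> (1 / real (Suc n))" if "ereal (of_rat q) < ?lo" for \<omega>
      using that False hausdorff_dim_nonneg[of "range_over Y \<omega> (orthant_ball t0 (1 / real (Suc n)))"]
      by (intro order_trans[OF _ hausdorff_dim_nonneg]) auto
    then show ?thesis by simp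
  qed
  then have 1: "AE \<omega> in M. \<forall>q n. ereal (of_rat q) < ?lo \<longrightarrow> ereal (of_rat q) \<le> ?f \<omega> (1 / real (Suc n))"
    by (simp only: AE_all_countable) blast
  have "AE \<omega> in M. ?hi < ereal (of_rat q) \<longrightarrow> (\<exists>\<rho>>0. ?f \<omega> \<rho> \<le> ereal (of_rat q))" for q
    using AE_range_le[OF \<alpha>, of "of_rat q"] by (cases "?hi < ereal (of_rat q)") auto
  then have 2: "AE \<omega> in M. \<forall>q. ?hi < ereal (of_rat q) \<longrightarrow> (\<exists>\<rho>>0. ?f \<omega> \<rho> \<le> ereal (of_rat q))"
    by (simp only: AE_all_countable) blast
  from 1 2 show ?thesis
  proof eventually_elim
    case (elim \<omega>)
    show ?case
    proof (rule tendsto_at_right_mono_bounds)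
      show "?f \<omega> x \<le> ?f \<omega> y" if "x \<le> y" for x y
        unfolding range_over_image using that by (intro hausdorff_dim_mono image_mono orthant_ball_mono)
    qed (use elim in blast)+
  qed
qed

text \<open>The upper bound \<infinity> for infinite \<alpha> makes no claim, so one limit argument
  covers both cases. For N \<le> d \<beta> the lower bound is the one of the range, obtained for the
  graph from the same energy choice.\<close>

lemma AE_graph_limit:
  assumes \<alpha>: "0 < \<alpha>"
  shows "AE \<omega> in M. \<exists>g. ((\<lambda>\<rho>. hausdorff_dim (graph_over Y \<omega> (orthant_ball t0 \<rho>))) \<longlongrightarrow> g) (at_right 0) \<and>
    (if ereal (CARD('n)) \<le> ereal (CARD('d)) * \<beta> then ereal (CARD('n)) / \<beta>
     else ereal (CARD('n)) + ereal (CARD('d)) * (1 - \<beta>)) \<le> g \<and>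
    g \<le> (if \<alpha> < \<infinity> then min (ereal (CARD('n)) / \<alpha>) (ereal (CARD('n)) + ereal (CARD('d)) * (1 - \<alpha>)) else \<infinity>)"
proof -
  let ?f = "\<lambda>\<omega> \<rho>. hausdorff_dim (graph_over Y \<omega> (orthant_ball t0 \<rho>))"
  let ?lo = "if ereal (CARD('n)) \<le> ereal (CARD('d)) * \<beta> then ereal (CARD('n)) / \<beta>
     else ereal (CARD('n)) + ereal (CARD('d)) * (1 - \<beta>)"
  let ?hi = "if \<alpha> < \<infinity> then min (ereal (CARD('n)) / \<alpha>) (ereal (CARD('n)) + ereal (CARD('d)) * (1 - \<alpha>)) else \<infinity>"
  have "AE \<omega> in M. ereal (of_rat q) < ?lo \<longrightarrow> ereal (of_rat q) \<le> ?f \<omega> (1 / real (Suc n))" for q n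
  proof (cases "0 < (of_rat q :: real) \<and> ereal (of_rat q) < ?lo")
    case True
    show ?thesis
    proof (cases "ereal (CARD('n)) \<le> ereal (CARD('d)) * \<beta>")
      case le: True
      then have "ereal (of_rat q) < (if ereal (CARD('n)) \<le> ereal (CARD('d)) * \<beta> then ereal (CARD('n)) / \<beta> else ereal (CARD('d)))"
        using True by simp
      note cond = lower_dim_cases[OF sub_exponent_nonneg _ _ this]
      have "AE \<omega> in M. ereal (of_rat q) \<le> hausdorff_dim (range_over Y \<omega> (orthant_ball t0 (1 / real (Suc n)))) \<and>
          ereal (of_rat q) \<le> ?f \<omega> (1 / real (Suc n))"
        using True cond by (intro AE_range_ge) auto
      then show ?thesis by eventually_elim simp
    next
      case False
      then have "AE \<omega> in M. ereal (of_rat q) \<le> ?f \<omega> (1 / real (Suc n))"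
        using True by (intro AE_graph_ge) auto
      then show ?thesis by eventually_elim simp
    qed
  next
    case False
    have "ereal (of_rat q) \<le> ?f \<omega> (1 / real (Suc n))" if "ereal (of_rat q) < ?lo" for \<omega>
    proof (rule order_trans[OF _ hausdorff_dim_nonneg])
      show "ereal (of_rat q) \<le> 0" using that False by (cases "0 < (of_rat q :: real)") auto
    qed
    then show ?thesis by simp
  qed
  then have 1: "AE \<omega> in M. \<forall>q n. ereal (of_rat q) < ?lo \<longrightarrow> ereal (of_rat q) \<le> ?f \<omega> (1 / real (Suc n))"
    by (simp only: AE_all_countable) blast
  have "AE \<omega> in M. ?hi < ereal (of_rat q) \<longrightarrow> (\<exists>\<rho>>0. ?f \<omega> \<rho> \<le> ereal (of_rat q))" for q
  proof (cases "?hi < ereal (of_rat q)")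
    case True
    then have fin: "\<alpha> < \<infinity>" by (auto split: if_splits)
    then have "AE \<omega> in M. \<exists>\<rho>>0. ?f \<omega> \<rho> \<le> ereal (of_rat q)"
      using True by (intro AE_graph_le \<alpha>) auto
    then show ?thesis by eventually_elim simp
  qed simp
  then have 2: "AE \<omega> in M. \<forall>q. ?hi < ereal (of_rat q) \<longrightarrow> (\<exists>\<rho>>0. ?f \<omega> \<rho> \<le> ereal (of_rat q))"
    by (simp only: AE_all_countable) blast
  from 1 2 show ?thesis
  proof eventually_elim
    case (elim \<omega>)
    show ?case
    proof (rule tendsto_at_right_mono_bounds)
      show "?f \<omega> x \<le> ?f \<omega> y" if "x \<le> y" for x y
        unfolding graph_over_image using that by (intro hausdorff_dim_mono image_mono orthant_ball_mono)
    qed (use elim in blast)+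
  qed
qed

end

end

theorem theorem2p2:
  fixes M :: "'w measure"
    and X :: "real ^ 'n \<Rightarrow> 'w \<Rightarrow> real ^ 'd"
    and t0 :: "real ^ 'n"
    and i :: 'd
    and N d \<alpha> \<beta> :: ereal
  assumes "prob_space M"
    and "gaussian_field M X"
    and "t0 \<in> orthant"
    and N_def: "N = ereal (real CARD('n))"
    and d_def: "d = ereal (real CARD('d))"
    and alpha_def: "\<alpha> = local_holder_exponent M (coord_process X i) t0"
    and beta_def: "\<beta> = local_sub_exponent M (coord_process X i) t0"
    and "\<alpha> > 0"
  shows
    "(\<exists>Y. modification M orthant Y X \<and> continuous_paths_near M t0 Y) \<and>
     (\<forall>Y. modification M orthant Y X \<and> continuous_paths_near M t0 Y \<longrightarrow>
       (AE \<omega> in M. \<exists>g r.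
          ((\<lambda>\<rho>. hausdorff_dim (graph_over Y \<omega> (orthant_ball t0 \<rho>))) \<longlongrightarrow> g) (at_right 0) \<and>
          ((\<lambda>\<rho>. hausdorff_dim (range_over Y \<omega> (orthant_ball t0 \<rho>))) \<longlongrightarrow> r) (at_right 0) \<and>
          (if N \<le> d * \<beta> then N / \<beta> else N + d * (1 - \<beta>)) \<le> g \<and>
          (\<alpha> < \<infinity> \<longrightarrow> g \<le> min (N / \<alpha>) (N + d * (1 - \<alpha>))) \<and>
          (if N \<le> d * \<beta> then N / \<beta> else d) \<le> r \<and>
          r \<le> min (N / \<alpha>) d))"
proof -
  interpret gaussian_field_at M X t0 i
    using assms(1-3) by (simp add: gaussian_field_at_def gaussian_field_at_axioms_def)
  have \<alpha>: "0 < local_holder_exponent M (coord_process X i) t0" using assms(8) alpha_def by simp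
  show ?thesis
  proof (intro conjI allI impI)
    show "\<exists>Y. modification M orthant Y X \<and> continuous_paths_near M t0 Y"
      by (rule ex_continuous_modification[OF \<alpha>])
  next
    fix Y assume "modification M orthant Y X \<and> continuous_paths_near M t0 Y"
    then have Y: "modification M orthant Y X" "continuous_paths_near M t0 Y" by auto
    from AE_graph_limit[OF Y \<alpha>] AE_range_limit[OF Y \<alpha>]
    show "AE \<omega> in M. \<exists>g r.
          ((\<lambda>\<rho>. hausdorff_dim (graph_over Y \<omega> (orthant_ball t0 \<rho>))) \<longlongrightarrow> g) (at_right 0) \<and>
          ((\<lambda>\<rho>. hausdorff_dim (range_over Y \<omega> (orthant_ball t0 \<rho>))) \<longlongrightarrow> r) (at_right 0) \<and>
          (if N \<le> d * \<beta> then N / \<beta> else N + d * (1 - \<beta>)) \<le> g \<and>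
          (\<alpha> < \<infinity> \<longrightarrow> g \<le> min (N / \<alpha>) (N + d * (1 - \<alpha>))) \<and>
          (if N \<le> d * \<beta> then N / \<beta> else d) \<le> r \<and>
          r \<le> min (N / \<alpha>) d"
      unfolding N_def d_def alpha_def beta_def
    proof eventually_elim
      case (elim \<omega>)
      then obtain g r where
        "((\<lambda>\<rho>. hausdorff_dim (graph_over Y \<omega> (orthant_ball t0 \<rho>))) \<longlongrightarrow> g) (at_right 0) \<and>
        (if ereal (CARD('n)) \<le> ereal (CARD('d)) * local_sub_exponent M (coord_process X i) t0
         then ereal (CARD('n)) / local_sub_exponent M (coord_process X i) t0
         else ereal (CARD('n)) + ereal (CARD('d)) * (1 - local_sub_exponent M (coord_process X i) t0)) \<le> g \<and>
        g \<le> (if local_holder_exponent M (coord_process X i) t0 < \<infinity>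
          then min (ereal (CARD('n)) / local_holder_exponent M (coord_process X i) t0)
            (ereal (CARD('n)) + ereal (CARD('d)) * (1 - local_holder_exponent M (coord_process X i) t0))
          else \<infinity>)"
        "((\<lambda>\<rho>. hausdorff_dim (range_over Y \<omega> (orthant_ball t0 \<rho>))) \<longlongrightarrow> r) (at_right 0) \<and>
        (if ereal (CARD('n)) \<le> ereal (CARD('d)) * local_sub_exponent M (coord_process X i) t0
         then ereal (CARD('n)) / local_sub_exponent M (coord_process X i) t0 else ereal (CARD('d))) \<le> r \<and>
        r \<le> min (ereal (CARD('n)) / local_holder_exponent M (coord_process X i) t0) (ereal (CARD('d)))"
        by iprover
      then show ?case
        by - (rule exI[of _ g], rule exI[of _ r],
            cases "local_holder_exponent M (coord_process X i) t0 = \<infinity>", simp_all)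
    qed
  qed
qed

end
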